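(* Let $E_2(T)$ be defined by $$\int_0^T|\zeta(\tfrac12+it)|^4\,dt = TP_4(\log T)+E_2(T),$$ where $P_4$ is the polynomial of degree four (with leading coefficient $\frac{1}{2\pi^2}$) for which $E_2(T)=o(T)$, let $Q_4(x)=P_4(x)+P_4'(x)$, and let $\mathcal{K}(s)$ be the analytic continuation to $\operatorname{Re}s>1$ of $$\mathcal{K}(s)=\int_1^\infty\bigl(|\zeta(\tfrac12+ix)|^4-Q_4(\log x)\bigr)E_2(x)x^{-s}\,dx\qquad(\operatorname{Re}s>\tfrac53).$$ Then for every fixed $\sigma>1$ and every $\varepsilon>0$, $$\int_T^{2T}E_2^4(t)\,dt\ll_\varepsilon T^{2\sigma+1}\left(1+\int_0^{T^{1+\varepsilon}}\frac{|\mathcal{K}(\sigma+it)|^2}{1+t^2}\,dt\right)\qquad(T\to\infty).$$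
   Context: $\zeta$ is the Riemann zeta-function. The function $\mathcal{K}(s)$ is regular in $\operatorname{Re}s>1$ (its continuation is given by $\mathcal{K}(s)=-\frac12E_2^2(1)-\frac12 s\int_1^\infty E_2^2(x)x^{-s-1}dx$). Implied constants may depend on $\varepsilon$ and $\sigma$. *)

theory Defs
  imports
    "HOL-Complex_Analysis.Complex_Analysis"
    "HOL-Library.Landau_Symbols"
    "HOL-Computational_Algebra.Polynomial"
begin

definition is_zeta_continuation :: "(complex \<Rightarrow> complex) \<Rightarrow> bool" where
  "is_zeta_continuation Z \<longleftrightarrow>
     Z holomorphic_on (- {1}) \<and>
     (\<forall>s. Re s > 1 \<longrightarrow> (\<lambda>n. of_nat (Suc n) powr (-s)) sums Z s)"

(* The value at the pole s = 1 is arbitrary. *)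
definition riemann_zeta :: "complex \<Rightarrow> complex" where
  "riemann_zeta = (SOME Z. is_zeta_continuation Z)"

lemma open_half_plane: "open {s::complex. Re s > b}"
  by (rule open_halfspace_Re_gt)

lemma half_plane_series:
  fixes f :: "nat \<Rightarrow> complex \<Rightarrow> complex" and C :: "complex \<Rightarrow> real"
  assumes hol: "\<And>n. f n holomorphic_on {s. Re s > b}"
    and C: "continuous_on UNIV C"
    and bd: "\<And>n s. Re s > b \<Longrightarrow> norm (f n s) \<le> C s * real (Suc n) powr (b - Re s - 1)"
  shows "(\<lambda>s. \<Sum>n. f n s) holomorphic_on {s. Re s > b}"
    and "\<And>s. Re s > b \<Longrightarrow> summable (\<lambda>n. f n s)"
proof -
  have sm: "summable (\<lambda>n. B * real (Suc n) powr (b - a - 1))" if "a > b" for a B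
    using that summable_real_powr_iff[of "b - a - 1"]
    by (intro summable_mult) (subst summable_Suc_iff, simp)
  show "summable (\<lambda>n. f n s)" if "Re s > b" for s
    by (rule summable_comparison_test'[OF sm[OF that, of "C s"], of 0]) (use bd[OF that] in auto)
  show "(\<lambda>s. \<Sum>n. f n s) holomorphic_on {s. Re s > b}"
  proof (rule holomorphic_uniform_sequence[where f = "\<lambda>N s. \<Sum>n<N. f n s"])
    show "open {s. Re s > b}" by (rule open_half_plane)
    show "(\<lambda>s. \<Sum>n<N. f n s) holomorphic_on {s. Re s > b}" for N
      by (intro holomorphic_on_sum hol)
    fix x assume x: "x \<in> {s. Re s > b}"
    define d where "d = (Re x - b) / 2"
    have d: "d > 0" using x by (simp add: d_def)
    define a where "a = Re x - d"
    have a: "a > b" using x by (simp add: a_def d_def field_simps)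
    have ge: "Re s \<ge> a" if "s \<in> cball x d" for s
      using that abs_Re_le_cmod[of "x - s"] by (simp add: dist_norm a_def)
    have "bounded (C ` cball x d)"
      by (intro compact_imp_bounded compact_continuous_image continuous_on_subset[OF C]) auto
    then obtain B where B: "\<And>s. s \<in> cball x d \<Longrightarrow> \<bar>C s\<bar> \<le> B"
      unfolding bounded_iff by (metis imageI real_norm_def)
    have "uniform_limit (cball x d) (\<lambda>N s. \<Sum>n<N. f n s) (\<lambda>s. \<Sum>n. f n s) sequentially"
    proof (rule Weierstrass_m_test)
      show "summable (\<lambda>n. B * real (Suc n) powr (b - a - 1))" by (rule sm[OF a])
      fix n s assume s: "s \<in> cball x d"
      have "norm (f n s) \<le> C s * real (Suc n) powr (b - Re s - 1)"
        using ge[OF s] a by (intro bd) auto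
      also have "\<dots> \<le> B * real (Suc n) powr (b - a - 1)"
        using ge[OF s] B[OF s] by (intro mult_mono powr_mono) auto
      finally show "norm (f n s) \<le> B * real (Suc n) powr (b - a - 1)" .
    qed
    moreover have "cball x d \<subseteq> {s. Re s > b}" using ge a by force
    ultimately show "\<exists>d>0. cball x d \<subseteq> {s. Re s > b} \<and>
        uniform_limit (cball x d) (\<lambda>N s. \<Sum>n<N. f n s) (\<lambda>s. \<Sum>n. f n s) sequentially"
      using d by blast
  qed
qed

abbreviation (input) dirichlet_sum :: "complex \<Rightarrow> complex" where
  "dirichlet_sum s \<equiv> (\<Sum>n. of_nat (Suc n) powr (-s))"

lemma norm_of_nat_Suc_powr: "norm (of_nat (Suc n) powr s :: complex) = real (Suc n) powr Re s"
  using norm_powr_real_powr[of "of_nat (Suc n)" s] by simp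

lemma dirichlet_sum_holomorphic: "dirichlet_sum holomorphic_on {s. Re s > 1}"
  and dirichlet_sum_summable: "Re s > 1 \<Longrightarrow> summable (\<lambda>n. of_nat (Suc n) powr (-s) :: complex)"
proof -
  have *: "norm (of_nat (Suc n) powr (-s) :: complex) \<le> 1 * real (Suc n) powr (1 - Re s - 1)" for n s
    using norm_of_nat_Suc_powr[of n "-s"] by simp
  show "dirichlet_sum holomorphic_on {s. Re s > 1}"
    by (rule half_plane_series(1)[where C = "\<lambda>_. 1"]) (intro holomorphic_intros | use * in force)+
  show "Re s > 1 \<Longrightarrow> summable (\<lambda>n. of_nat (Suc n) powr (-s) :: complex)"
    by (rule half_plane_series(2)[where C = "\<lambda>_. 1" and b = 1]) (intro holomorphic_intros | use * in force)+
qed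

(* Existence of the continuation. With c_i(s) = (1-s)(-s)...(2-s-i), the Taylor remainder
   (n+1)^(1-s) - (sum over i <= N of c_i(s)/i! n^(1-s-i)) sums to a holomorphic function on
   Re s > 1-N; summing it termwise for Re s > 1 expresses (s-1) zeta(s) through the values
   of (w-1) zeta(w) at w = s+1, ..., s+N-1, which extends it one strip at a time. *)

definition zeta_coeff :: "nat \<Rightarrow> complex \<Rightarrow> complex" where
  "zeta_coeff i s = (\<Prod>j<i. 1 - s - of_nat j)"

definition zeta_remainder :: "nat \<Rightarrow> nat \<Rightarrow> complex \<Rightarrow> complex" where
  "zeta_remainder N n s = of_nat (Suc (Suc n)) powr (1 - s)
     - (\<Sum>i\<le>N. zeta_coeff i s / fact i * of_nat (Suc n) powr (1 - s - of_nat i))"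

lemma zeta_coeff_holomorphic [holomorphic_intros]: "zeta_coeff i holomorphic_on A"
  unfolding zeta_coeff_def by (intro holomorphic_intros)

lemma zeta_remainder_bound:
  assumes "Re s > 1 - real N"
  shows "norm (zeta_remainder N n s) \<le> norm (zeta_coeff (Suc N) s) * real (Suc n) powr (1 - real N - Re s - 1)"
proof -
  define S where "S = closed_segment (of_nat (Suc n)) (of_nat (Suc (Suc n)) :: complex)"
  define f where "f = (\<lambda>i (x::complex). zeta_coeff i s * x powr (1 - s - of_nat i))"
  have S: "\<exists>y. x = of_real y \<and> y \<ge> real (Suc n)" if "x \<in> S" for x
  proof -
    have "x \<in> closed_segment (of_real (real (Suc n))) (of_real (real (Suc (Suc n))) :: complex)"
      using that by (simp only: S_def of_real_of_nat_eq)
    thus ?thesis unfolding closed_segment_of_real by (auto simp: closed_segment_eq_real_ivl)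
  qed
  have "norm (f 0 (of_nat (Suc (Suc n))) -
      (\<Sum>i\<le>N. f i (of_nat (Suc n)) * (of_nat (Suc (Suc n)) - of_nat (Suc n)) ^ i / fact i))
      \<le> (norm (zeta_coeff (Suc N) s) * real (Suc n) powr (1 - real N - Re s - 1))
         * norm (of_nat (Suc (Suc n)) - of_nat (Suc n) :: complex) ^ Suc N / fact N"
  proof (rule complex_Taylor)
    show "convex S" by (simp add: S_def)
    fix i :: nat and x assume x: "x \<in> S"
    then obtain y where y: "x = of_real y" "y \<ge> real (Suc n)" using S by blast
    hence nz: "x \<notin> \<real>\<^sub>\<le>\<^sub>0" by (auto simp: complex_nonpos_Reals_iff)
    show "(f i has_field_derivative f (Suc i) x) (at x within S)"
      unfolding f_def using nz
      by (auto intro!: derivative_eq_intros simp: zeta_coeff_def algebra_simps)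
  next
    fix x assume x: "x \<in> S"
    then obtain y where y: "x = of_real y" "y \<ge> real (Suc n)" using S by blast
    have "norm (f (Suc N) x) = norm (zeta_coeff (Suc N) s) * y powr (1 - real N - Re s - 1)"
      using y by (simp add: f_def norm_mult norm_powr_real_powr algebra_simps)
    also have "\<dots> \<le> norm (zeta_coeff (Suc N) s) * real (Suc n) powr (1 - real N - Re s - 1)"
      using y assms by (intro mult_left_mono powr_mono2') auto
    finally show "norm (f (Suc N) x) \<le> norm (zeta_coeff (Suc N) s) * real (Suc n) powr (1 - real N - Re s - 1)" .
  qed (auto simp: S_def)
  also have "\<dots> \<le> norm (zeta_coeff (Suc N) s) * real (Suc n) powr (1 - real N - Re s - 1)"
  proof -
    have "x / fact N \<le> x" if "x \<ge> 0" for x :: real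
      using that mult_left_mono[of 1 "fact N" x] by (simp add: divide_le_eq fact_ge_1)
    thus ?thesis by simp
  qed
  also have "of_nat (Suc (Suc n)) - of_nat (Suc n) = (1 :: complex)" by simp
  finally show ?thesis by (simp add: zeta_remainder_def f_def zeta_coeff_def del: of_nat_Suc)
qed

lemma zeta_remainder_holomorphic: "(\<lambda>s. \<Sum>n. zeta_remainder N n s) holomorphic_on {s. Re s > 1 - real N}"
proof (rule half_plane_series(1)[where C = "\<lambda>s. norm (zeta_coeff (Suc N) s)"])
  show "continuous_on UNIV (\<lambda>s. norm (zeta_coeff (Suc N) s))"
    by (intro continuous_intros holomorphic_on_imp_continuous_on holomorphic_intros)
  show "zeta_remainder N n holomorphic_on {s. Re s > 1 - real N}" for n
    unfolding zeta_remainder_def by (intro holomorphic_intros) auto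
qed (use zeta_remainder_bound in auto)

lemma zeta_remainder_sum:
  assumes s: "Re s > 1"
  shows "(\<Sum>n. zeta_remainder N n s) = -1 - (\<Sum>i=1..N. zeta_coeff i s / fact i * dirichlet_sum (s + of_nat i - 1))"
proof -
  have "(\<lambda>n. of_nat (Suc (Suc n)) powr (1 - s) - of_nat (Suc n) powr (1 - s) :: complex) sums (0 - of_nat (Suc 0) powr (1 - s))"
  proof (rule telescope_sums)
    have "(\<lambda>n. real (Suc n) powr (1 - Re s)) \<longlonglongrightarrow> 0"
      using s by (intro tendsto_neg_powr filterlim_compose[OF filterlim_real_sequentially filterlim_Suc]) auto
    thus "(\<lambda>n. of_nat (Suc n) powr (1 - s) :: complex) \<longlonglongrightarrow> 0"
      by (subst tendsto_norm_zero_iff [symmetric]) (simp add: norm_of_nat_Suc_powr del: of_nat_Suc)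
  qed
  hence 1: "(\<lambda>n. of_nat (Suc (Suc n)) powr (1 - s) - of_nat (Suc n) powr (1 - s) :: complex) sums (-1)"
    by simp
  have 2: "(\<lambda>n. \<Sum>i=1..N. zeta_coeff i s / fact i * of_nat (Suc n) powr (1 - s - of_nat i))
     sums (\<Sum>i=1..N. zeta_coeff i s / fact i * dirichlet_sum (s + of_nat i - 1))"
  proof (intro sums_sum sums_mult)
    fix i assume "i \<in> {1..N}"
    hence "Re (s + of_nat i - 1) > 1" using s by simp
    from summable_sums[OF dirichlet_sum_summable[OF this]]
    show "(\<lambda>n. of_nat (Suc n) powr (1 - s - of_nat i)) sums dirichlet_sum (s + of_nat i - 1)"
      by (simp add: algebra_simps)
  qed
  have "zeta_remainder N n s = (of_nat (Suc (Suc n)) powr (1 - s) - of_nat (Suc n) powr (1 - s))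
     - (\<Sum>i=1..N. zeta_coeff i s / fact i * of_nat (Suc n) powr (1 - s - of_nat i))" for n
  proof -
    have "{..N} = insert 0 {1..N}" by auto
    thus ?thesis by (simp add: zeta_remainder_def zeta_coeff_def algebra_simps)
  qed
  thus ?thesis using sums_diff[OF 1 2] by (simp add: sums_iff)
qed

lemma zeta_strip:
  "\<exists>E. E holomorphic_on {s. Re s > 1 - real m} \<and> (\<forall>s. Re s > 1 \<longrightarrow> E s = (s - 1) * dirichlet_sum s)"
proof (induction m)
  case 0
  show ?case
    by (rule exI[of _ "\<lambda>s. (s - 1) * dirichlet_sum s"]) (use dirichlet_sum_holomorphic in \<open>auto intro!: holomorphic_intros\<close>)
next
  case (Suc m)
  then obtain E where E: "E holomorphic_on {s. Re s > 1 - real m}"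
      "\<And>s. Re s > 1 \<Longrightarrow> E s = (s - 1) * dirichlet_sum s" by blast
  define N where "N = Suc m"
  define F where "F = (\<lambda>s. 1 + (\<Sum>n. zeta_remainder N n s)
      - (\<Sum>i=2..N. zeta_coeff (i - 1) s / fact i * E (s + of_nat i - 1)))"
  have holE: "(\<lambda>s. E (s + of_nat i - 1)) holomorphic_on {s. Re s > 1 - real N}" if "i \<ge> 2" for i
  proof -
    have "(E \<circ> (\<lambda>s. s + of_nat i - 1)) holomorphic_on {s. Re s > 1 - real N}"
      by (rule holomorphic_on_compose_gen[OF _ E(1)]) (use that in \<open>auto intro!: holomorphic_intros simp: N_def\<close>)
    thus ?thesis by (simp add: o_def)
  qed
  have "F holomorphic_on {s. Re s > 1 - real N}"
    unfolding F_def by (intro holomorphic_intros zeta_remainder_holomorphic holE) auto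
  moreover have "F s = (s - 1) * dirichlet_sum s" if s: "Re s > 1" for s
  proof -
    have "(\<Sum>n. zeta_remainder N n s) = -1 - (\<Sum>i=1..N. zeta_coeff i s / fact i * dirichlet_sum (s + of_nat i - 1))"
      by (rule zeta_remainder_sum[OF s])
    also have "(\<Sum>i=1..N. zeta_coeff i s / fact i * dirichlet_sum (s + of_nat i - 1))
        = (\<Sum>i=1..N. - (zeta_coeff (i - 1) s / fact i * E (s + of_nat i - 1)))"
    proof (rule sum.cong)
      fix i assume i: "i \<in> {1..N}"
      then obtain j where j: "i = Suc j" by (cases i) auto
      have "E (s + of_nat i - 1) = (s + of_nat i - 1 - 1) * dirichlet_sum (s + of_nat i - 1)"
        by (rule E(2)) (use s i in auto)
      moreover have "zeta_coeff i s = - (zeta_coeff (i - 1) s * (s + of_nat i - 1 - 1))"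
        by (simp add: j zeta_coeff_def algebra_simps)
      ultimately show "zeta_coeff i s / fact i * dirichlet_sum (s + of_nat i - 1) =
          - (zeta_coeff (i - 1) s / fact i * E (s + of_nat i - 1))"
        by simp
    qed auto
    also have "\<dots> = - E s - (\<Sum>i=2..N. zeta_coeff (i - 1) s / fact i * E (s + of_nat i - 1))"
    proof -
      have "{1..N} = insert 1 {2..N}" by (auto simp: N_def)
      thus ?thesis by (simp add: zeta_coeff_def sum_negf)
    qed
    finally show ?thesis using E(2)[OF s] by (simp add: F_def)
  qed
  ultimately show ?case unfolding N_def by blast
qed

lemma is_zeta_continuation_exists: "\<exists>Z. is_zeta_continuation Z"
proof -
  obtain E where E: "\<And>m. E m holomorphic_on {s. Re s > 1 - real m}"
      "\<And>m s. Re s > 1 \<Longrightarrow> E m s = (s - 1) * dirichlet_sum s"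
    using zeta_strip by metis
  have agree: "E m s = E k s" if "m \<le> k" "Re s > 1 - real m" for m k s
  proof (rule analytic_continuation_open[where s = "{s. Re s > 1}" and s' = "{s. Re s > 1 - real m}"
        and f = "E m" and g = "E k"])
    show "{s. Re s > 1} \<noteq> {}" by (auto intro!: exI[of _ 2])
    show "connected {s. Re s > 1 - real m}"
      by (intro convex_connected convex_halfspace_Re_gt)
    show "E k holomorphic_on {s. Re s > 1 - real m}"
      by (rule holomorphic_on_subset[OF E(1)]) (use that in auto)
    show "E m w = E k w" if "w \<in> {s. Re s > 1}" for w
      using E(2)[of w m] E(2)[of w k] that by simp
  qed (use E(1) that(2) in \<open>auto simp: open_half_plane\<close>)
  define M where "M = (\<lambda>s. Suc (nat \<lceil>1 - Re s\<rceil>))"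
  have M: "Re s > 1 - real (M s)" for s unfolding M_def by linarith
  have EM: "E (M s) s = E k s" if "Re s > 1 - real k" for s k
    using agree[OF _ M[of s], of k] agree[OF _ that, of "M s"] by (metis nat_le_linear)
  define Z where "Z = (\<lambda>s. E (M s) s / (s - 1))"
  have "Z holomorphic_on (- {1})"
  proof -
    have "\<exists>f'. (Z has_field_derivative f') (at s)" if s: "s \<in> - {1}" for s
    proof -
      define U where "U = {w. Re w > 1 - real (M s)} - {1}"
      have U: "open U" "s \<in> U" using s M[of s] by (auto simp: U_def open_half_plane open_Diff)
      have "(\<lambda>w. E (M s) w / (w - 1)) holomorphic_on U"
        by (intro holomorphic_intros holomorphic_on_subset[OF E(1)]) (auto simp: U_def)
      hence "Z holomorphic_on U"
        by (rule holomorphic_transform) (auto simp: U_def Z_def EM)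
      thus ?thesis using U holomorphic_on_open by blast
    qed
    thus ?thesis using holomorphic_on_open[of "- {1}" Z] by (simp add: open_Compl)
  qed
  moreover have "(\<lambda>n. of_nat (Suc n) powr (-s)) sums Z s" if "Re s > 1" for s
  proof -
    have "Z s = dirichlet_sum s" using E(2)[OF that, of "M s"] that by (auto simp: Z_def)
    thus ?thesis using summable_sums[OF dirichlet_sum_summable[OF that]] by simp
  qed
  ultimately show ?thesis unfolding is_zeta_continuation_def by blast
qed

lemma is_zeta_continuation_unique:
  assumes "is_zeta_continuation Z" "is_zeta_continuation Z'" "s \<noteq> 1"
  shows "Z s = Z' s"
proof (rule analytic_continuation_open[where s = "{s. Re s > 1}" and s' = "- {1}"
      and f = Z and g = Z'])
  show "{s. Re s > 1} \<noteq> {}" by (auto intro!: exI[of _ 2])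
  show "connected (- {1::complex})"
    by (intro connected_punctured_universe) simp
  show "Z w = Z' w" if "w \<in> {s. Re s > 1}" for w
    using assms that sums_unique2 unfolding is_zeta_continuation_def by blast
qed (use assms in \<open>auto simp: open_half_plane is_zeta_continuation_def\<close>)

lemma riemann_zeta_is_continuation: "is_zeta_continuation riemann_zeta"
  unfolding riemann_zeta_def using is_zeta_continuation_exists by (rule someI_ex)

definition E2 :: "real poly \<Rightarrow> real \<Rightarrow> real" where
  "E2 P T = integral {0..T} (\<lambda>t. norm (riemann_zeta (Complex (1/2) t)) ^ 4) - T * poly P (ln T)"

definition Q4 :: "real poly \<Rightarrow> real poly" where
  "Q4 P = P + pderiv P"

definition K_integral :: "real poly \<Rightarrow> complex \<Rightarrow> complex" where
  "K_integral P s =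
     integral {1..} (\<lambda>x. of_real ((norm (riemann_zeta (Complex (1/2) x)) ^ 4 - poly (Q4 P) (ln x)) * E2 P x)
                          * of_real x powr (-s))"

end

theory Submission
  imports Defs "HOL-Probability.Probability"
begin

text \<open>
  Write \<open>g u = (E2 P (exp u))\<^sup>2\<close> for \<open>u \<ge> 0\<close>. Integration by parts shows that for large \<open>Re s\<close> the Laplace
  transform of \<open>g\<close> is \<open>(2 * K s + (E2 P 1)\<^sup>2) / s\<close>; since \<open>g\<close> is nonnegative and \<open>K\<close> is holomorphic
  on \<open>Re s > 1\<close>, Landau's theorem extends convergence and identity to that half plane. Hence the Fourier
  transform of the integrable function \<open>G u = g u * exp (- \<sigma> * u)\<close> is known in terms of \<open>K\<close>.

  By the polynomial growth of zeta near the critical line, \<open>E2\<close> extends holomorphically to a strip around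
  the real axis with polynomial bounds, so \<open>G\<close> is smooth at scale \<open>1 / T\<close> near \<open>ln T\<close>. Averaging its \<open>m\<close>-th
  difference over a Gaussian of width \<open>1 / Y\<close>, \<open>Y = T powr (1 + \<epsilon> / 2)\<close>, expresses \<open>G\<close> as a combination of Gaussian
  convolutions of \<open>G\<close> up to an error that is bounded once \<open>m\<close> is large. The convolutions have Fourier transforms
  concentrated on \<open>\<bar>t\<bar> \<le> T powr (1 + \<epsilon>)\<close>, and a local Plancherel inequality bounds their mean square
  over \<open>ln T \<le> u \<le> ln (2 * T)\<close> by the mean square of the transform of \<open>G\<close> on that range.
\<close>

section \<open>Growth of zeta near the critical line\<close>

text \<open>No growth of \<open>K\<close> on the line \<open>Re s = \<sigma>\<close> is assumed, and
  Landau's theorem only makes \<open>G\<close> integrable, so its transform is known to be bounded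
  but not to be square-integrable. The frequency cut must therefore come from smoothness of
  \<open>G\<close>, with a Gaussian factor making every integral over \<open>t\<close> converge. For
  \<open>E2\<close> there is only a crude polynomial bound \<open>T ^ n\<close>. A single Gaussian
  average would gain a fixed power of \<open>T / Y\<close>, which need not beat
  \<open>T ^ n\<close>; the average of an \<open>m\<close>-th difference gains
  \<open>(T / Y) ^ m\<close>, and \<open>m\<close> is free. The exponent \<open>\<epsilon>\<close>
  is split in halves: the gap from \<open>T\<close> to \<open>Y\<close> pays for the smoothness
  error, the gap from \<open>Y\<close> to \<open>T powr (1 + \<epsilon>)\<close> for the Gaussian
  tail. Since \<open>G\<close> is cut off at \<open>u = 0\<close> and the smoothness bound is local,
  distant values of \<open>G\<close> enter only through the integral of
  \<open>\<bar>G\<bar>\<close>. The exponent \<open>2 * \<sigma> + 1\<close> is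
  \<open>2 * \<sigma>\<close> from removing the weight in \<open>G\<^sup>2\<close> plus 1 from
  \<open>dt = exp u du\<close>.\<close>

lemma riemann_zeta_eq_remainder:
  assumes "Re s > 0" "s \<noteq> 1"
  shows "(s - 1) * riemann_zeta s = 1 + (\<Sum>n. zeta_remainder 1 n s)"
proof (rule analytic_continuation_open[where s = "{s. Re s > 1}" and s' = "{s. Re s > 0} - {1}"
      and f = "\<lambda>s. (s - 1) * riemann_zeta s" and g = "\<lambda>s. 1 + (\<Sum>n. zeta_remainder 1 n s)"])
  have hol: "riemann_zeta holomorphic_on - {1}"
    using riemann_zeta_is_continuation by (simp add: is_zeta_continuation_def)
  show "(\<lambda>s. (s - 1) * riemann_zeta s) holomorphic_on {s. Re s > 0} - {1}"
    by (intro holomorphic_intros holomorphic_on_subset[OF hol]) auto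
  show "(\<lambda>s. 1 + (\<Sum>n. zeta_remainder 1 n s)) holomorphic_on {s. Re s > 0} - {1}"
    using zeta_remainder_holomorphic[of 1]
    by (intro holomorphic_intros) (auto elim: holomorphic_on_subset)
  show "{s. Re s > 1} \<noteq> {}" by (auto intro!: exI[of _ 2])
  show "connected ({s::complex. Re s > 0} - {1})"
    by (intro connected_open_delete convex_connected convex_halfspace_Re_gt open_half_plane) auto
  fix w assume w: "w \<in> {s. Re s > 1}"
  have "(\<lambda>n. of_nat (Suc n) powr (-w)) sums riemann_zeta w"
    using w riemann_zeta_is_continuation by (simp add: is_zeta_continuation_def)
  \<comment> \<open>For \<open>N = 1\<close> the sum has the single term
    \<open>zeta_coeff 1 w = 1 - w\<close> times zeta itself, while the remainder series converges
    one unit further left, for \<open>Re s > 0\<close>.\<close>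
  with zeta_remainder_sum[of w 1] w
  show "(w - 1) * riemann_zeta w = 1 + (\<Sum>n. zeta_remainder 1 n w)"
    by (simp add: sums_iff zeta_coeff_def algebra_simps)
qed (use assms in \<open>auto simp: open_half_plane open_Diff\<close>)

text \<open>The remainder terms carry \<open>zeta_coeff 2 s\<close>, of size
  \<open>norm (s - 1) * norm s\<close>; dividing by \<open>s - 1\<close> leaves linear growth. The
  strip is the image of \<open>\<bar>Im z\<bar> \<le> 1/4\<close> under
  \<open>1/2 + \<i> * z\<close>, and its left edge gives the exponent \<open>-5/4\<close>.\<close>

lemma riemann_zeta_bound:
  "\<exists>C\<ge>0. \<forall>s. 1/4 \<le> Re s \<longrightarrow> Re s \<le> 3/4 \<longrightarrow> norm (riemann_zeta s) \<le> C * (1 + norm s)"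
proof -
  define S where "S = (\<Sum>n. real (Suc n) powr (-5/4))"
  have sm: "summable (\<lambda>n. real (Suc n) powr (-5/4))"
    using summable_real_powr_iff[of "-5/4"] by (subst summable_Suc_iff) simp
  have S0: "S \<ge> 0" unfolding S_def by (intro suminf_nonneg sm) auto
  have "norm (riemann_zeta s) \<le> (4 + S) * (1 + norm s)" if s: "1/4 \<le> Re s" "Re s \<le> 3/4" for s
  proof -
    have "norm (s - 1) \<ge> 1/4" using abs_Re_le_cmod[of "s - 1"] s by simp
    hence pos: "norm (s - 1) > 0" by linarith
    hence s1: "s \<noteq> 1" by auto
    have bd: "norm (zeta_remainder 1 n s) \<le> norm (zeta_coeff 2 s) * real (Suc n) powr (-5/4)" for n
    proof -
      have "norm (zeta_remainder 1 n s) \<le> norm (zeta_coeff 2 s) * real (Suc n) powr (1 - real 1 - Re s - 1)"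
        using zeta_remainder_bound[of 1 s n] s by (simp add: numeral_2_eq_2)
      also have "\<dots> \<le> norm (zeta_coeff 2 s) * real (Suc n) powr (-5/4)"
        using s by (intro mult_left_mono powr_mono) auto
      finally show ?thesis .
    qed
    have "norm (\<Sum>n. zeta_remainder 1 n s) \<le> (\<Sum>n. norm (zeta_coeff 2 s) * real (Suc n) powr (-5/4))"
      by (rule norm_suminf_le[OF bd summable_mult[OF sm]])
    also have "\<dots> = norm (zeta_coeff 2 s) * S"
      unfolding S_def by (rule suminf_mult[OF sm])
    also have "norm (zeta_coeff 2 s) = norm (s - 1) * norm s"
      by (simp add: zeta_coeff_def numeral_2_eq_2 norm_mult norm_minus_commute)
    finally have "norm ((s - 1) * riemann_zeta s) \<le> 1 + norm (s - 1) * norm s * S"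
      using riemann_zeta_eq_remainder[of s] s s1 norm_triangle_ineq[of 1 "\<Sum>n. zeta_remainder 1 n s"] by simp
    also have "\<dots> \<le> norm (s - 1) * (4 + norm s * S)"
      using \<open>norm (s - 1) \<ge> 1/4\<close> by (simp add: algebra_simps)
    finally have "norm (riemann_zeta s) \<le> 4 + norm s * S"
      using pos by (simp add: norm_mult)
    also have "\<dots> \<le> (4 + S) * (1 + norm s)" using S0 by (simp add: algebra_simps)
    finally show ?thesis .
  qed
  thus ?thesis using S0 by (intro exI[of _ "4 + S"]) auto
qed

text \<open>The function \<open>cnj \<circ> riemann_zeta \<circ> cnj\<close> has the same Dirichlet
  series on \<open>Re s > 1\<close> and is again a continuation, so uniqueness applies. The value at
  1 is arbitrary and has to be excluded.\<close>

lemma riemann_zeta_cnj: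
  assumes "s \<noteq> 1"
  shows "riemann_zeta (cnj s) = cnj (riemann_zeta s)"
proof -
  have hol: "riemann_zeta holomorphic_on - {1}"
    and sums: "\<And>s. Re s > 1 \<Longrightarrow> (\<lambda>n. of_nat (Suc n) powr (-s)) sums riemann_zeta s"
    using riemann_zeta_is_continuation by (auto simp: is_zeta_continuation_def)
  have "is_zeta_continuation (cnj \<circ> riemann_zeta \<circ> cnj)"
    unfolding is_zeta_continuation_def
  proof (intro conjI allI impI)
    have "cnj ` (- {1}) = - {1}"
    proof (intro equalityI subsetI)
      show "x \<in> cnj ` (- {1})" if "x \<in> - {1}" for x
        using that by (intro image_eqI[of _ _ "cnj x"]) auto
    qed auto
    with hol show "(cnj \<circ> riemann_zeta \<circ> cnj) holomorphic_on - {1}"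
      by (intro holomorphic_on_compose_cnj_cnj) (auto simp: open_Compl)
    fix s :: complex assume "Re s > 1"
    hence "(\<lambda>n. of_nat (Suc n) powr (-cnj s)) sums riemann_zeta (cnj s)" by (intro sums) auto
    hence "(\<lambda>n. cnj (of_nat (Suc n) powr (-cnj s))) sums cnj (riemann_zeta (cnj s))"
      by (simp only: sums_cnj)
    moreover have "cnj (of_nat (Suc n) powr (-cnj s)) = of_nat (Suc n) powr (-s)" for n
      by (simp add: cnj_powr del: of_nat_Suc)
    ultimately show "(\<lambda>n. of_nat (Suc n) powr (-s)) sums (cnj \<circ> riemann_zeta \<circ> cnj) s" by simp
  qed
  from is_zeta_continuation_unique[OF this riemann_zeta_is_continuation assms]
  show ?thesis by (metis comp_apply complex_cnj_cnj)
qed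

section \<open>Holomorphic extension of the error term\<close>

text \<open>A modulus is not holomorphic, but on the real axis each factor is the conjugate of the
  other, so this product extends the fourth power of the modulus. Its singularities
  \<open>\<i> / 2\<close> and \<open>- \<i> / 2\<close> lie off \<open>Re z > 0\<close>.\<close>

definition zeta_fourth :: "complex \<Rightarrow> complex" where
  "zeta_fourth z = riemann_zeta (1/2 + \<i> * z) ^ 2 * riemann_zeta (1/2 - \<i> * z) ^ 2"

lemma zeta_fourth_holomorphic: "zeta_fourth holomorphic_on {z. Re z > 0}"
proof -
  have hol: "riemann_zeta holomorphic_on - {1}"
    using riemann_zeta_is_continuation by (simp add: is_zeta_continuation_def)
  have "(riemann_zeta \<circ> (\<lambda>z. 1/2 + \<i> * z)) holomorphic_on {z. Re z > 0}"
    by (rule holomorphic_on_compose_gen[OF _ hol]) (auto intro!: holomorphic_intros simp: complex_eq_iff)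
  moreover have "(riemann_zeta \<circ> (\<lambda>z. 1/2 - \<i> * z)) holomorphic_on {z. Re z > 0}"
    by (rule holomorphic_on_compose_gen[OF _ hol]) (auto intro!: holomorphic_intros simp: complex_eq_iff)
  ultimately show ?thesis
    unfolding zeta_fourth_def[abs_def] by (auto intro!: holomorphic_intros simp: o_def)
qed

lemma zeta_fourth_of_real:
  "zeta_fourth (of_real x) = of_real (norm (riemann_zeta (Complex (1/2) x)) ^ 4)"
proof -
  have 1: "1/2 + \<i> * of_real x = Complex (1/2) x" "1/2 - \<i> * of_real x = cnj (Complex (1/2) x)"
    by (auto simp: complex_eq_iff)
  have "riemann_zeta (cnj (Complex (1/2) x)) = cnj (riemann_zeta (Complex (1/2) x))"
    by (rule riemann_zeta_cnj) (auto simp: complex_eq_iff)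
  hence "zeta_fourth (of_real x) = (riemann_zeta (Complex (1/2) x) * cnj (riemann_zeta (Complex (1/2) x)))\<^sup>2"
    unfolding zeta_fourth_def 1 by (simp add: power_mult_distrib)
  thus ?thesis by (simp add: complex_norm_square[symmetric] flip: power_mult)
qed

lemma zeta_fourth_bound:
  "\<exists>C\<ge>0. \<forall>z. \<bar>Im z\<bar> \<le> 1/4 \<longrightarrow> norm (zeta_fourth z) \<le> C * (1 + norm z) ^ 4"
proof -
  obtain C where C: "C \<ge> 0"
    "\<And>s. 1/4 \<le> Re s \<Longrightarrow> Re s \<le> 3/4 \<Longrightarrow> norm (riemann_zeta s) \<le> C * (1 + norm s)"
    using riemann_zeta_bound by blast
  have "norm (zeta_fourth z) \<le> (2 * C) ^ 4 * (1 + norm z) ^ 4" if z: "\<bar>Im z\<bar> \<le> 1/4" for z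
  proof -
    have *: "norm (riemann_zeta (1/2 + w)) \<le> 2 * C * (1 + norm z)" if "norm w = norm z" "\<bar>Re w\<bar> \<le> 1/4" for w
    proof -
      have "norm (riemann_zeta (1/2 + w)) \<le> C * (1 + norm (1/2 + w))"
        using that by (intro C) auto
      also have "\<dots> \<le> C * (2 * (1 + norm z))"
        using C(1) norm_triangle_ineq[of "1/2" w] that norm_ge_zero[of z] by (intro mult_left_mono) (simp_all del: norm_ge_zero)
      finally show ?thesis by (simp add: algebra_simps)
    qed
    have "norm (zeta_fourth z) = norm (riemann_zeta (1/2 + \<i> * z)) ^ 2 * norm (riemann_zeta (1/2 + - (\<i> * z))) ^ 2"
      by (simp add: zeta_fourth_def norm_mult norm_power)
    also have "\<dots> \<le> (2 * C * (1 + norm z)) ^ 2 * (2 * C * (1 + norm z)) ^ 2"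
      using z by (intro mult_mono power_mono *) (auto simp: norm_mult)
    also have "\<dots> = (2 * C) ^ 4 * (1 + norm z) ^ 4"
      by (simp add: power4_eq_xxxx power2_eq_square)
    finally show ?thesis .
  qed
  thus ?thesis using C(1) by (intro exI[of _ "(2 * C) ^ 4"]) auto
qed

lemma poly_norm_bound:
  fixes p :: "'a::real_normed_field poly"
  shows "\<exists>C\<ge>0. \<exists>n. \<forall>z. norm (poly p z) \<le> C * (1 + norm z) ^ n"
proof (induction p)
  case 0
  show ?case by (intro exI[of _ 0]) auto
next
  case (pCons a p)
  then obtain C n where C: "C \<ge> 0" "\<And>z. norm (poly p z) \<le> C * (1 + norm z) ^ n" by blast
  have "norm (poly (pCons a p) z) \<le> (norm a + C) * (1 + norm z) ^ Suc n" for z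
  proof -
    have "norm (poly (pCons a p) z) \<le> norm a + norm z * norm (poly p z)"
      using norm_triangle_ineq[of a "z * poly p z"] by (simp add: norm_mult)
    also have "\<dots> \<le> norm a * (1 + norm z) ^ Suc n + (1 + norm z) * (C * (1 + norm z) ^ n)"
      using C one_le_power[of "1 + norm z" "Suc n"] mult_left_mono[of 1 "(1 + norm z) ^ Suc n" "norm a"]
      by (intro add_mono mult_mono) auto
    also have "\<dots> = (norm a + C) * (1 + norm z) ^ Suc n" by (simp add: algebra_simps)
    finally show ?thesis .
  qed
  thus ?case using C(1) by (intro exI[of _ "norm a + C"] conjI exI[of _ "Suc n"] allI) auto
qed

lemma continuous_zeta_fourth_real:
  "continuous_on UNIV (\<lambda>t. norm (riemann_zeta (Complex (1/2) t)) ^ 4)"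
proof -
  have hol: "riemann_zeta holomorphic_on - {1}"
    using riemann_zeta_is_continuation by (simp add: is_zeta_continuation_def)
  have "continuous_on UNIV (\<lambda>t. riemann_zeta (Complex (1/2) t))"
    by (rule continuous_on_compose2[OF holomorphic_on_imp_continuous_on[OF hol]])
       (auto intro!: continuous_intros simp: complex_eq_iff Complex_eq)
  thus ?thesis by (intro continuous_intros)
qed

lemma zeta_moment_has_derivative:
  assumes "x > 0"
  shows "((\<lambda>T. integral {0..T} (\<lambda>t. norm (riemann_zeta (Complex (1/2) t)) ^ 4)) has_real_derivative
           norm (riemann_zeta (Complex (1/2) x)) ^ 4) (at x)"
proof -
  have "((\<lambda>T. integral {0..T} (\<lambda>t. norm (riemann_zeta (Complex (1/2) t)) ^ 4)) has_real_derivative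
           norm (riemann_zeta (Complex (1/2) x)) ^ 4) (at x within {0..x+1})"
    using assms by (intro integral_has_real_derivative continuous_on_subset[OF continuous_zeta_fourth_real]) auto
  moreover have "at x within {0..x+1} = at x"
    using assms by (intro at_within_interior) auto
  ultimately show ?thesis by simp
qed

text \<open>Differentiating \<open>T * poly P (ln T)\<close> produces \<open>P + pderiv P\<close>,
  the origin of \<open>Q4\<close>. The integrand of \<open>K_integral\<close> is thus half the
  derivative of the square of \<open>E2\<close>, times a power of \<open>x\<close>.\<close>

lemma E2_has_derivative:
  assumes "x > 0"
  shows "(E2 P has_real_derivative (norm (riemann_zeta (Complex (1/2) x)) ^ 4 - poly (Q4 P) (ln x))) (at x)"
  unfolding E2_def[abs_def] Q4_def using assms
  by (auto intro!: derivative_eq_intros zeta_moment_has_derivative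
        DERIV_chain2[OF poly_DERIV] simp: field_simps)

lemma norm_Ln_bound:
  assumes "norm z \<ge> 1/2"
  shows "1 + norm (Ln z) \<le> 6 * (1 + norm z)"
proof -
  have z: "z \<noteq> 0" using assms by auto
  have "norm (Ln z) \<le> \<bar>ln (norm z)\<bar> + pi"
    using cmod_le[of "Ln z"] z mpi_less_Im_Ln[of z] Im_Ln_le_pi[of z] by (simp add: abs_le_iff)
  moreover have "ln (norm z) \<le> norm z - 1" using z by (intro ln_le_minus_one) auto
  moreover have "- ln (norm z) \<le> 1"
  proof -
    have "- ln (norm z) = ln (1 / norm z)" using z by (simp add: ln_div)
    also have "\<dots> \<le> 1 / norm z - 1" using z by (intro ln_le_minus_one) auto
    also have "\<dots> \<le> 1" using assms z by (simp add: field_simps)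
    finally show ?thesis .
  qed
  ultimately show ?thesis using pi_less_4 assms by (auto simp: abs_if split: if_splits)
qed

text \<open>The moment integral is replaced by a holomorphic primitive of
  \<open>zeta_fourth\<close>, normalised at 1 because 0 is on the boundary of the half plane, and
  \<open>ln\<close> by \<open>Ln\<close>. The polynomial bound in the strip is crude, but both the
  size and the smoothness of \<open>E2\<close> are drawn from it.\<close>

lemma E2_holomorphic_extension:
  obtains Ec C n where "Ec holomorphic_on {z. Re z > 0}"
    and "\<And>x. x > 0 \<Longrightarrow> Ec (of_real x) = of_real (E2 P x)"
    and "C \<ge> 0"
    and "\<And>z. Re z > 1/2 \<Longrightarrow> \<bar>Im z\<bar> \<le> 1/4 \<Longrightarrow> norm (Ec z) \<le> C * (1 + norm z) ^ n"
proof -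
  let ?I = "\<lambda>T. integral {0..T} (\<lambda>t. norm (riemann_zeta (Complex (1/2) t)) ^ 4)"
  have cv: "convex {z. Re z > 0}" by (rule convex_halfspace_Re_gt)
  obtain H where H: "\<And>z. Re z > 0 \<Longrightarrow> (H has_field_derivative zeta_fourth z) (at z)"
    using holomorphic_convex_primitive'[OF cv open_half_plane zeta_fourth_holomorphic]
      at_within_open[OF _ open_half_plane[of 0]] by (metis mem_Collect_eq)
  \<comment> \<open>On the positive reals \<open>H\<close> and the moment integral have the same
    derivative, so they differ by a constant.\<close>
  have HI: "H (of_real x) - H 1 = of_real (?I x - ?I 1)" if "x > 0" for x
  proof -
    obtain c where c: "\<And>x. x \<in> {0<..} \<Longrightarrow> H (of_real x) - of_real (?I x) = c"
    proof (rule has_vector_derivative_zero_constant[where f = "\<lambda>x. H (of_real x) - of_real (?I x)"])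
      show "convex {0::real<..}" by (rule convex_real_interval)
      fix x :: real assume x: "x \<in> {0<..}"
      have "((\<lambda>x. H (of_real x)) has_vector_derivative zeta_fourth (of_real x)) (at x)"
        using x by (intro has_vector_derivative_real_field H) auto
      moreover have "((\<lambda>x. of_real (?I x)) has_vector_derivative zeta_fourth (of_real x)) (at x)"
        unfolding zeta_fourth_of_real using x
        by (intro has_vector_derivative_of_real)
           (auto intro: zeta_moment_has_derivative simp: has_real_derivative_iff_has_vector_derivative[symmetric])
      ultimately have "((\<lambda>x. H (of_real x) - of_real (?I x)) has_vector_derivative 0) (at x)"
        using has_vector_derivative_diff by fastforce
      thus "((\<lambda>x. H (of_real x) - of_real (?I x)) has_vector_derivative 0) (at x within {0<..})"
        by (rule has_vector_derivative_at_within)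
    qed blast
    from c[of x] c[of 1] that show ?thesis by (simp add: algebra_simps)
  qed
  define p where "p = (map_poly of_real P :: complex poly)"
  have p: "poly p (of_real x) = of_real (poly P x)" for x
    unfolding p_def by (induction P) (auto simp: map_poly_pCons)
  define Ec where "Ec = (\<lambda>z. H z - H 1 + of_real (?I 1) - z * poly p (Ln z))"
  obtain C1 where C1: "C1 \<ge> 0" "\<And>z. \<bar>Im z\<bar> \<le> 1/4 \<Longrightarrow> norm (zeta_fourth z) \<le> C1 * (1 + norm z) ^ 4"
    using zeta_fourth_bound by blast
  obtain C2 k where C2: "C2 \<ge> 0" "\<And>z. norm (poly p z) \<le> C2 * (1 + norm z) ^ k"
    using poly_norm_bound[of p] by blast
  define C where "C = C1 * 2 ^ 4 + \<bar>?I 1\<bar> + C2 * 6 ^ k"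
  show ?thesis
  proof
    have "H holomorphic_on {z. Re z > 0}"
      using H open_half_plane[of 0] by (auto simp: holomorphic_on_open)
    moreover have "(\<lambda>z. poly p (Ln z)) holomorphic_on {z. Re z > 0}"
      by (intro holomorphic_intros) (auto simp: complex_nonpos_Reals_iff)
    ultimately show "Ec holomorphic_on {z. Re z > 0}"
      unfolding Ec_def by (intro holomorphic_on_diff holomorphic_on_add holomorphic_on_mult) (auto intro: holomorphic_intros)
    show "Ec (of_real x) = of_real (E2 P x)" if "x > 0" for x
      using HI[OF that] that by (simp add: Ec_def E2_def p Ln_of_real)
    show "C \<ge> 0" using C1(1) C2(1) by (simp add: C_def)
    fix z assume z: "Re z > 1/2" "\<bar>Im z\<bar> \<le> 1/4"
    have z1: "norm z \<ge> 1/2" using z abs_Re_le_cmod[of z] by linarith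
    define R where "R = 1 + norm z"
    have R: "R \<ge> 1" by (simp add: R_def)
    \<comment> \<open>A convex set containing both 1 and \<open>z\<close>, so that the mean value
      inequality bounds \<open>H z - H 1\<close> through the size of \<open>zeta_fourth\<close>
      there.\<close>
    define D where "D = {w. Re w > 0} \<inter> {w. Im w \<le> 1/4} \<inter> {w. Im w \<ge> -1/4} \<inter> cball 0 R"
    have "norm (H z - H 1) \<le> C1 * (1 + R) ^ 4 * norm (z - 1)"
    proof (rule field_differentiable_bound[of D])
      show "convex D" unfolding D_def
        by (intro convex_Int convex_halfspace_Re_gt convex_halfspace_Im_le convex_halfspace_Im_ge convex_cball)
      show "(H has_field_derivative zeta_fourth w) (at w within D)" if "w \<in> D" for w
        using that by (intro has_field_derivative_at_within[OF H]) (auto simp: D_def)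
      fix w assume w: "w \<in> D"
      have "norm (zeta_fourth w) \<le> C1 * (1 + norm w) ^ 4" using w by (intro C1) (auto simp: D_def)
      also have "\<dots> \<le> C1 * (1 + R) ^ 4"
        using w C1(1) by (intro mult_left_mono power_mono) (auto simp: D_def)
      finally show "norm (zeta_fourth w) \<le> C1 * (1 + R) ^ 4" .
    qed (use z in \<open>auto simp: D_def R_def\<close>)
    also have "\<dots> \<le> C1 * (2 * R) ^ 4 * R"
      using C1(1) R norm_triangle_ineq4[of z 1] by (intro mult_mono power_mono) (auto simp: R_def)
    also have "\<dots> = C1 * 2 ^ 4 * R ^ 5" by (simp add: power_mult_distrib eval_nat_numeral)
    also have "\<dots> \<le> C1 * 2 ^ 4 * R ^ (k + 5)"
      using C1(1) R by (intro mult_left_mono power_increasing) auto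
    finally have b1: "norm (H z - H 1) \<le> C1 * 2 ^ 4 * R ^ (k + 5)" .
    have b2: "\<bar>?I 1\<bar> \<le> \<bar>?I 1\<bar> * R ^ (k + 5)"
      using R one_le_power[of R "k+5"] mult_left_mono[of 1 "R ^ (k+5)" "\<bar>?I 1\<bar>"] by simp
    have "norm (z * poly p (Ln z)) \<le> R * (C2 * (1 + norm (Ln z)) ^ k)"
      unfolding norm_mult using R C2 by (intro mult_mono) (auto simp: R_def)
    also have "\<dots> \<le> R * (C2 * (6 * R) ^ k)"
      using R C2(1) norm_Ln_bound[OF z1] by (intro mult_left_mono power_mono) (auto simp: R_def)
    also have "\<dots> = C2 * 6 ^ k * R ^ (k + 1)" by (simp add: power_mult_distrib)
    also have "\<dots> \<le> C2 * 6 ^ k * R ^ (k + 5)"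
      using C2(1) R by (intro mult_left_mono power_increasing) auto
    finally have b3: "norm (z * poly p (Ln z)) \<le> C2 * 6 ^ k * R ^ (k + 5)" .
    have "norm (Ec z) \<le> norm (H z - H 1) + \<bar>?I 1\<bar> + norm (z * poly p (Ln z))"
      unfolding Ec_def using norm_triangle_ineq4[of "H z - H 1 + of_real (?I 1)" "z * poly p (Ln z)"]
        norm_triangle_ineq[of "H z - H 1" "of_real (?I 1)"] by simp
    \<comment> \<open>The primitive contributes \<open>R ^ 5\<close> and the logarithmic term
      \<open>R ^ (k + 1)\<close>; the exponent \<open>k + 5\<close> covers both.\<close>
    also have "\<dots> \<le> C * R ^ (k + 5)"
      using b1 b2 b3 by (simp add: C_def algebra_simps)
    finally show "norm (Ec z) \<le> C * (1 + norm z) ^ (k + 5)" by (simp add: R_def)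
  qed
qed

text \<open>Needed to dominate the integrand of \<open>K_integral\<close> when \<open>Re s\<close>
  is large.\<close>

lemma E2_derivative_bound:
  "\<exists>C\<ge>0. \<exists>n. \<forall>x\<ge>1. \<bar>norm (riemann_zeta (Complex (1/2) x)) ^ 4 - poly (Q4 P) (ln x)\<bar> \<le> C * (1 + x) ^ n"
proof -
  obtain C1 where C1: "C1 \<ge> 0" "\<And>z. \<bar>Im z\<bar> \<le> 1/4 \<Longrightarrow> norm (zeta_fourth z) \<le> C1 * (1 + norm z) ^ 4"
    using zeta_fourth_bound by blast
  obtain C2 k where C2: "C2 \<ge> 0" "\<And>x. \<bar>poly (Q4 P) x\<bar> \<le> C2 * (1 + \<bar>x\<bar>) ^ k"
    using poly_norm_bound[of "Q4 P"] by auto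
  have "\<bar>norm (riemann_zeta (Complex (1/2) x)) ^ 4 - poly (Q4 P) (ln x)\<bar> \<le> (C1 + C2) * (1 + x) ^ (k + 4)"
    if x: "x \<ge> 1" for x
  proof -
    have "norm (zeta_fourth (of_real x)) \<le> C1 * (1 + x) ^ 4"
      using C1(2)[of "of_real x"] x by simp
    hence "norm (riemann_zeta (Complex (1/2) x)) ^ 4 \<le> C1 * (1 + x) ^ 4"
      unfolding zeta_fourth_of_real by (simp add: norm_power)
    also have "\<dots> \<le> C1 * (1 + x) ^ (k + 4)"
      using C1(1) x by (intro mult_left_mono power_increasing) auto
    finally have 1: "norm (riemann_zeta (Complex (1/2) x)) ^ 4 \<le> C1 * (1 + x) ^ (k + 4)" .
    have "\<bar>poly (Q4 P) (ln x)\<bar> \<le> C2 * (1 + \<bar>ln x\<bar>) ^ k" by (rule C2)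
    also have "\<dots> \<le> C2 * (1 + x) ^ k"
      using C2(1) x ln_le_minus_one[of x] by (intro mult_left_mono power_mono) auto
    also have "\<dots> \<le> C2 * (1 + x) ^ (k + 4)"
      using C2(1) x by (intro mult_left_mono power_increasing) auto
    finally have 2: "\<bar>poly (Q4 P) (ln x)\<bar> \<le> C2 * (1 + x) ^ (k + 4)" .
    have "\<bar>a - b\<bar> \<le> a + \<bar>b\<bar>" if "a \<ge> 0" for a b :: real using that by linarith
    from this[of "norm (riemann_zeta (Complex (1/2) x)) ^ 4" "poly (Q4 P) (ln x)"] 1 2
    show ?thesis by (simp add: distrib_right)
  qed
  thus ?thesis using C1(1) C2(1) by (intro exI[of _ "C1 + C2"] conjI exI[of _ "k + 4"]) auto
qed

section \<open>Landau's theorem for Laplace transforms\<close>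

text \<open>Expand \<open>exp (- (s * u))\<close> about \<open>c\<close>: apart from the factor
  \<open>exp (- (c * u))\<close> the terms are at most \<open>(r * u) ^ n / fact n\<close> in
  modulus, with sum \<open>exp (r * u)\<close>, so integrability at the leftmost point
  \<open>c - r\<close> dominates the whole series on the closed disc. Vanishing for
  \<open>u < 0\<close> allows \<open>\<bar>u\<bar>\<close> to be read as \<open>u\<close>.\<close>

lemma laplace_power_series:
  fixes g :: "real \<Rightarrow> real" and c r :: real and s :: complex
  assumes [measurable]: "g \<in> borel_measurable borel"
    and supp: "\<And>u. u < 0 \<Longrightarrow> g u = 0"
    and int: "integrable lborel (\<lambda>u. g u * exp (- ((c - r) * u)))"
    and s: "norm (s - of_real c) \<le> r"
  shows "integrable lborel (\<lambda>u. of_real (g u) * exp (- (s * of_real u)))"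
    and "(\<lambda>n. (\<integral>u. of_real (g u * exp (- (c * u)) * (-u) ^ n / fact n) \<partial>lborel) * (s - of_real c) ^ n)
           sums (\<integral>u. of_real (g u) * exp (- (s * of_real u)) \<partial>lborel)"
    and "integrable lborel (\<lambda>u. of_real (g u * exp (- (c * u)) * (-u) ^ n / fact n) * (s - of_real c) ^ n :: complex)"
proof -
  define f where "f = (\<lambda>n u. of_real (g u * exp (- (c * u)) * (-u) ^ n / fact n) * (s - of_real c) ^ n :: complex)"
  define B where "B = (\<lambda>u. \<bar>g u * exp (- ((c - r) * u))\<bar>)"
  have intB: "integrable lborel B" unfolding B_def by (rule integrable_abs[OF int])
  have nf: "norm (f n u) = \<bar>g u\<bar> * exp (- (c * u)) * ((\<bar>u\<bar> * norm (s - of_real c)) ^ n / fact n)" for n u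
    by (simp add: f_def norm_mult norm_power norm_divide power_mult_distrib abs_mult power_abs del: of_real_mult)
  have B_eq: "B u = \<bar>g u\<bar> * exp (- (c * u)) * exp (r * \<bar>u\<bar>)" for u
    using supp[of u] by (cases "u < 0") (auto simp: B_def abs_mult algebra_simps simp flip: exp_add)
  have partial: "(\<Sum>n<N. norm (f n u)) \<le> B u" for N u
  proof -
    have "(\<Sum>n<N. (\<bar>u\<bar> * norm (s - of_real c)) ^ n / fact n) \<le> (\<Sum>n<N. (\<bar>u\<bar> * r) ^ n / fact n)"
      using s by (intro sum_mono divide_right_mono power_mono mult_left_mono) auto
    also have "\<dots> \<le> exp (\<bar>u\<bar> * r)"
    proof -
      have "r \<ge> 0" using s norm_ge_zero order_trans by blast
      hence "(\<Sum>n<N. (\<bar>u\<bar> * r) ^ n /\<^sub>R fact n) \<le> (\<Sum>n. (\<bar>u\<bar> * r) ^ n /\<^sub>R fact n)"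
        by (intro sum_le_suminf summable_exp_generic) auto
      thus ?thesis by (simp add: exp_def field_simps)
    qed
    finally have exp: "(\<Sum>n<N. (\<bar>u\<bar> * norm (s - of_real c)) ^ n / fact n) \<le> exp (\<bar>u\<bar> * r)" .
    have "(\<Sum>n<N. norm (f n u)) = \<bar>g u\<bar> * exp (- (c * u)) * (\<Sum>n<N. (\<bar>u\<bar> * norm (s - of_real c)) ^ n / fact n)"
      by (simp add: nf sum_distrib_left)
    also have "\<dots> \<le> \<bar>g u\<bar> * exp (- (c * u)) * exp (\<bar>u\<bar> * r)"
      by (intro mult_left_mono exp) auto
    finally show ?thesis unfolding B_eq by (simp add: mult.commute)
  qed
  have le: "norm (f n u) \<le> B u" for n u
  proof -
    have "norm (f n u) \<le> (\<Sum>k<Suc n. norm (f k u))" by (rule member_le_sum) auto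
    also have "\<dots> \<le> B u" by (rule partial)
    finally show ?thesis .
  qed
  have meas: "f n \<in> borel_measurable lborel" for n unfolding f_def by measurable
  have intf: "integrable lborel (f n)" for n
    by (rule Bochner_Integration.integrable_bound[OF intB meas]) (use le in \<open>auto simp: B_def\<close>)
  thus "integrable lborel (\<lambda>u. of_real (g u * exp (- (c * u)) * (-u) ^ n / fact n) * (s - of_real c) ^ n :: complex)"
    by (simp add: f_def)
  have 1: "AE u in lborel. summable (\<lambda>n. norm (f n u))"
    by (intro AE_I2 summableI_nonneg_bounded[where x = "B _"]) (auto intro: partial)
  have 2: "summable (\<lambda>n. \<integral>u. norm (f n u) \<partial>lborel)"
  proof (rule summableI_nonneg_bounded)
    show "(\<Sum>n<N. \<integral>u. norm (f n u) \<partial>lborel) \<le> (\<integral>u. B u \<partial>lborel)" for N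
    proof -
      have "(\<Sum>n<N. \<integral>u. norm (f n u) \<partial>lborel) = (\<integral>u. (\<Sum>n<N. norm (f n u)) \<partial>lborel)"
        by (intro Bochner_Integration.integral_sum[symmetric] integrable_norm intf)
      also have "\<dots> \<le> (\<integral>u. B u \<partial>lborel)"
        by (intro integral_mono intB Bochner_Integration.integrable_sum integrable_norm intf partial)
      finally show ?thesis .
    qed
  qed auto
  have sum: "(\<Sum>n. f n u) = of_real (g u) * exp (- (s * of_real u))" for u
  proof -
    have "(\<lambda>n. of_real (g u * exp (- (c * u))) * ((- of_real u * (s - of_real c)) ^ n /\<^sub>R fact n))
        sums (of_real (g u * exp (- (c * u))) * exp (- of_real u * (s - of_real c)))"
      by (intro sums_mult exp_converges)
    moreover have "of_real (g u * exp (- (c * u))) * exp (- of_real u * (s - of_real c)) = of_real (g u) * exp (- (s * of_real u))"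
    proof -
      have "of_real (exp (- (c * u))) * exp (- of_real u * (s - of_real c)) = exp (- (s * of_real u))"
        by (simp add: algebra_simps flip: exp_of_real exp_add)
      thus ?thesis by (simp add: mult.assoc)
    qed
    moreover have "of_real (g u * exp (- (c * u))) * ((- of_real u * (s - of_real c)) ^ n /\<^sub>R fact n) = f n u" for n
      unfolding power_mult_distrib by (simp add: f_def scaleR_conv_of_real field_simps)
    ultimately show ?thesis by (simp add: sums_iff)
  qed
  show "integrable lborel (\<lambda>u. of_real (g u) * exp (- (s * of_real u)))"
    using integrable_suminf[OF intf 1 2] by (simp add: sum)
  have "(\<lambda>n. integral\<^sup>L lborel (f n)) sums (\<integral>u. of_real (g u) * exp (- (s * of_real u)) \<partial>lborel)"
    using sums_integral[OF intf 1 2] by (simp add: sum)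
  thus "(\<lambda>n. (\<integral>u. of_real (g u * exp (- (c * u)) * (-u) ^ n / fact n) \<partial>lborel) * (s - of_real c) ^ n)
           sums (\<integral>u. of_real (g u) * exp (- (s * of_real u)) \<partial>lborel)"
    by (simp only: f_def integral_mult_left_zero)
qed

lemma power_series_unique:
  fixes a b :: "nat \<Rightarrow> complex"
  assumes "r > 0"
    and "\<And>w. norm (w - z) < r \<Longrightarrow> (\<lambda>n. a n * (w - z) ^ n) sums f w"
    and "\<And>w. norm (w - z) < r \<Longrightarrow> (\<lambda>n. b n * (w - z) ^ n) sums f w"
  shows "a = b"
proof (rule ext, rule ccontr)
  fix n assume n: "a n \<noteq> b n"
  have sums: "(\<lambda>n. (a n - b n) * (w - z) ^ n) sums 0" if "norm (w - z) < r" for w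
    using sums_diff[OF assms(2,3)[OF that]] by (simp add: algebra_simps)
  have "n > 0"
  proof (rule ccontr)
    assume "\<not> n > 0"
    moreover have "(\<lambda>n. (a n - b n) * 0 ^ n) sums (a 0 - b 0)" by (rule powser_sums_zero)
    ultimately show False using sums[of z] n assms(1) sums_unique2 by fastforce
  qed
  \<comment> \<open>A power series with a nonzero coefficient of positive index and value 0 at the
    centre has no zeros in some punctured disc, but the sum here is the constant 0.\<close>
  obtain t where t: "t > 0" "\<And>w. w \<in> cball z t - {z} \<Longrightarrow> (0::complex) \<noteq> 0"
    by (rule powser_0_nonzero[where f = "\<lambda>_. 0", OF assms(1) sums]) (use n \<open>n > 0\<close> in auto)
  moreover have "z + of_real t \<in> cball z t - {z}" using t(1) by (auto simp: dist_norm)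
  ultimately show False by blast
qed

text \<open>Landau's theorem. Expand \<open>N\<close> about a large real \<open>c\<close>: up to the sign \<open>(-1) ^ n\<close> the Taylor
  coefficients are integrals of nonnegative functions, so convergence of the Taylor series at \<open>c - r\<close>
  for \<open>r < c - b\<close> allows summation under the integral, which yields convergence of the integral at \<open>c - r\<close>.\<close>

lemma landau_laplace:
  fixes g :: "real \<Rightarrow> real" and b c0 :: real and N :: "complex \<Rightarrow> complex"
  assumes meas [measurable]: "g \<in> borel_measurable borel"
    and supp: "\<And>u. u < 0 \<Longrightarrow> g u = 0" and nonneg: "\<And>u. g u \<ge> 0"
    and hol: "N holomorphic_on {s. Re s > b}"
    and int: "\<And>s. Re s > c0 \<Longrightarrow> integrable lborel (\<lambda>u. of_real (g u) * exp (- (s * of_real u)))"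
    and eq: "\<And>s. Re s > c0 \<Longrightarrow> N s = (\<integral>u. of_real (g u) * exp (- (s * of_real u)) \<partial>lborel)"
    and s: "Re s > b"
  shows "integrable lborel (\<lambda>u. of_real (g u) * exp (- (s * of_real u)))"
    and "N s = (\<integral>u. of_real (g u) * exp (- (s * of_real u)) \<partial>lborel)"
proof -
  \<comment> \<open>For \<open>c > b\<close>, the disc about \<open>c\<close> of radius
    \<open>c - b\<close> contains \<open>s\<close> exactly when \<open>(Re s)\<^sup>2 + (Im
    s)\<^sup>2 - b\<^sup>2 < 2 * c * (Re s - b)\<close>, because the squares of \<open>c\<close>
    cancel; every large \<open>c\<close> satisfies this.\<close>
  define c where "c = max (max (c0 + 1) (b + 1)) (((Re s)\<^sup>2 + (Im s)\<^sup>2 - b\<^sup>2) / (2 * (Re s - b)) + 1)"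
  have c: "c > c0 + 1/2" "c > b" by (auto simp: c_def)
  define r where "r = norm (s - of_real c)"
  have r: "r < c - b"
  proof -
    have "((Re s)\<^sup>2 + (Im s)\<^sup>2 - b\<^sup>2) / (2 * (Re s - b)) < c" by (auto simp: c_def)
    hence "(Re s)\<^sup>2 + (Im s)\<^sup>2 - b\<^sup>2 < c * (2 * (Re s - b))"
      using s by (simp add: divide_less_eq)
    hence "r\<^sup>2 < (c - b)\<^sup>2"
      unfolding r_def cmod_power2 by (simp add: power2_eq_square algebra_simps)
    thus ?thesis using c by (simp add: power2_less_imp_less)
  qed
  have r0: "r \<ge> 0" by (simp add: r_def)
  define a where "a = (\<lambda>n. (\<integral>u. of_real (g u * exp (- (c * u)) * (-u) ^ n / fact n) \<partial>lborel) :: complex)"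
  have int_half: "integrable lborel (\<lambda>u. g u * exp (- ((c - 1/2) * u)))"
  proof -
    have "integrable lborel (\<lambda>u. of_real (g u) * exp (- (of_real (c - 1/2) * of_real u)) :: complex)"
      by (rule int) (use c in auto)
    hence "integrable lborel (\<lambda>u. complex_of_real (g u * exp (- ((c - 1/2) * u))))"
      by (simp add: exp_of_real[symmetric])
    thus ?thesis by (simp only: complex_of_real_integrable_eq)
  qed
  have ball: "ball (of_real c) (c - b) \<subseteq> {s. Re s > b}"
  proof
    fix w assume "w \<in> ball (complex_of_real c) (c - b)"
    thus "w \<in> {s. Re s > b}" using abs_Re_le_cmod[of "of_real c - w"] by (auto simp: dist_norm)
  qed
  have taylor: "(\<lambda>n. (deriv ^^ n) N (of_real c) / fact n * (w - of_real c) ^ n) sums N w"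
    if "norm (w - of_real c) < c - b" for w
    by (rule holomorphic_power_series[OF holomorphic_on_subset[OF hol ball]])
       (use that in \<open>auto simp: dist_norm norm_minus_commute\<close>)
  \<comment> \<open>Near \<open>c\<close> both series represent \<open>N\<close>, so their
    coefficients agree. The series with coefficients \<open>a\<close> then converges on the full
    disc of radius \<open>c - b\<close>, where the integral is not yet known to exist.\<close>
  have "a = (\<lambda>n. (deriv ^^ n) N (of_real c) / fact n)"
  proof (rule power_series_unique[of "min (1/2) (c - b)" "of_real c" _ N])
    fix w assume w: "norm (w - complex_of_real c) < min (1/2) (c - b)"
    hence "Re w > c0" using abs_Re_le_cmod[of "w - of_real c"] c by auto
    hence "N w = (\<integral>u. of_real (g u) * exp (- (w * of_real u)) \<partial>lborel)" by (rule eq)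
    thus "(\<lambda>n. a n * (w - of_real c) ^ n) sums N w"
      using laplace_power_series(2)[OF meas supp int_half, of w] w by (simp add: a_def)
    show "(\<lambda>n. (deriv ^^ n) N (of_real c) / fact n * (w - of_real c) ^ n) sums N w"
      by (rule taylor) (use w in auto)
  qed (use c in auto)
  with taylor have sums: "(\<lambda>n. a n * (w - of_real c) ^ n) sums N w" if "norm (w - of_real c) < c - b" for w
    using that by simp
  \<comment> \<open>This is the term of the series at \<open>c - r\<close>: the signs of
    \<open>(-u) ^ n\<close> and \<open>(-r) ^ n\<close> cancel, so it is nonnegative.\<close>
  define f where "f = (\<lambda>n u. g u * exp (- (c * u)) * ((r * u) ^ n /\<^sub>R fact n))"
  have f_eq: "complex_of_real (f n u) = of_real (g u * exp (- (c * u)) * (-u) ^ n / fact n) * (of_real (- r)) ^ n" for n u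
  proof -
    have "f n u = g u * exp (- (c * u)) * (-u) ^ n / fact n * (- r) ^ n"
      by (simp add: f_def field_simps flip: power_mult_distrib)
    thus ?thesis by simp
  qed
  have intf0: "integrable lborel (\<lambda>u. complex_of_real (f n u))" for n
  proof -
    \<comment> \<open>Integrability of a single term does not depend on the radius, so it is taken
      at distance \<open>1/2\<close>, where it is known, and rescaled to \<open>r\<close>.\<close>
    have "integrable lborel (\<lambda>u. of_real (g u * exp (- (c * u)) * (-u) ^ n / fact n) * (1/2) ^ n :: complex)"
      using laplace_power_series(3)[OF meas supp int_half, of "of_real c + 1/2" n] by simp
    from integrable_mult_left[OF this, of "2 ^ n * (of_real (- r)) ^ n"]
    show ?thesis unfolding f_eq by (simp add: field_simps)
  qed
  hence intf: "integrable lborel (f n)" for n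
    by (simp only: complex_of_real_integrable_eq)
  have f0: "f n u \<ge> 0" for n u
    using supp[of u] nonneg[of u] r0 by (cases "u < 0") (auto simp: f_def)
  have 1: "AE u in lborel. summable (\<lambda>n. norm (f n u))"
  proof (rule AE_I2)
    fix u
    have "summable (\<lambda>n. g u * exp (- (c * u)) * ((r * u) ^ n /\<^sub>R fact n))"
      by (intro summable_mult summable_exp_generic)
    thus "summable (\<lambda>n. norm (f n u))" using f0 by (simp add: f_def)
  qed
  have 2: "summable (\<lambda>n. \<integral>u. norm (f n u) \<partial>lborel)"
  proof -
    have "(\<lambda>n. a n * (of_real (c - r) - of_real c) ^ n) sums N (of_real (c - r))"
      by (rule sums) (use r r0 in auto)
    moreover have "a n * (of_real (c - r) - of_real c) ^ n = of_real (\<integral>u. norm (f n u) \<partial>lborel)" for n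
    proof -
      have "a n * (of_real (c - r) - of_real c) ^ n = (\<integral>u. complex_of_real (f n u) \<partial>lborel)"
        unfolding f_eq a_def integral_mult_left_zero by simp
      thus ?thesis using f0 by (simp add: integral_complex_of_real)
    qed
    ultimately have "summable (\<lambda>n. complex_of_real (\<integral>u. norm (f n u) \<partial>lborel))"
      by (simp add: sums_iff)
    thus ?thesis by (simp only: summable_of_real_iff)
  qed
  have "(\<Sum>n. f n u) = g u * exp (- ((c - r) * u))" for u
  proof -
    have "(\<lambda>n. f n u) sums (g u * exp (- (c * u)) * exp (r * u))"
      unfolding f_def by (intro sums_mult exp_converges)
    thus ?thesis by (simp add: sums_iff algebra_simps flip: exp_add)
  qed
  hence intr: "integrable lborel (\<lambda>u. g u * exp (- ((c - r) * u)))"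
    using integrable_suminf[OF intf 1 2] by simp
  \<comment> \<open>The point \<open>s\<close> lies on the circle of radius \<open>r\<close> about
    \<open>c\<close>, the boundary case that \<open>laplace_power_series\<close> admits.\<close>
  show "integrable lborel (\<lambda>u. of_real (g u) * exp (- (s * of_real u)))"
    by (rule laplace_power_series(1)[OF meas supp intr r_def[symmetric, THEN eq_refl]])
  have "(\<lambda>n. a n * (s - of_real c) ^ n) sums (\<integral>u. of_real (g u) * exp (- (s * of_real u)) \<partial>lborel)"
    unfolding a_def by (rule laplace_power_series(2)[OF meas supp intr r_def[symmetric, THEN eq_refl]])
  moreover have "(\<lambda>n. a n * (s - of_real c) ^ n) sums N s"
    by (rule sums) (use r in \<open>simp add: r_def\<close>)
  ultimately show "N s = (\<integral>u. of_real (g u) * exp (- (s * of_real u)) \<partial>lborel)"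
    using sums_unique2 by blast
qed

section \<open>The Laplace transform of the squared error term\<close>

definition E2_log_square :: "real poly \<Rightarrow> real \<Rightarrow> real" where
  "E2_log_square P u = (if u \<ge> 0 then (E2 P (exp u))\<^sup>2 else 0)"

lemma E2_bound:
  "\<exists>C\<ge>0. \<exists>n. \<forall>x\<ge>1. \<bar>E2 P x\<bar> \<le> C * x ^ n"
proof -
  obtain Ec C n where "Ec holomorphic_on {z. Re z > 0}"
    and Ec: "\<And>x. x > 0 \<Longrightarrow> Ec (of_real x) = of_real (E2 P x)" "C \<ge> 0"
    "\<And>z. Re z > 1/2 \<Longrightarrow> \<bar>Im z\<bar> \<le> 1/4 \<Longrightarrow> norm (Ec z) \<le> C * (1 + norm z) ^ n"
    by (rule E2_holomorphic_extension[of P]) blast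
  have "\<bar>E2 P x\<bar> \<le> C * 2 ^ n * x ^ n" if "x \<ge> 1" for x
  proof -
    have "\<bar>E2 P x\<bar> \<le> C * (1 + x) ^ n"
      using Ec(1)[of x] Ec(3)[of "of_real x"] that by simp
    also have "\<dots> \<le> C * (2 * x) ^ n"
      using that Ec(2) by (intro mult_left_mono power_mono) auto
    finally show ?thesis by (simp add: power_mult_distrib)
  qed
  thus ?thesis using Ec(2) by (intro exI[of _ "C * 2 ^ n"] conjI exI[of _ n]) auto
qed

lemma continuous_on_E2: "continuous_on {0<..} (E2 P)"
  using E2_has_derivative[of _ P]
  by (intro continuous_at_imp_continuous_on ballI) (auto intro: DERIV_isCont)

lemma continuous_on_E2_exp: "continuous_on A (\<lambda>u. E2 P (exp u))"
  by (rule continuous_on_compose2[OF continuous_on_E2]) (auto intro!: continuous_intros)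

lemma E2_log_square_measurable [measurable]: "E2_log_square P \<in> borel_measurable borel"
proof -
  have [measurable]: "(\<lambda>u. E2 P (exp u)) \<in> borel_measurable borel"
    by (intro borel_measurable_continuous_onI continuous_on_E2_exp)
  show ?thesis unfolding E2_log_square_def[abs_def] by measurable
qed

lemma E2_log_square_laplace_integrable:
  assumes C: "C \<ge> 0" "\<And>x. x \<ge> 1 \<Longrightarrow> \<bar>E2 P x\<bar> \<le> C * x ^ n" and s: "Re s > 2 * real n"
  shows "integrable lborel (\<lambda>u. of_real (E2_log_square P u) * exp (- (s * of_real u)))"
proof (rule Bochner_Integration.integrable_bound)
  have "set_integrable lborel {0<..} (\<lambda>u. exp (- (u * (Re s - 2 * real n))))"
    by (rule integrable_I0i_exp_mscale) (use s in auto)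
  hence "set_integrable lborel {0<..} (\<lambda>u. C\<^sup>2 * exp (- (u * (Re s - 2 * real n))))"
    by (rule set_integrable_mult_right)
  thus "integrable lborel (\<lambda>u. indicator {0<..} u *\<^sub>R (C\<^sup>2 * exp (- (u * (Re s - 2 * real n)))))"
    by (simp add: set_integrable_def)
  show "AE u in lborel. norm (of_real (E2_log_square P u) * exp (- (s * of_real u)))
      \<le> norm (indicator {0<..} u *\<^sub>R (C\<^sup>2 * exp (- (u * (Re s - 2 * real n)))))"
    using AE_lborel_singleton[of 0]
  proof eventually_elim
    case (elim u)
    show ?case
    proof (cases "u > 0")
      case True
      have "(E2 P (exp u))\<^sup>2 \<le> (C * exp u ^ n)\<^sup>2"
        using C(2)[of "exp u"] True by (simp add: abs_le_square_iff[symmetric])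
      also have "\<dots> = C\<^sup>2 * exp (2 * real n * u)"
        by (simp add: power_mult_distrib flip: exp_of_nat_mult exp_of_nat2_mult power_mult)
      finally have "(E2 P (exp u))\<^sup>2 * exp (- (Re s * u)) \<le> C\<^sup>2 * exp (2 * real n * u) * exp (- (Re s * u))"
        by (intro mult_right_mono) auto
      thus ?thesis using True
        by (simp add: E2_log_square_def norm_mult norm_power algebra_simps flip: exp_add)
    qed (use elim in \<open>auto simp: E2_log_square_def\<close>)
  qed
qed measurable

lemma of_real_powr_eq_exp: "x > 0 \<Longrightarrow> of_real x powr s = exp (s * of_real (ln x) :: complex)"
  by (simp add: powr_def Ln_of_real)

text \<open>Integration by parts for half the derivative of the square of \<open>E2\<close> against
  \<open>x powr (-s)\<close>, followed by \<open>x = exp u\<close> in the remaining integral. The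
  antiderivative \<open>H\<close> is written down and differentiated.\<close>

lemma K_integral_partial:
  fixes s :: complex
  assumes N: "N \<ge> 1"
  shows "((\<lambda>x. of_real ((norm (riemann_zeta (Complex (1/2) x)) ^ 4 - poly (Q4 P) (ln x)) * E2 P x) * of_real x powr (-s))
           has_integral (of_real ((E2 P N)\<^sup>2) * of_real N powr (-s) / 2 - of_real ((E2 P 1)\<^sup>2) / 2
             + s / 2 * integral {0..ln N} (\<lambda>u. of_real ((E2 P (exp u))\<^sup>2) * exp (- (s * of_real u))))) {1..N}"
proof -
  define E' where "E' = (\<lambda>x. norm (riemann_zeta (Complex (1/2) x)) ^ 4 - poly (Q4 P) (ln x))"
  define j where "j = (\<lambda>u. of_real ((E2 P (exp u))\<^sup>2) * exp (- (s * of_real u)))"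
  define H where "H = (\<lambda>x. of_real ((E2 P x)\<^sup>2) * exp (- (s * of_real (ln x))) / 2 + s / 2 * integral {0..ln x} j)"
  have "((\<lambda>x. of_real (E' x * E2 P x) * of_real x powr (-s)) has_integral (H N - H 1)) {1..N}"
  proof (rule fundamental_theorem_of_calculus[OF N])
    fix x assume x: "x \<in> {1..N}"
    hence x0: "x > 0" by auto
    have dln: "(ln has_vector_derivative 1 / x) (at x within {1..N})"
      unfolding has_real_derivative_iff_has_vector_derivative[symmetric]
      using x0 by (auto intro!: derivative_eq_intros)
    have d1: "((\<lambda>x. of_real ((E2 P x)\<^sup>2)) has_vector_derivative (of_real (2 * E2 P x * E' x) :: complex)) (at x within {1..N})"
      unfolding E'_def using x0
      by (intro has_vector_derivative_of_real)
         (auto intro!: derivative_eq_intros E2_has_derivative[THEN has_field_derivative_at_within]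
           simp flip: has_real_derivative_iff_has_vector_derivative)
    have "((\<lambda>z. exp (- (s * z))) has_field_derivative (- s * exp (- (s * of_real (ln x))))) (at (of_real (ln x)))"
      by (auto intro!: derivative_eq_intros)
    hence "((\<lambda>u. exp (- (s * of_real u))) has_vector_derivative (- s * exp (- (s * of_real (ln x))))) (at (ln x) within ln ` {1..N})"
      by (rule has_vector_derivative_real_field)
    from vector_diff_chain_within[OF dln this]
    have d2: "((\<lambda>x. exp (- (s * of_real (ln x)))) has_vector_derivative (- s / of_real x * exp (- (s * of_real (ln x))))) (at x within {1..N})"
      by (simp add: o_def scaleR_conv_of_real)
    have "continuous_on {0..ln N} j"
      unfolding j_def by (intro continuous_intros continuous_on_E2_exp)
    hence "((\<lambda>u. integral {0..u} j) has_vector_derivative j (ln x)) (at (ln x) within {0..ln N})"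
      by (rule integral_has_vector_derivative) (use x in auto)
    hence "((\<lambda>u. integral {0..u} j) has_vector_derivative j (ln x)) (at (ln x) within ln ` {1..N})"
      by (rule has_vector_derivative_within_subset) (use x in auto)
    from vector_diff_chain_within[OF dln this]
    have d3: "((\<lambda>x. integral {0..ln x} j) has_vector_derivative (j (ln x) / of_real x)) (at x within {1..N})"
      by (simp add: o_def scaleR_conv_of_real)
    show "(H has_vector_derivative of_real (E' x * E2 P x) * of_real x powr (-s)) (at x within {1..N})"
      unfolding H_def
    proof (rule has_vector_derivative_eq_rhs[OF has_vector_derivative_add[OF
            has_vector_derivative_divide[OF has_vector_derivative_mult[OF d1 d2]] has_vector_derivative_mult_right[OF d3]]])
      have "(a\<^sup>2 * (- s / y * e) + 2 * a * a' * e) / 2 + s / 2 * (a\<^sup>2 * e / y) = a' * a * e"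
        if "y \<noteq> 0" for a a' y e :: complex
        using that by (simp add: field_simps power2_eq_square)
      from this[of "of_real x" "of_real (E2 P x)" "exp (- (s * of_real (ln x)))" "of_real (E' x)"] x0
      show "(of_real ((E2 P x)\<^sup>2) * (- s / of_real x * exp (- (s * of_real (ln x)))) +
          of_real (2 * E2 P x * E' x) * exp (- (s * of_real (ln x)))) / 2 + s / 2 * (j (ln x) / of_real x) =
          of_real (E' x * E2 P x) * of_real x powr - s"
        by (simp only: j_def of_real_powr_eq_exp[OF x0] exp_ln of_real_mult of_real_power of_real_numeral
            mult_minus_left of_real_eq_0_iff less_imp_neq not_False_eq_True)
    qed
  qed
  moreover have "H N - H 1 = of_real ((E2 P N)\<^sup>2) * of_real N powr (-s) / 2 - of_real ((E2 P 1)\<^sup>2) / 2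
             + s / 2 * integral {0..ln N} (\<lambda>u. of_real ((E2 P (exp u))\<^sup>2) * exp (- (s * of_real u)))"
    using N by (simp add: H_def of_real_powr_eq_exp j_def)
  ultimately show ?thesis by (simp add: E'_def)
qed

text \<open>The limit of \<open>K_integral_partial\<close> as \<open>N\<close> tends to infinity.
  Some half plane is enough, since Landau's theorem later moves the identity to
  \<open>Re s > 1\<close>; hence crude growth exponents suffice.\<close>

lemma K_integral_eq_laplace:
  "\<exists>c0. \<forall>s. Re s > c0 \<longrightarrow>
     integrable lborel (\<lambda>u. of_real (E2_log_square P u) * exp (- (s * of_real u))) \<and>
     K_integral P s = - of_real ((E2 P 1)\<^sup>2) / 2 +
       s / 2 * (\<integral>u. of_real (E2_log_square P u) * exp (- (s * of_real u)) \<partial>lborel)"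
proof -
  obtain C n where C: "C \<ge> 0" "\<And>x. x \<ge> 1 \<Longrightarrow> \<bar>E2 P x\<bar> \<le> C * x ^ n"
    using E2_bound[of P] by blast
  define E' where "E' = (\<lambda>x. norm (riemann_zeta (Complex (1/2) x)) ^ 4 - poly (Q4 P) (ln x))"
  obtain C' m where C': "C' \<ge> 0" "\<And>x. x \<ge> 1 \<Longrightarrow> \<bar>E' x\<bar> \<le> C' * (1 + x) ^ m"
    unfolding E'_def using E2_derivative_bound[of P] by blast
  have C'': "\<bar>E' x\<bar> \<le> C' * 2 ^ m * x ^ m" if "x \<ge> 1" for x
  proof -
    have "\<bar>E' x\<bar> \<le> C' * (1 + x) ^ m" by (rule C'(2)[OF that])
    also have "\<dots> \<le> C' * (2 * x) ^ m"
      using that C'(1) by (intro mult_left_mono power_mono) auto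
    finally show ?thesis by (simp add: power_mult_distrib)
  qed
  \<comment> \<open>The abscissa makes the integrand \<open>O(x powr (-2))\<close>, as
    \<open>n + m - Re s \<le> -2\<close>, and lets the boundary term, of exponent
    \<open>2 * n - Re s\<close>, tend to 0.\<close>
  have "integrable lborel (\<lambda>u. of_real (E2_log_square P u) * exp (- (s * of_real u))) \<and>
     K_integral P s = - of_real ((E2 P 1)\<^sup>2) / 2 +
       s / 2 * (\<integral>u. of_real (E2_log_square P u) * exp (- (s * of_real u)) \<partial>lborel)"
    if s: "Re s > 2 * real n + real m + 2" for s
  proof
    define M where "M = (\<integral>u. of_real (E2_log_square P u) * exp (- (s * of_real u)) \<partial>lborel)"
    define f where "f = (\<lambda>x. of_real (E' x * E2 P x) * of_real x powr (-s) :: complex)"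
    define j where "j = (\<lambda>u. of_real ((E2 P (exp u))\<^sup>2) * exp (- (s * of_real u)))"
    show int: "integrable lborel (\<lambda>u. of_real (E2_log_square P u) * exp (- (s * of_real u)))"
      by (rule E2_log_square_laplace_integrable[OF C]) (use s in auto)
    have partial: "(f has_integral (of_real ((E2 P N)\<^sup>2) * of_real N powr (-s) / 2 - of_real ((E2 P 1)\<^sup>2) / 2
             + s / 2 * integral {0..ln N} j)) {1..N}" if "N \<ge> 1" for N
      unfolding f_def E'_def j_def by (rule K_integral_partial[OF that])
    have fb: "norm (f x) \<le> C * C' * 2 ^ m * x powr (-2)" if "x \<ge> 1" for x
    proof -
      have "norm (f x) = \<bar>E' x\<bar> * \<bar>E2 P x\<bar> * x powr (- Re s)"
        using that by (simp add: f_def norm_mult norm_powr_real_powr abs_mult)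
      also have "\<dots> \<le> (C' * 2 ^ m * x ^ m) * (C * x ^ n) * x powr (- Re s)"
        using that C C'(1) C'' by (intro mult_right_mono mult_mono) auto
      also have "\<dots> = C * C' * 2 ^ m * x powr (real m + real n - Re s)"
        using that by (simp add: powr_add powr_diff powr_minus powr_realpow divide_inverse)
      also have "\<dots> \<le> C * C' * 2 ^ m * x powr (-2)"
        using that s C(1) C'(1) by (intro mult_left_mono powr_mono) auto
      finally show ?thesis .
    qed
    have conv: "(\<lambda>k. integral {1..} (\<lambda>x. if x \<in> {1..real (Suc k)} then f x else 0)) \<longlonglongrightarrow> integral {1..} f"
    proof (rule dominated_convergence(2))
      show "(\<lambda>x. if x \<in> {1..real (Suc k)} then f x else 0) integrable_on {1..}" for k
      proof -
        have "{1..real (Suc k)} \<inter> {1..} = {1..real (Suc k)}" by auto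
        thus ?thesis unfolding integrable_restrict_Int using partial[of "real (Suc k)"] by auto
      qed
      show "(\<lambda>x. C * C' * 2 ^ m * x powr (-2)) integrable_on {1..}"
        using has_integral_powr_to_inf[of "-2" 1] by (intro integrable_on_mult_right) auto
      show "norm (if x \<in> {1..real (Suc k)} then f x else 0) \<le> C * C' * 2 ^ m * x powr (-2)"
        if "x \<in> {1..}" for k x using fb[of x] that C(1) C'(1) by auto
      show "(\<lambda>k. if x \<in> {1..real (Suc k)} then f x else 0) \<longlonglongrightarrow> f x" if "x \<in> {1..}" for x
      proof (rule tendsto_eventually)
        have "\<forall>\<^sub>F k in sequentially. real k \<ge> x"
          using filterlim_real_sequentially by (simp add: filterlim_at_top)
        thus "\<forall>\<^sub>F k in sequentially. (if x \<in> {1..real (Suc k)} then f x else 0) = f x"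
          by eventually_elim (use that in auto)
      qed
    qed
    have lim1: "((\<lambda>N. of_real ((E2 P N)\<^sup>2) * of_real N powr (-s) :: complex) \<longlongrightarrow> 0) at_top"
    proof (rule Lim_null_comparison)
      show "\<forall>\<^sub>F N in at_top. norm (of_real ((E2 P N)\<^sup>2) * of_real N powr (-s) :: complex) \<le> C\<^sup>2 * N powr (2 * real n - Re s)"
        using eventually_ge_at_top[of 1]
      proof eventually_elim
        case (elim N)
        have "norm (of_real ((E2 P N)\<^sup>2) * of_real N powr (-s) :: complex) = \<bar>E2 P N\<bar>\<^sup>2 * N powr (- Re s)"
          using elim by (simp add: norm_mult norm_powr_real_powr norm_power)
        also have "\<dots> \<le> (C * N ^ n)\<^sup>2 * N powr (- Re s)"
          using elim C(2) by (intro mult_right_mono power_mono) auto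
        also have "\<dots> = C\<^sup>2 * (N powr real n * N powr real n * N powr (- Re s))"
          using elim by (simp add: powr_realpow power2_eq_square)
        also have "N powr real n * N powr real n * N powr (- Re s) = N powr (2 * real n - Re s)"
          by (simp flip: powr_add)
        finally show ?case .
      qed
      show "((\<lambda>N. C\<^sup>2 * N powr (2 * real n - Re s)) \<longlongrightarrow> 0) at_top"
        using s by (intro tendsto_mult_right_zero tendsto_neg_powr) (auto simp: filterlim_ident)
    qed
    have lim2: "((\<lambda>N. integral {0..ln N} j) \<longlongrightarrow> M) at_top"
    proof -
      \<comment> \<open>Vanishing for \<open>u < 0\<close> turns the cut at \<open>y\<close> into an
        integral over \<open>{0..y}\<close>.\<close>
      have eq: "(\<integral>u. indicator {..y} u *\<^sub>R (of_real (E2_log_square P u) * exp (- (s * of_real u))) \<partial>lborel) = integral {0..y} j" for y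
      proof -
        have "set_integrable lborel {0..y} j"
          unfolding j_def by (intro borel_integrable_atLeastAtMost' continuous_intros continuous_on_E2_exp)
        from set_borel_integral_eq_integral(2)[OF this]
        have "integral {0..y} j = (\<integral>u. indicator {0..y} u *\<^sub>R j u \<partial>lborel)"
          by (simp add: set_lebesgue_integral_def)
        also have "\<dots> = (\<integral>u. indicator {..y} u *\<^sub>R (of_real (E2_log_square P u) * exp (- (s * of_real u))) \<partial>lborel)"
          by (intro Bochner_Integration.integral_cong) (auto simp: j_def E2_log_square_def indicator_def)
        finally show ?thesis ..
      qed
      from tendsto_integral_at_top[OF _ int] have "((\<lambda>y. integral {0..y} j) \<longlongrightarrow> M) at_top"
        by (simp add: eq M_def)
      thus ?thesis by (rule filterlim_compose[OF _ ln_at_top])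
    qed
    have Suc_top: "filterlim (\<lambda>k. real (Suc k)) at_top sequentially"
      by (intro filterlim_compose[OF filterlim_real_sequentially filterlim_Suc])
    have "(\<lambda>k. of_real ((E2 P (real (Suc k)))\<^sup>2) * of_real (real (Suc k)) powr (-s) / 2 - of_real ((E2 P 1)\<^sup>2) / 2
        + s / 2 * integral {0..ln (real (Suc k))} j) \<longlonglongrightarrow> 0 / 2 - of_real ((E2 P 1)\<^sup>2) / 2 + s / 2 * M"
      by (intro tendsto_intros filterlim_compose[OF lim1 Suc_top] filterlim_compose[OF lim2 Suc_top]) auto
    moreover have "integral {1..} (\<lambda>x. if x \<in> {1..real (Suc k)} then f x else 0) =
        of_real ((E2 P (real (Suc k)))\<^sup>2) * of_real (real (Suc k)) powr (-s) / 2 - of_real ((E2 P 1)\<^sup>2) / 2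
        + s / 2 * integral {0..ln (real (Suc k))} j" for k
    proof -
      have "{1..real (Suc k)} \<inter> {1..} = {1..real (Suc k)}" by auto
      thus ?thesis unfolding Henstock_Kurzweil_Integration.integral_restrict_Int
        using integral_unique[OF partial[of "real (Suc k)"]] by simp
    qed
    ultimately have "(\<lambda>k. integral {1..} (\<lambda>x. if x \<in> {1..real (Suc k)} then f x else 0)) \<longlonglongrightarrow>
        0 / 2 - of_real ((E2 P 1)\<^sup>2) / 2 + s / 2 * M"
      by (simp only:)
    from LIMSEQ_unique[OF conv this]
    have "integral {1..} f = - of_real ((E2 P 1)\<^sup>2) / 2 + s / 2 * M" by simp
    thus "K_integral P s = - of_real ((E2 P 1)\<^sup>2) / 2 +
       s / 2 * (\<integral>u. of_real (E2_log_square P u) * exp (- (s * of_real u)) \<partial>lborel)"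
      by (simp add: K_integral_def f_def E'_def M_def)
  qed
  thus ?thesis by blast
qed

section \<open>Gaussian smoothing\<close>

lemma gauss_fourier:
  "(\<integral>t. of_real (std_normal_density t) * iexp (v * t) \<partial>lborel) = complex_of_real (exp (- v\<^sup>2 / 2))"
proof -
  have "(\<integral>t. of_real (std_normal_density t) * iexp (v * t) \<partial>lborel) = char std_normal_distribution v"
    unfolding char_def by (subst integral_density) (auto simp: scaleR_conv_of_real)
  thus ?thesis by (simp add: char_std_normal_distribution)
qed

lemma gauss_fourier_scaled:
  assumes "b > 0"
  shows "(\<integral>t. of_real (std_normal_density (b * t)) * iexp (x * t) \<partial>lborel) = complex_of_real (exp (- (x / b)\<^sup>2 / 2) / b)"
proof -
  have "(\<integral>t. of_real (std_normal_density t) * iexp (x / b * t) \<partial>lborel) =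
      \<bar>b\<bar> *\<^sub>R (\<integral>t. of_real (std_normal_density (0 + b * t)) * iexp (x / b * (0 + b * t)) \<partial>lborel)"
    by (rule lborel_integral_real_affine) (use assms in auto)
  hence "complex_of_real (exp (- (x / b)\<^sup>2 / 2)) = of_real b * (\<integral>t. of_real (std_normal_density (b * t)) * iexp (x * t) \<partial>lborel)"
    using assms unfolding gauss_fourier by (simp add: scaleR_conv_of_real)
  thus ?thesis using assms by (simp add: field_simps)
qed

text \<open>Every interchange of Bochner integrals below has an integrand dominated by a product of
  integrable functions of one variable each.\<close>

lemma Fubini_product_bound:
  fixes f :: "real \<Rightarrow> real \<Rightarrow> 'a::{banach, second_countable_topology}" and p q :: "real \<Rightarrow> real"
  assumes f [measurable]: "case_prod f \<in> borel_measurable (lborel \<Otimes>\<^sub>M lborel)"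
    and p: "integrable lborel p" and q: "integrable lborel q"
    and bound: "\<And>x y. norm (f x y) \<le> p x * q y"
  shows "integrable (lborel \<Otimes>\<^sub>M lborel) (case_prod f)"
    and "(\<integral>x. (\<integral>y. f x y \<partial>lborel) \<partial>lborel) = (\<integral>y. (\<integral>x. f x y \<partial>lborel) \<partial>lborel)"
proof -
  have [measurable]: "p \<in> borel_measurable lborel" "q \<in> borel_measurable lborel" using p q by auto
  have "integrable (lborel \<Otimes>\<^sub>M lborel) (\<lambda>(x, y). p x * q y)"
  proof (rule lborel_pair.Fubini_integrable)
    have "integrable lborel (\<lambda>x. \<bar>p x\<bar> * (\<integral>y. \<bar>q y\<bar> \<partial>lborel))"
      by (intro integrable_mult_left integrable_abs p)
    thus "integrable lborel (\<lambda>x. \<integral>y. norm (case (x, y) of (x, y) \<Rightarrow> p x * q y) \<partial>lborel)"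
      by (simp add: abs_mult)
    show "AE x in lborel. integrable lborel (\<lambda>y. case (x, y) of (x, y) \<Rightarrow> p x * q y)"
      using q by auto
  qed measurable
  thus int: "integrable (lborel \<Otimes>\<^sub>M lborel) (case_prod f)"
    by (rule Bochner_Integration.integrable_bound) (use bound in \<open>auto intro!: order.trans[OF bound]\<close>)
  show "(\<integral>x. (\<integral>y. f x y \<partial>lborel) \<partial>lborel) = (\<integral>y. (\<integral>x. f x y \<partial>lborel) \<partial>lborel)"
    by (rule lborel_pair.Fubini_integral[OF int, symmetric])
qed

text \<open>With this sign and no normalisation, the transform of
  \<open>E2_weight P \<sigma>\<close> at \<open>t\<close> is the Laplace transform of
  \<open>E2_log_square P\<close> at \<open>\<sigma> + \<i> * t\<close>.\<close>

definition fourier :: "(real \<Rightarrow> real) \<Rightarrow> real \<Rightarrow> complex" where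
  "fourier G t = (\<integral>u. of_real (G u) * iexp (- t * u) \<partial>lborel)"

lemma integrable_std_normal_density: "integrable lborel std_normal_density"
  using integrable_std_normal_moment[of 0] by simp

lemma integrable_std_normal_density_scaled:
  "b \<noteq> 0 \<Longrightarrow> integrable lborel (\<lambda>t. std_normal_density (b * t))"
  using lborel_integrable_real_affine[OF integrable_std_normal_density, of b 0] by simp

lemma norm_fourier_le: "norm (fourier G t) \<le> (\<integral>u. \<bar>G u\<bar> \<partial>lborel)"
  unfolding fourier_def using integral_norm_bound[of lborel "\<lambda>u. of_real (G u) * iexp (- t * u)"]
  by (simp add: norm_mult)

lemma fourier_measurable [measurable]:
  assumes [measurable]: "G \<in> borel_measurable borel"
  shows "fourier G \<in> borel_measurable borel"
  unfolding fourier_def[abs_def] by measurable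

text \<open>Fourier inversion for a Gaussian average: each kernel value is written as the Fourier
  integral of a Gaussian, which makes the double integral absolutely convergent for any integrable
  \<open>G\<close>. One factor \<open>1 / sqrt (2 * pi)\<close> of the inversion formula is inside
  the density, the other is explicit.\<close>

lemma gauss_smoothing_fourier:
  assumes G: "integrable lborel G" and b: "b > 0"
  shows "complex_of_real (\<integral>v. std_normal_density v * G (u + b * v) \<partial>lborel) =
     (\<integral>t. of_real (std_normal_density (b * t)) * fourier G t / of_real (sqrt (2 * pi)) * iexp (t * u) \<partial>lborel)"
proof -
  have [measurable]: "G \<in> borel_measurable lborel" using G by auto
  have "(\<integral>w. std_normal_density ((w - u) / b) * G w \<partial>lborel) =
      \<bar>b\<bar> *\<^sub>R (\<integral>v. std_normal_density ((u + b * v - u) / b) * G (u + b * v) \<partial>lborel)"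
    by (rule lborel_integral_real_affine) (use b in auto)
  hence "(\<integral>v. std_normal_density v * G (u + b * v) \<partial>lborel) = (\<integral>w. std_normal_density ((w - u) / b) * G w / b \<partial>lborel)"
    using b by simp
  also have "complex_of_real \<dots> = (\<integral>w. complex_of_real (std_normal_density ((w - u) / b) * G w / b) \<partial>lborel)"
    by (rule integral_complex_of_real[symmetric])
  also have "\<dots> = (\<integral>w. (\<integral>t. of_real (std_normal_density (b * t)) * iexp ((u - w) * t) / of_real (sqrt (2 * pi)) * of_real (G w) \<partial>lborel) \<partial>lborel)"
  proof (rule Bochner_Integration.integral_cong[OF refl])
    fix w
    have "std_normal_density ((w - u) / b) = 1 / sqrt (2 * pi) * exp (- ((u - w) / b)\<^sup>2 / 2)"
      by (simp add: std_normal_density_def power2_commute power_divide)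
    hence r: "std_normal_density ((w - u) / b) * G w / b = exp (- ((u - w) / b)\<^sup>2 / 2) / b / sqrt (2 * pi) * G w"
      by simp
    have "complex_of_real (std_normal_density ((w - u) / b) * G w / b) =
        complex_of_real (exp (- ((u - w) / b)\<^sup>2 / 2) / b) / of_real (sqrt (2 * pi)) * of_real (G w)"
      unfolding r by (simp only: of_real_mult of_real_divide)
    thus "complex_of_real (std_normal_density ((w - u) / b) * G w / b) =
        (\<integral>t. of_real (std_normal_density (b * t)) * iexp ((u - w) * t) / of_real (sqrt (2 * pi)) * of_real (G w) \<partial>lborel)"
      unfolding gauss_fourier_scaled[OF b, symmetric] by simp
  qed
  also have "\<dots> = (\<integral>t. (\<integral>w. of_real (std_normal_density (b * t)) * iexp ((u - w) * t) / of_real (sqrt (2 * pi)) * of_real (G w) \<partial>lborel) \<partial>lborel)"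
  proof (rule Fubini_product_bound(2))
    show "integrable lborel (\<lambda>w. \<bar>G w\<bar> / sqrt (2 * pi))" using G by auto
    show "integrable lborel (\<lambda>t. std_normal_density (b * t))"
      by (rule integrable_std_normal_density_scaled) (use b in auto)
  qed (auto simp: norm_mult norm_divide mult.commute)
  also have "\<dots> = (\<integral>t. of_real (std_normal_density (b * t)) * fourier G t / of_real (sqrt (2 * pi)) * iexp (t * u) \<partial>lborel)"
  proof (rule Bochner_Integration.integral_cong[OF refl])
    fix t
    have "(\<integral>w. of_real (std_normal_density (b * t)) * iexp ((u - w) * t) / of_real (sqrt (2 * pi)) * of_real (G w) \<partial>lborel) =
      (\<integral>w. of_real (std_normal_density (b * t)) * iexp (t * u) / of_real (sqrt (2 * pi)) * (of_real (G w) * iexp (- t * w)) \<partial>lborel)"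
      by (intro Bochner_Integration.integral_cong[OF refl]) (simp add: algebra_simps exp_diff exp_minus field_simps)
    also have "\<dots> = of_real (std_normal_density (b * t)) * fourier G t / of_real (sqrt (2 * pi)) * iexp (t * u)"
      unfolding integral_mult_right_zero fourier_def by simp
    finally show "(\<integral>w. of_real (std_normal_density (b * t)) * iexp ((u - w) * t) / of_real (sqrt (2 * pi)) * of_real (G w) \<partial>lborel) =
      of_real (std_normal_density (b * t)) * fourier G t / of_real (sqrt (2 * pi)) * iexp (t * u)" .
  qed
  finally show ?thesis .
qed

text \<open>Schur's test: \<open>2 * x * y \<le> x\<^sup>2 + y\<^sup>2\<close>, and the symmetric
  kernel has mass \<open>sqrt (2 * pi)\<close> in each variable. Extended nonnegative integrals
  permit Tonelli's theorem without integrability conditions.\<close>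

lemma schur_gauss:
  fixes h :: "real \<Rightarrow> complex"
  assumes h [measurable]: "h \<in> borel_measurable borel"
  shows "(\<integral>\<^sup>+t. (\<integral>\<^sup>+t'. ennreal (norm (h t) * norm (h t') * exp (- (t - t')\<^sup>2 / 2)) \<partial>lborel) \<partial>lborel)
     \<le> ennreal (sqrt (2 * pi)) * (\<integral>\<^sup>+t. ennreal ((norm (h t))\<^sup>2) \<partial>lborel)"
proof -
  define k where "k = (\<lambda>t t' :: real. exp (- (t - t')\<^sup>2 / 2))"
  have k: "(\<integral>\<^sup>+t'. ennreal (k t t') \<partial>lborel) = ennreal (sqrt (2 * pi))" for t
  proof -
    have eq: "k t t' = sqrt (2 * pi) * normal_density t 1 t'" for t'
      by (simp add: k_def normal_density_def power2_commute)
    have "(\<integral>\<^sup>+t'. ennreal (k t t') \<partial>lborel) = ennreal (sqrt (2 * pi)) * (\<integral>\<^sup>+t'. ennreal (normal_density t 1 t') \<partial>lborel)"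
      unfolding eq by (subst nn_integral_cmult[symmetric]) (auto simp: ennreal_mult)
    also have "(\<integral>\<^sup>+t'. ennreal (normal_density t 1 t') \<partial>lborel) = 1"
      by (subst nn_integral_eq_integral) auto
    finally show ?thesis by simp
  qed
  have sym: "k t t' = k t' t" for t t' by (simp add: k_def power2_commute)
  have [measurable]: "(\<lambda>x. k (fst x) (snd x)) \<in> borel_measurable (lborel \<Otimes>\<^sub>M lborel)"
    "(\<lambda>x. k (snd x) (fst x)) \<in> borel_measurable (lborel \<Otimes>\<^sub>M lborel)"
    "\<And>t. k t \<in> borel_measurable borel" "\<And>t. (\<lambda>t'. k t' t) \<in> borel_measurable borel" unfolding k_def by measurable
  let ?A = "\<lambda>t t'. ennreal ((norm (h t))\<^sup>2 / 2 * k t t')"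
  have 1: "(\<integral>\<^sup>+t. (\<integral>\<^sup>+t'. ?A t t' \<partial>lborel) \<partial>lborel) = ennreal (sqrt (2 * pi)) * (\<integral>\<^sup>+t. ennreal ((norm (h t))\<^sup>2 / 2) \<partial>lborel)"
  proof -
    have "(\<integral>\<^sup>+t'. ?A t t' \<partial>lborel) = ennreal ((norm (h t))\<^sup>2 / 2) * ennreal (sqrt (2 * pi))" for t
    proof -
      have "(\<integral>\<^sup>+t'. ?A t t' \<partial>lborel) = (\<integral>\<^sup>+t'. ennreal ((norm (h t))\<^sup>2 / 2) * ennreal (k t t') \<partial>lborel)"
        by (intro nn_integral_cong ennreal_mult) (auto simp: k_def)
      also have "\<dots> = ennreal ((norm (h t))\<^sup>2 / 2) * ennreal (sqrt (2 * pi))"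
        unfolding k[of t, symmetric] by (rule nn_integral_cmult) auto
      finally show ?thesis .
    qed
    thus ?thesis by (simp add: nn_integral_cmult mult.commute)
  qed
  have "(\<integral>\<^sup>+t. (\<integral>\<^sup>+t'. ?A t' t \<partial>lborel) \<partial>lborel) = (\<integral>\<^sup>+t'. (\<integral>\<^sup>+t. ?A t' t \<partial>lborel) \<partial>lborel)"
    by (rule lborel_pair.Fubini') (simp add: split_beta')
  with 1 have 2: "(\<integral>\<^sup>+t. (\<integral>\<^sup>+t'. ?A t' t \<partial>lborel) \<partial>lborel) = ennreal (sqrt (2 * pi)) * (\<integral>\<^sup>+t. ennreal ((norm (h t))\<^sup>2 / 2) \<partial>lborel)"
    by simp
  have "(\<integral>\<^sup>+t. (\<integral>\<^sup>+t'. ennreal (norm (h t) * norm (h t') * k t t') \<partial>lborel) \<partial>lborel)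
      \<le> (\<integral>\<^sup>+t. (\<integral>\<^sup>+t'. ?A t t' + ?A t' t \<partial>lborel) \<partial>lborel)"
  proof (intro nn_integral_mono)
    fix t t'
    have "norm (h t) * norm (h t') \<le> (norm (h t))\<^sup>2 / 2 + (norm (h t'))\<^sup>2 / 2"
      using sum_squares_bound[of "norm (h t)" "norm (h t')"] by simp
    hence "norm (h t) * norm (h t') * k t t' \<le> ((norm (h t))\<^sup>2 / 2 + (norm (h t'))\<^sup>2 / 2) * k t t'"
      by (intro mult_right_mono) (auto simp: k_def)
    hence "ennreal (norm (h t) * norm (h t') * k t t') \<le> ennreal ((norm (h t))\<^sup>2 / 2 * k t t' + (norm (h t'))\<^sup>2 / 2 * k t' t)"
      by (intro ennreal_leI) (simp only: distrib_right sym[of t' t])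
    also have "\<dots> = ?A t t' + ?A t' t" by (rule ennreal_plus) (auto simp: k_def)
    finally show "ennreal (norm (h t) * norm (h t') * k t t') \<le> ?A t t' + ?A t' t" .
  qed
  also have "\<dots> = (\<integral>\<^sup>+t. (\<integral>\<^sup>+t'. ?A t t' \<partial>lborel) \<partial>lborel) + (\<integral>\<^sup>+t. (\<integral>\<^sup>+t'. ?A t' t \<partial>lborel) \<partial>lborel)"
    by (subst nn_integral_add[symmetric]) (auto intro!: nn_integral_cong nn_integral_add)
  also have "\<dots> = ennreal (sqrt (2 * pi)) * (\<integral>\<^sup>+t. ennreal ((norm (h t))\<^sup>2) \<partial>lborel)"
    unfolding 1 2 distrib_left[symmetric]
    by (subst nn_integral_add[symmetric]) (auto simp flip: ennreal_plus)
  finally show ?thesis by (simp add: k_def)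
qed

lemma gauss_fourier_shifted:
  "(\<integral>u. of_real (std_normal_density (u - a)) * iexp (x * u) \<partial>lborel) = iexp (x * a) * of_real (exp (- x\<^sup>2 / 2))"
proof -
  have "(\<integral>u. of_real (std_normal_density (u - a)) * iexp (x * u) \<partial>lborel) =
      \<bar>1\<bar> *\<^sub>R (\<integral>u. of_real (std_normal_density (a + 1 * u - a)) * iexp (x * (a + 1 * u)) \<partial>lborel)"
    by (rule lborel_integral_real_affine) auto
  also have "\<dots> = (\<integral>u. iexp (x * a) * (of_real (std_normal_density u) * iexp (x * u)) \<partial>lborel)"
    by (simp add: algebra_simps exp_add)
  finally show ?thesis unfolding integral_mult_right_zero gauss_fourier .
qed

text \<open>Without integrability the left side is 0 by convention.\<close>

lemma norm_integral_le_nn_integral: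
  fixes f :: "'a \<Rightarrow> 'b::{banach, second_countable_topology}"
  shows "ennreal (norm (integral\<^sup>L M f)) \<le> (\<integral>\<^sup>+x. ennreal (norm (f x)) \<partial>M)"
  by (cases "integrable M f") (auto simp: integral_norm_bound_ennreal not_integrable_integral_eq)

lemma borel_measurable_cnj [measurable (raw)]:
  "f \<in> borel_measurable M \<Longrightarrow> (\<lambda>x. cnj (f x)) \<in> borel_measurable M"
  using measurable_compose[of f M borel cnj borel] borel_measurable_continuous_onI[of cnj]
  by (simp add: continuous_on_cnj)

text \<open>Majorise the interval by a Gaussian weight and apply the Schur test to its transform.\<close>

lemma local_plancherel:
  fixes h :: "real \<Rightarrow> complex"
  assumes h: "integrable lborel h" and h2: "integrable lborel (\<lambda>t. (norm (h t))\<^sup>2)"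
  defines "S \<equiv> (\<lambda>u. \<integral>t. h t * iexp (t * u) \<partial>lborel)"
  shows "integrable lborel (\<lambda>u. indicator {a..a+1} u * (norm (S u))\<^sup>2)"
    and "(\<integral>u. indicator {a..a+1} u * (norm (S u))\<^sup>2 \<partial>lborel)
      \<le> sqrt (2 * pi) / std_normal_density 1 * (\<integral>t. (norm (h t))\<^sup>2 \<partial>lborel)"
proof -
  have hm [measurable]: "h \<in> borel_measurable borel" using h by auto
  have Sm [measurable]: "S \<in> borel_measurable borel" unfolding S_def by measurable
  define L where "L = (\<integral>t. norm (h t) \<partial>lborel)"
  have S_le: "norm (S u) \<le> L" for u
    unfolding S_def L_def using integral_norm_bound[of lborel "\<lambda>t. h t * iexp (t * u)"] by (simp add: norm_mult)
  have L0: "L \<ge> 0" by (simp add: L_def)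
  have w_int: "integrable lborel (\<lambda>u. std_normal_density (u - a))"
    using lborel_integrable_real_affine[OF integrable_std_normal_density, of 1 "-a"] by simp
  have V_int: "integrable lborel (\<lambda>u. std_normal_density (u - a) * (norm (S u))\<^sup>2)"
  proof (rule Bochner_Integration.integrable_bound)
    show "integrable lborel (\<lambda>u. std_normal_density (u - a) * L\<^sup>2)" using w_int by auto
    show "AE u in lborel. norm (std_normal_density (u - a) * (norm (S u))\<^sup>2) \<le> norm (std_normal_density (u - a) * L\<^sup>2)"
      using S_le L0 by (auto simp: abs_mult intro!: mult_left_mono power_mono)
  qed measurable
  define V where "V = (\<integral>u. std_normal_density (u - a) * (norm (S u))\<^sup>2 \<partial>lborel)"
  \<comment> \<open>Opening one factor of \<open>(norm (S u))\<^sup>2 = S u * cnj (S u)\<close>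
    gives the integral of \<open>h * A\<close>. Opening the other in \<open>A_eq\<close> and
    integrating over \<open>u\<close> first leaves a Gaussian kernel in
    \<open>t - t'\<close>.\<close>
  define A where "A = (\<lambda>t. \<integral>u. of_real (std_normal_density (u - a)) * cnj (S u) * iexp (t * u) \<partial>lborel)"
  have V_eq: "complex_of_real V = (\<integral>t. h t * A t \<partial>lborel)"
  proof -
    have "complex_of_real V = (\<integral>u. complex_of_real (std_normal_density (u - a) * (norm (S u))\<^sup>2) \<partial>lborel)"
      unfolding V_def by (rule integral_complex_of_real[symmetric])
    also have "\<dots> = (\<integral>u. (\<integral>t. (of_real (std_normal_density (u - a)) * cnj (S u)) * (h t * iexp (t * u)) \<partial>lborel) \<partial>lborel)"
    proof (rule Bochner_Integration.integral_cong[OF refl])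
      fix u
      have "complex_of_real (std_normal_density (u - a) * (norm (S u))\<^sup>2) = of_real (std_normal_density (u - a)) * cnj (S u) * S u"
        by (simp only: of_real_mult complex_norm_square mult_ac)
      thus "complex_of_real (std_normal_density (u - a) * (norm (S u))\<^sup>2) =
          (\<integral>t. (of_real (std_normal_density (u - a)) * cnj (S u)) * (h t * iexp (t * u)) \<partial>lborel)"
        by (simp only: integral_mult_right_zero S_def)
    qed
    also have "\<dots> = (\<integral>t. (\<integral>u. (of_real (std_normal_density (u - a)) * cnj (S u)) * (h t * iexp (t * u)) \<partial>lborel) \<partial>lborel)"
    proof (rule Fubini_product_bound(2))
      show "integrable lborel (\<lambda>u. std_normal_density (u - a) * L)" using w_int by auto
      show "integrable lborel (\<lambda>t. norm (h t))" using h by auto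
      show "norm ((of_real (std_normal_density (u - a)) * cnj (S u)) * (h t * iexp (t * u))) \<le> std_normal_density (u - a) * L * norm (h t)" for u t
        using S_le[of u] by (auto simp: norm_mult intro!: mult_right_mono mult_left_mono)
    qed measurable
    also have "\<dots> = (\<integral>t. h t * A t \<partial>lborel)"
      unfolding A_def integral_mult_right_zero[symmetric] by (simp add: mult_ac)
    finally show ?thesis .
  qed
  have A_eq: "A t = (\<integral>t'. cnj (h t') * (iexp ((t - t') * a) * of_real (exp (- (t - t')\<^sup>2 / 2))) \<partial>lborel)" for t
  proof -
    have "A t = (\<integral>u. (\<integral>t'. of_real (std_normal_density (u - a)) * iexp (t * u) * cnj (h t' * iexp (t' * u)) \<partial>lborel) \<partial>lborel)"
      unfolding A_def S_def
      by (simp only: integral_mult_right_zero Bochner_Integration.integral_cnj mult_ac)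
    also have "\<dots> = (\<integral>t'. (\<integral>u. of_real (std_normal_density (u - a)) * iexp (t * u) * cnj (h t' * iexp (t' * u)) \<partial>lborel) \<partial>lborel)"
    proof (rule Fubini_product_bound(2))
      show "integrable lborel (\<lambda>u. std_normal_density (u - a))" by (rule w_int)
      show "integrable lborel (\<lambda>t'. norm (h t'))" using h by auto
    qed (auto simp: norm_mult)
    also have "\<dots> = (\<integral>t'. cnj (h t') * (\<integral>u. of_real (std_normal_density (u - a)) * iexp ((t - t') * u) \<partial>lborel) \<partial>lborel)"
      unfolding integral_mult_right_zero[symmetric]
      by (intro Bochner_Integration.integral_cong refl)
         (simp add: exp_cnj algebra_simps exp_diff exp_minus field_simps)
    finally show ?thesis unfolding gauss_fourier_shifted .
  qed
  \<comment> \<open>The estimates continue in extended nonnegative integrals, which bypasses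
    integrability of \<open>h * A\<close>.\<close>
  have "ennreal V = ennreal (norm (\<integral>t. h t * A t \<partial>lborel))"
  proof -
    have "V \<ge> 0" unfolding V_def by auto
    thus ?thesis unfolding V_eq[symmetric] by simp
  qed
  also have "\<dots> \<le> (\<integral>\<^sup>+t. ennreal (norm (h t * A t)) \<partial>lborel)" by (rule norm_integral_le_nn_integral)
  also have "\<dots> \<le> (\<integral>\<^sup>+t. (\<integral>\<^sup>+t'. ennreal (norm (h t) * norm (h t') * exp (- (t - t')\<^sup>2 / 2)) \<partial>lborel) \<partial>lborel)"
  proof (rule nn_integral_mono)
    fix t
    have "h t * A t = (\<integral>t'. h t * (cnj (h t') * (iexp ((t - t') * a) * of_real (exp (- (t - t')\<^sup>2 / 2)))) \<partial>lborel)"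
      unfolding A_eq integral_mult_right_zero ..
    also have "ennreal (norm \<dots>) \<le> (\<integral>\<^sup>+t'. ennreal (norm (h t * (cnj (h t') * (iexp ((t - t') * a) * of_real (exp (- (t - t')\<^sup>2 / 2)))))) \<partial>lborel)"
      by (rule norm_integral_le_nn_integral)
    also have "\<dots> = (\<integral>\<^sup>+t'. ennreal (norm (h t) * norm (h t') * exp (- (t - t')\<^sup>2 / 2)) \<partial>lborel)"
      by (simp add: norm_mult mult.assoc)
    finally show "ennreal (norm (h t * A t)) \<le> (\<integral>\<^sup>+t'. ennreal (norm (h t) * norm (h t') * exp (- (t - t')\<^sup>2 / 2)) \<partial>lborel)" .
  qed
  also have "\<dots> \<le> ennreal (sqrt (2 * pi)) * (\<integral>\<^sup>+t. ennreal ((norm (h t))\<^sup>2) \<partial>lborel)"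
    by (rule schur_gauss[OF hm])
  also have "(\<integral>\<^sup>+t. ennreal ((norm (h t))\<^sup>2) \<partial>lborel) = ennreal (\<integral>t. (norm (h t))\<^sup>2 \<partial>lborel)"
    by (rule nn_integral_eq_integral[OF h2]) auto
  also have "ennreal (sqrt (2 * pi)) * \<dots> = ennreal (sqrt (2 * pi) * (\<integral>t. (norm (h t))\<^sup>2 \<partial>lborel))"
    by (rule ennreal_mult[symmetric]) auto
  finally have V_le: "V \<le> sqrt (2 * pi) * (\<integral>t. (norm (h t))\<^sup>2 \<partial>lborel)"
    by (subst (asm) ennreal_le_iff) auto
  \<comment> \<open>On the unit interval \<open>u - a\<close> lies between 0 and 1, where the
    density is at least \<open>std_normal_density 1\<close>.\<close>
  have ind: "indicator {a..a+1} u * (norm (S u))\<^sup>2 \<le> std_normal_density (u - a) * (norm (S u))\<^sup>2 / std_normal_density 1" for u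
  proof (cases "u \<in> {a..a+1}")
    case True
    have "std_normal_density 1 \<le> std_normal_density (u - a)"
      using True by (auto simp: std_normal_density_def power_le_one intro!: divide_right_mono)
    moreover have "std_normal_density 1 > 0" by (simp add: normal_density_pos)
    ultimately show ?thesis using True by (auto simp: field_simps intro!: mult_right_mono)
  qed auto
  show int: "integrable lborel (\<lambda>u. indicator {a..a+1} u * (norm (S u))\<^sup>2)"
  proof (rule Bochner_Integration.integrable_bound)
    show "integrable lborel (\<lambda>u. std_normal_density (u - a) * (norm (S u))\<^sup>2 / std_normal_density 1)" using V_int by auto
    show "AE u in lborel. norm (indicator {a..a+1} u * (norm (S u))\<^sup>2) \<le> norm (std_normal_density (u - a) * (norm (S u))\<^sup>2 / std_normal_density 1)"
      using ind by (auto simp: abs_mult)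
  qed measurable
  have "(\<integral>u. indicator {a..a+1} u * (norm (S u))\<^sup>2 \<partial>lborel) \<le> (\<integral>u. std_normal_density (u - a) * (norm (S u))\<^sup>2 / std_normal_density 1 \<partial>lborel)"
    using V_int by (intro integral_mono int ind) auto
  also have "\<dots> = V / std_normal_density 1" by (simp add: V_def)
  also have "\<dots> \<le> sqrt (2 * pi) * (\<integral>t. (norm (h t))\<^sup>2 \<partial>lborel) / std_normal_density 1"
    by (intro divide_right_mono V_le) auto
  finally show "(\<integral>u. indicator {a..a+1} u * (norm (S u))\<^sup>2 \<partial>lborel)
      \<le> sqrt (2 * pi) / std_normal_density 1 * (\<integral>t. (norm (h t))\<^sup>2 \<partial>lborel)" by simp
qed

text \<open>The sign convention differs from the usual forward difference by \<open>(-1) ^ n\<close>, so that the term \<open>f x\<close> has coefficient 1.\<close>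

definition fdiff :: "nat \<Rightarrow> ('a::comm_ring_1 \<Rightarrow> 'a) \<Rightarrow> 'a \<Rightarrow> 'a \<Rightarrow> 'a" where
  "fdiff n f h x = (\<Sum>j\<le>n. (-1) ^ j * of_nat (n choose j) * f (x + of_nat j * h))"

section \<open>Finite differences of holomorphic functions\<close>

lemma fdiff_Suc: "fdiff (Suc n) f h x = fdiff n f h x - fdiff n f h (x + h)"
proof -
  let ?F = "\<lambda>j. f (x + of_nat j * h)"
  have 1: "fdiff n f h x = ?F 0 + (\<Sum>j\<le>n. (-1) ^ Suc j * of_nat (n choose Suc j) * ?F (Suc j))"
  proof -
    have "fdiff n f h x = (\<Sum>j\<le>Suc n. (-1) ^ j * of_nat (n choose j) * ?F j)"
      by (simp add: fdiff_def binomial_eq_0)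
    thus ?thesis by (subst (asm) sum.atMost_Suc_shift) simp
  qed
  have 2: "fdiff n f h (x + h) = - (\<Sum>j\<le>n. (-1) ^ Suc j * of_nat (n choose j) * ?F (Suc j))"
    by (simp add: fdiff_def sum_negf[symmetric] algebra_simps)
  have "fdiff (Suc n) f h x = ?F 0 + (\<Sum>j\<le>n. (-1) ^ Suc j * of_nat (Suc n choose Suc j) * ?F (Suc j))"
    unfolding fdiff_def by (subst sum.atMost_Suc_shift) simp
  also have "\<dots> = ?F 0 + (\<Sum>j\<le>n. (-1) ^ Suc j * of_nat (n choose Suc j) * ?F (Suc j))
      + (\<Sum>j\<le>n. (-1) ^ Suc j * of_nat (n choose j) * ?F (Suc j))"
    by (simp add: sum.distrib[symmetric] algebra_simps)
  finally show ?thesis unfolding 1 2 by simp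
qed

text \<open>Induction through the mean value inequality: by \<open>fdiff_Suc\<close> the next
  difference is, up to sign, the increment over the segment from 0 to \<open>h\<close> of
  \<open>fdiff n f h (x + t)\<close> as a function of \<open>t\<close>, whose derivative is the
  difference of \<open>deriv f\<close>.\<close>

lemma fdiff_bound:
  fixes f :: "complex \<Rightarrow> complex"
  assumes "open S" "convex S" "f holomorphic_on S" "x \<in> S" "x + of_nat n * h \<in> S"
    and "\<And>z. z \<in> S \<Longrightarrow> norm ((deriv ^^ n) f z) \<le> B"
  shows "norm (fdiff n f h x) \<le> B * norm h ^ n"
  using assms(3-6)
proof (induction n arbitrary: f x)
  case 0
  thus ?case by (simp add: fdiff_def)
next
  case (Suc n)
  \<comment> \<open>Convexity puts all intermediate points in \<open>S\<close>, as only the two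
    extreme ones are assumed to lie there.\<close>
  have mem: "x + of_real c * h \<in> S" if "c \<ge> 0" "c \<le> real (Suc n)" for c
  proof -
    define l where "l = c / real (Suc n)"
    have l: "l \<ge> 0" "l \<le> 1" using that by (auto simp: l_def field_simps)
    have "(1 - l) *\<^sub>R x + l *\<^sub>R (x + of_nat (Suc n) * h) \<in> S"
      using l Suc.prems by (intro convexD[OF assms(2)]) auto
    also have "(1 - l) *\<^sub>R x + l *\<^sub>R (x + of_nat (Suc n) * h) = x + of_real (l * real (Suc n)) * h"
      by (simp add: scaleR_conv_of_real algebra_simps)
    also have "l * real (Suc n) = c" by (simp add: l_def)
    finally show ?thesis .
  qed
  have seg: "\<exists>c\<ge>0. c \<le> 1 \<and> t = of_real c * h" if "t \<in> closed_segment 0 h" for t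
    using that by (auto simp: in_segment scaleR_conv_of_real)
  have "norm ((\<lambda>t. fdiff n f h (x + t)) 0 - (\<lambda>t. fdiff n f h (x + t)) h) \<le> B * norm h ^ n * norm (0 - h)"
  proof (rule field_differentiable_bound[where f' = "\<lambda>t. fdiff n (deriv f) h (x + t)"])
    show "convex (closed_segment 0 h)" by simp
    fix t assume "t \<in> closed_segment 0 h"
    then obtain c where c: "c \<ge> 0" "c \<le> 1" "t = of_real c * h" using seg by blast
    have "(f has_field_derivative deriv f (x + t + of_nat j * h)) (at (x + t + of_nat j * h))" if "j \<le> n" for j
    proof (rule holomorphic_derivI[OF Suc.prems(1) assms(1)])
      have "x + of_real (c + real j) * h \<in> S" using c that by (intro mem) auto
      thus "x + t + of_nat j * h \<in> S" by (simp add: c algebra_simps)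
    qed
    hence "((\<lambda>t. f (x + t + of_nat j * h)) has_field_derivative deriv f (x + t + of_nat j * h) * 1) (at t within closed_segment 0 h)" if "j \<le> n" for j
      using that by (intro DERIV_chain2[of f]) (auto intro!: derivative_eq_intros)
    thus "((\<lambda>t. fdiff n f h (x + t)) has_field_derivative fdiff n (deriv f) h (x + t)) (at t within closed_segment 0 h)"
      unfolding fdiff_def by (auto intro!: DERIV_sum DERIV_cmult)
    show "norm (fdiff n (deriv f) h (x + t)) \<le> B * norm h ^ n"
    proof (rule Suc.IH)
      show "deriv f holomorphic_on S" by (rule holomorphic_deriv[OF Suc.prems(1) assms(1)])
      show "x + t \<in> S" using mem[of c] c by simp
      show "x + t + of_nat n * h \<in> S" using mem[of "c + real n"] c by (simp add: algebra_simps)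
      show "norm ((deriv ^^ n) (deriv f) z) \<le> B" if "z \<in> S" for z
        using Suc.prems(4)[OF that] by (simp add: funpow_Suc_right del: funpow.simps)
    qed
  qed auto
  thus ?case by (simp add: fdiff_Suc mult_ac)
qed

text \<open>Cauchy's estimate on discs of radius \<open>\<rho> / 4\<close> about points of
  \<open>ball u (\<rho> / 2)\<close>; even the closed discs stay inside
  \<open>ball u \<rho>\<close>. The bound \<open>M + 1\<close> appears because the estimate asks for
  values in an open ball.\<close>

lemma fdiff_cauchy:
  fixes f :: "complex \<Rightarrow> complex"
  assumes f: "f holomorphic_on ball u \<rho>" and \<rho>: "\<rho> > 0" and n: "n > 0"
    and M: "\<And>z. z \<in> ball u \<rho> \<Longrightarrow> norm (f z) \<le> M" and h: "real n * norm h < \<rho> / 2"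
  shows "norm (fdiff n f h u) \<le> fact n * (M + 1) * (4 * norm h / \<rho>) ^ n"
proof -
  have "norm (fdiff n f h u) \<le> (fact n * (M + 1) / (\<rho> / 4) ^ n) * norm h ^ n"
  proof (rule fdiff_bound[of "ball u (\<rho> / 2)"])
    show "f holomorphic_on ball u (\<rho> / 2)"
      by (rule holomorphic_on_subset[OF f]) (use \<rho> in auto)
    fix z assume z: "z \<in> ball u (\<rho> / 2)"
    have sub: "cball z (\<rho> / 4) \<subseteq> ball u \<rho>"
    proof
      fix w assume "w \<in> cball z (\<rho> / 4)"
      thus "w \<in> ball u \<rho>" using z \<rho> dist_triangle[of u w z] by auto
    qed
    show "norm ((deriv ^^ n) f z) \<le> fact n * (M + 1) / (\<rho> / 4) ^ n"
    proof (rule Cauchy_higher_deriv_bound)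
      show "f holomorphic_on ball z (\<rho> / 4)"
        using sub by (intro holomorphic_on_subset[OF f]) auto
      show "continuous_on (cball z (\<rho> / 4)) f"
        using sub by (intro holomorphic_on_imp_continuous_on holomorphic_on_subset[OF f]) auto
      show "f w \<in> ball 0 (M + 1)" if "w \<in> ball z (\<rho> / 4)" for w
      proof -
        have "w \<in> cball z (\<rho> / 4)" using that by auto
        with sub have "w \<in> ball u \<rho>" by blast
        from M[OF this] show ?thesis by simp
      qed
    qed (use \<rho> n in auto)
  qed (use \<rho> h in \<open>auto simp: dist_norm norm_mult\<close>)
  also have "\<dots> = fact n * (M + 1) * (4 * norm h / \<rho>) ^ n"
    by (simp add: power_divide power_mult_distrib)
  finally show ?thesis .
qed

section \<open>Gaussian tails and averaged differences\<close>

lemma power_div_fact_le_exp: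
  fixes x :: real
  assumes "x \<ge> 0"
  shows "x ^ n / fact n \<le> exp x"
proof -
  have "(\<Sum>k\<in>{n}. x ^ k /\<^sub>R fact k) \<le> (\<Sum>k. x ^ k /\<^sub>R fact k)"
    using assms by (intro sum_le_suminf summable_exp_generic) auto
  thus ?thesis by (simp add: exp_def field_simps)
qed

lemma std_normal_density_le_1: "std_normal_density x \<le> 1"
proof -
  have "sqrt (2 * pi) \<ge> 1" using pi_ge_two by (intro real_le_rsqrt) auto
  hence "1 / sqrt (2 * pi) \<le> 1" by simp
  moreover have "exp (- x\<^sup>2 / 2) \<le> 1" by simp
  ultimately have "1 / sqrt (2 * pi) * exp (- x\<^sup>2 / 2) \<le> 1 * 1"
    by (intro mult_mono) auto
  thus ?thesis by (simp add: std_normal_density_def)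
qed

text \<open>For \<open>\<bar>x\<bar> > 1\<close> the power is at most
  \<open>(x\<^sup>2) ^ m\<close>, and a single term of the exponential series bounds this by
  \<open>2 ^ m * fact m * exp (x\<^sup>2 / 2)\<close>, whose exponential cancels that of the
  density.\<close>

lemma std_normal_density_power_le: "std_normal_density x * \<bar>x\<bar> ^ m \<le> 2 ^ m * fact m"
proof -
  have 1: "\<bar>x\<bar> ^ m \<le> 2 ^ m * fact m * exp (x\<^sup>2 / 2)"
  proof (cases "\<bar>x\<bar> \<le> 1")
    case True
    have "\<bar>x\<bar> ^ m \<le> 1 * 1 * 1" using True by (simp add: power_le_one)
    also have "\<dots> \<le> 2 ^ m * fact m * exp (x\<^sup>2 / 2)"
      by (intro mult_mono) (auto simp: fact_ge_1)
    finally show ?thesis .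
  next
    case False
    hence "\<bar>x\<bar> ^ m \<le> \<bar>x\<bar> ^ (2 * m)" by (intro power_increasing) auto
    also have "\<dots> = 2 ^ m * fact m * ((x\<^sup>2 / 2) ^ m / fact m)"
      by (simp add: power_mult power_divide)
    also have "\<dots> \<le> 2 ^ m * fact m * exp (x\<^sup>2 / 2)"
      by (intro mult_left_mono power_div_fact_le_exp) auto
    finally show ?thesis .
  qed
  have e: "std_normal_density x * exp (x\<^sup>2 / 2) = std_normal_density 0"
    by (simp add: std_normal_density_def flip: exp_add)
  have "std_normal_density x * \<bar>x\<bar> ^ m \<le> std_normal_density x * (2 ^ m * fact m * exp (x\<^sup>2 / 2))"
    by (intro mult_left_mono 1) auto
  also have "\<dots> = 2 ^ m * fact m * (std_normal_density x * exp (x\<^sup>2 / 2))" by simp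
  also have "\<dots> \<le> 2 ^ m * fact m * 1"
    unfolding e by (intro mult_left_mono std_normal_density_le_1) auto
  finally show ?thesis by simp
qed

definition gauss_moment :: "nat \<Rightarrow> real" where
  "gauss_moment k = (\<integral>v. std_normal_density v * \<bar>v\<bar> ^ k \<partial>lborel)"

lemma gauss_moment_nonneg: "gauss_moment k \<ge> 0"
  unfolding gauss_moment_def by (intro integral_nonneg_AE AE_I2) auto

lemma integrable_gauss_mult:
  assumes "integrable lborel G" "b \<noteq> 0"
  shows "integrable lborel (\<lambda>v. std_normal_density v * G (u + b * v))"
proof (rule Bochner_Integration.integrable_bound)
  show int: "integrable lborel (\<lambda>v. G (u + b * v))"
    by (rule lborel_integrable_real_affine[OF assms])
  have [measurable]: "G \<in> borel_measurable borel" using assms(1) by auto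
  show "(\<lambda>v. std_normal_density v * G (u + b * v)) \<in> borel_measurable lborel" by measurable
  show "AE v in lborel. norm (std_normal_density v * G (u + b * v)) \<le> norm (G (u + b * v))"
    using std_normal_density_le_1 by (auto simp: abs_mult intro!: mult_left_le_one_le)
qed

text \<open>The left side is the Gaussian average of \<open>fdiff m G (v / Y) u\<close>, since the
  density has mass 1. For \<open>\<bar>v\<bar> \<le> \<delta>\<close> the hypothesis
  \<open>D\<close> applies. Beyond \<open>\<delta>\<close> no smoothness is available, and the
  factor \<open>(\<bar>v\<bar> / \<delta>) ^ m \<ge> 1\<close> is inserted: against
  \<open>G u\<close> it gives a Gaussian moment; against the shifted values its product with the
  density is bounded uniformly, leaving the integral of \<open>\<bar>G\<bar>\<close>.\<close>

lemma gauss_remainder: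
  assumes G: "integrable lborel G" and Y: "Y > 0" and \<delta>: "\<delta> > 0" and B: "B \<ge> 0"
    and D: "\<And>v. \<bar>v\<bar> \<le> \<delta> \<Longrightarrow> \<bar>fdiff m G (v / Y) u\<bar> \<le> B * \<bar>v\<bar> ^ m"
  shows "\<bar>G u + (\<Sum>j=1..m. (-1) ^ j * of_nat (m choose j) * (\<integral>v. std_normal_density v * G (u + (j / Y) * v) \<partial>lborel))\<bar>
    \<le> (B + \<bar>G u\<bar> / \<delta> ^ m) * gauss_moment m + 2 ^ m * (2 ^ m * fact m / \<delta> ^ m) * Y * (\<integral>x. \<bar>G x\<bar> \<partial>lborel)"
proof -
  define L where "L = (\<integral>x. \<bar>G x\<bar> \<partial>lborel)"
  have L0: "L \<ge> 0" by (simp add: L_def)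
  define \<kappa> where "\<kappa> = (2 ^ m * fact m / \<delta> ^ m :: real)"
  have \<kappa>0: "\<kappa> \<ge> 0" using \<delta> by (simp add: \<kappa>_def)
  have split: "{..m} = insert 0 {1..m}" by auto
  have fd: "fdiff m G (v / Y) u = G u + (\<Sum>j=1..m. (-1) ^ j * of_nat (m choose j) * G (u + (j / Y) * v))" for v
    unfolding fdiff_def split by (subst sum.insert) auto
  have intj: "integrable lborel (\<lambda>v. std_normal_density v * G (u + (real j / Y) * v))" if "j \<in> {1..m}" for j
    using that Y by (intro integrable_gauss_mult G) auto
  have absj: "integrable lborel (\<lambda>v. \<bar>G (u + (real j / Y) * v)\<bar>)"
    and absj_le: "(\<integral>v. \<bar>G (u + (real j / Y) * v)\<bar> \<partial>lborel) \<le> Y * L" if "j \<in> {1..m}" for j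
  proof -
    have nz: "real j / Y \<noteq> 0" using that Y by auto
    show "integrable lborel (\<lambda>v. \<bar>G (u + (real j / Y) * v)\<bar>)"
      by (rule integrable_abs[OF lborel_integrable_real_affine[OF G nz]])
    \<comment> \<open>The substitution costs \<open>Y / j\<close>, the origin of the factor
      \<open>Y\<close> in the bound.\<close>
    have "L = \<bar>real j / Y\<bar> *\<^sub>R (\<integral>v. \<bar>G (u + (real j / Y) * v)\<bar> \<partial>lborel)"
      unfolding L_def by (rule lborel_integral_real_affine[OF nz])
    hence "(\<integral>v. \<bar>G (u + (real j / Y) * v)\<bar> \<partial>lborel) = Y * L / real j"
      using that Y by (simp add: field_simps)
    also have "\<dots> \<le> Y * L" using that Y L0 mult_left_mono[of 1 "real j" "Y * L"] by (simp add: divide_le_eq)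
    finally show "(\<integral>v. \<bar>G (u + (real j / Y) * v)\<bar> \<partial>lborel) \<le> Y * L" .
  qed
  have "G u + (\<Sum>j=1..m. (-1) ^ j * of_nat (m choose j) * (\<integral>v. std_normal_density v * G (u + (j / Y) * v) \<partial>lborel))
      = (\<integral>v. std_normal_density v * G u \<partial>lborel) +
        (\<integral>v. (\<Sum>j=1..m. (-1) ^ j * of_nat (m choose j) * (std_normal_density v * G (u + (j / Y) * v))) \<partial>lborel)"
    using intj by (subst Bochner_Integration.integral_sum) auto
  also have "\<dots> = (\<integral>v. std_normal_density v * fdiff m G (v / Y) u \<partial>lborel)"
  proof (subst Bochner_Integration.integral_add[symmetric])
    show "integrable lborel (\<lambda>v. std_normal_density v * G u)" by auto
    show "integrable lborel (\<lambda>v. \<Sum>j=1..m. (-1) ^ j * of_nat (m choose j) * (std_normal_density v * G (u + (j / Y) * v)))"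
      using intj by (intro Bochner_Integration.integrable_sum integrable_mult_right) auto
  qed (simp add: fd distrib_left sum_distrib_left mult_ac)
  finally have eq: "G u + (\<Sum>j=1..m. (-1) ^ j * of_nat (m choose j) * (\<integral>v. std_normal_density v * G (u + (j / Y) * v) \<partial>lborel))
      = (\<integral>v. std_normal_density v * fdiff m G (v / Y) u \<partial>lborel)" .
  \<comment> \<open>One majorant covers both ranges of \<open>v\<close>, so the integral is never
    split.\<close>
  define Z where "Z = (\<lambda>v. (B + \<bar>G u\<bar> / \<delta> ^ m) * (std_normal_density v * \<bar>v\<bar> ^ m)
      + (\<Sum>j=1..m. real (m choose j) * \<kappa> * \<bar>G (u + (j / Y) * v)\<bar>))"
  have Zsum: "(\<Sum>j=1..m. real (m choose j) * \<kappa> * \<bar>G (u + (j / Y) * v)\<bar>) \<ge> 0" for v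
    using \<kappa>0 by (intro sum_nonneg) auto
  have Z: "norm (std_normal_density v * fdiff m G (v / Y) u) \<le> Z v" for v
  proof (cases "\<bar>v\<bar> \<le> \<delta>")
    case True
    have "norm (std_normal_density v * fdiff m G (v / Y) u) \<le> std_normal_density v * (B * \<bar>v\<bar> ^ m)"
      using D[OF True] by (simp add: abs_mult mult_left_mono)
    also have "\<dots> \<le> (B + \<bar>G u\<bar> / \<delta> ^ m) * (std_normal_density v * \<bar>v\<bar> ^ m)"
      using \<delta> by (simp add: algebra_simps)
    finally show ?thesis using Zsum[of v] by (simp add: Z_def)
  next
    case False
    hence one: "1 \<le> (\<bar>v\<bar> / \<delta>) ^ m" using \<delta> by (intro one_le_power) auto
    have "norm (std_normal_density v * fdiff m G (v / Y) u) \<le> std_normal_density v *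
        (\<bar>G u\<bar> + (\<Sum>j=1..m. real (m choose j) * \<bar>G (u + (j / Y) * v)\<bar>))"
    proof -
      have "\<bar>\<Sum>j=1..m. (-1) ^ j * of_nat (m choose j) * G (u + (j / Y) * v)\<bar> \<le> (\<Sum>j=1..m. real (m choose j) * \<bar>G (u + (j / Y) * v)\<bar>)"
        by (rule order.trans[OF sum_abs]) (simp add: abs_mult power_abs)
      hence "\<bar>fdiff m G (v / Y) u\<bar> \<le> \<bar>G u\<bar> + (\<Sum>j=1..m. real (m choose j) * \<bar>G (u + (j / Y) * v)\<bar>)"
        unfolding fd by linarith
      thus ?thesis by (simp add: abs_mult mult_left_mono)
    qed
    also have "\<dots> \<le> (std_normal_density v * (\<bar>v\<bar> / \<delta>) ^ m) *
        (\<bar>G u\<bar> + (\<Sum>j=1..m. real (m choose j) * \<bar>G (u + (j / Y) * v)\<bar>))"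
      using mult_left_mono[OF one, of "std_normal_density v"] by (intro mult_right_mono add_nonneg_nonneg sum_nonneg) auto
    also have "\<dots> = \<bar>G u\<bar> / \<delta> ^ m * (std_normal_density v * \<bar>v\<bar> ^ m) +
        (std_normal_density v * \<bar>v\<bar> ^ m / \<delta> ^ m) * (\<Sum>j=1..m. real (m choose j) * \<bar>G (u + (j / Y) * v)\<bar>)"
      by (simp add: power_divide distrib_left)
    also have "\<dots> \<le> \<bar>G u\<bar> / \<delta> ^ m * (std_normal_density v * \<bar>v\<bar> ^ m) +
        \<kappa> * (\<Sum>j=1..m. real (m choose j) * \<bar>G (u + (j / Y) * v)\<bar>)"
      unfolding \<kappa>_def using \<delta>
      by (intro add_left_mono mult_right_mono divide_right_mono std_normal_density_power_le sum_nonneg) auto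
    also have "\<dots> \<le> Z v"
      using B unfolding Z_def by (simp add: algebra_simps sum_distrib_left)
    finally show ?thesis .
  qed
  have Zint: "integrable lborel Z"
    unfolding Z_def using absj integrable_std_normal_moment_abs[of m]
    by (intro Bochner_Integration.integrable_add Bochner_Integration.integrable_sum integrable_mult_right) auto
  have "\<bar>\<integral>v. std_normal_density v * fdiff m G (v / Y) u \<partial>lborel\<bar> \<le> (\<integral>v. Z v \<partial>lborel)"
  proof -
    have [measurable]: "G \<in> borel_measurable borel" using G by auto
    have "integrable lborel (\<lambda>v. std_normal_density v * fdiff m G (v / Y) u)"
    proof (rule Bochner_Integration.integrable_bound[OF Zint])
      show "(\<lambda>v. std_normal_density v * fdiff m G (v / Y) u) \<in> borel_measurable lborel"
        unfolding fd by measurable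
      show "AE v in lborel. norm (std_normal_density v * fdiff m G (v / Y) u) \<le> norm (Z v)"
        using Z order.trans[OF Z abs_ge_self] by auto
    qed
    hence "(\<integral>v. \<bar>std_normal_density v * fdiff m G (v / Y) u\<bar> \<partial>lborel) \<le> (\<integral>v. Z v \<partial>lborel)"
      using Z by (intro integral_mono integrable_abs Zint) auto
    thus ?thesis using integral_abs_bound[of lborel "\<lambda>v. std_normal_density v * fdiff m G (v / Y) u"] by linarith
  qed
  also have "(\<integral>v. Z v \<partial>lborel) = (B + \<bar>G u\<bar> / \<delta> ^ m) * gauss_moment m
      + (\<Sum>j=1..m. real (m choose j) * \<kappa> * (\<integral>v. \<bar>G (u + (j / Y) * v)\<bar> \<partial>lborel))"
    unfolding Z_def gauss_moment_def using absj integrable_std_normal_moment_abs[of m]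
    by (subst Bochner_Integration.integral_add) (auto simp: Bochner_Integration.integral_sum)
  also have "(\<Sum>j=1..m. real (m choose j) * \<kappa> * (\<integral>v. \<bar>G (u + (j / Y) * v)\<bar> \<partial>lborel)) \<le>
      (\<Sum>j=1..m. real (m choose j) * \<kappa> * (Y * L))"
    using \<kappa>0 absj_le by (intro sum_mono mult_left_mono) auto
  also have "\<dots> = (\<Sum>j=1..m. real (m choose j)) * (\<kappa> * Y * L)"
    unfolding sum_distrib_right by (intro sum.cong) (auto simp: mult_ac)
  also have "\<dots> \<le> 2 ^ m * (\<kappa> * Y * L)"
  proof (intro mult_right_mono)
    have "(\<Sum>j=1..m. real (m choose j)) \<le> (\<Sum>j\<le>m. real (m choose j))"
      by (intro sum_mono2) auto
    also have "\<dots> = 2 ^ m" by (simp add: choose_row_sum flip: of_nat_sum)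
    finally show "(\<Sum>j=1..m. real (m choose j)) \<le> 2 ^ m" .
  qed (use \<kappa>0 Y L0 in auto)
  finally show ?thesis unfolding eq by (simp add: \<kappa>_def L_def mult_ac)
qed

text \<open>By \<open>gauss_smoothing_fourier\<close> the average is an inverse transform of a
  Gaussian times \<open>fourier G\<close>, to which \<open>local_plancherel\<close> applies. Outside
  \<open>{-X..X}\<close> only the trivial bound for \<open>fourier G\<close> enters, and the
  Gaussian tail supplies the saving \<open>(b * X) ^ k\<close>.\<close>

lemma gauss_smoothing_L2:
  assumes G: "integrable lborel G" and b: "b > 0" and X: "X > 0"
  shows "integrable lborel (\<lambda>u. indicator {a..a+1} u * (\<integral>v. std_normal_density v * G (u + b * v) \<partial>lborel)\<^sup>2)"
    and "(\<integral>u. indicator {a..a+1} u * (\<integral>v. std_normal_density v * G (u + b * v) \<partial>lborel)\<^sup>2 \<partial>lborel)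
      \<le> sqrt (2 * pi) / std_normal_density 1 *
         ((\<integral>t. indicator {-X..X} t * (norm (fourier G t))\<^sup>2 \<partial>lborel)
           + (\<integral>x. \<bar>G x\<bar> \<partial>lborel)\<^sup>2 * gauss_moment k / (b * (b * X) ^ k))"
proof -
  define L where "L = (\<integral>x. \<bar>G x\<bar> \<partial>lborel)"
  have L0: "L \<ge> 0" by (simp add: L_def)
  have [measurable]: "G \<in> borel_measurable borel" using G by auto
  define h where "h = (\<lambda>t. of_real (std_normal_density (b * t)) * fourier G t / of_real (sqrt (2 * pi)))"
  have hm [measurable]: "h \<in> borel_measurable borel" unfolding h_def by measurable
  have FL: "norm (fourier G t) \<le> L" for t unfolding L_def by (rule norm_fourier_le)
  have pi1: "1 \<le> sqrt (2 * pi)" using pi_ge_two by (intro real_le_rsqrt) auto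
  have nh: "norm (h t) \<le> std_normal_density (b * t) * norm (fourier G t)" for t
  proof -
    have "norm (h t) = std_normal_density (b * t) * norm (fourier G t) / sqrt (2 * pi)"
      by (simp add: h_def norm_mult norm_divide)
    also have "\<dots> \<le> std_normal_density (b * t) * norm (fourier G t) / 1"
      using pi1 by (intro divide_left_mono) auto
    finally show ?thesis by simp
  qed
  have phi_int: "integrable lborel (\<lambda>t. std_normal_density (b * t))"
    by (rule integrable_std_normal_density_scaled) (use b in auto)
  have h_int: "integrable lborel h"
  proof (rule Bochner_Integration.integrable_bound)
    show "integrable lborel (\<lambda>t. std_normal_density (b * t) * L)" using phi_int by auto
    show "AE t in lborel. norm (h t) \<le> norm (std_normal_density (b * t) * L)"
      using L0 by (intro AE_I2 order.trans[OF nh]) (auto simp: abs_mult intro!: mult_left_mono FL)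
  qed measurable
  define Z where "Z = (\<lambda>t. indicator {-X..X} t * (norm (fourier G t))\<^sup>2
      + L\<^sup>2 / (b * X) ^ k * (std_normal_density (0 + b * t) * \<bar>0 + b * t\<bar> ^ k))"
  have Z: "(norm (h t))\<^sup>2 \<le> Z t" for t
  proof (cases "\<bar>t\<bar> \<le> X")
    case True
    have "norm (h t) \<le> 1 * norm (fourier G t)"
      by (intro order.trans[OF nh] mult_right_mono std_normal_density_le_1) auto
    hence "(norm (h t))\<^sup>2 \<le> (norm (fourier G t))\<^sup>2" by (intro power_mono) auto
    also have "\<dots> \<le> Z t" using True b X by (simp add: Z_def abs_le_iff)
    finally show ?thesis .
  next
    case False
    have one: "1 \<le> (\<bar>b * t\<bar> / (b * X)) ^ k"
      using False b X by (intro one_le_power) (auto simp: abs_mult)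
    have "(norm (h t))\<^sup>2 \<le> (std_normal_density (b * t) * L)\<^sup>2"
      by (intro power_mono order.trans[OF nh] mult_left_mono FL) auto
    also have "\<dots> = L\<^sup>2 * (std_normal_density (b * t) * std_normal_density (b * t))"
      by (simp add: power2_eq_square)
    \<comment> \<open>One of the two Gaussian factors is bounded by 1 and replaced by the inserted
      power; the other keeps the moment finite.\<close>
    also have "\<dots> \<le> L\<^sup>2 * (std_normal_density (b * t) * (\<bar>b * t\<bar> / (b * X)) ^ k)"
      by (intro mult_left_mono order.trans[OF std_normal_density_le_1 one]) auto
    also have "\<dots> \<le> Z t" by (simp add: Z_def power_divide)
    finally show ?thesis .
  qed
  have F_int: "integrable lborel (\<lambda>t. indicator {-X..X} t * (norm (fourier G t))\<^sup>2)"
  proof (rule Bochner_Integration.integrable_bound)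
    show "integrable lborel (\<lambda>t. indicator {-X..X} t * L\<^sup>2)"
      using X by (intro integrable_mult_left) (auto simp: integrable_indicator_iff)
    show "AE t in lborel. norm (indicator {-X..X} t * (norm (fourier G t))\<^sup>2) \<le> norm (indicator {-X..X} t * L\<^sup>2)"
      by (auto simp: indicator_def intro!: power_mono FL)
  qed measurable
  have mom_int: "integrable lborel (\<lambda>t. std_normal_density (0 + b * t) * \<bar>0 + b * t\<bar> ^ k)"
    by (rule lborel_integrable_real_affine[OF integrable_std_normal_moment_abs]) (use b in auto)
  have mom: "(\<integral>t. std_normal_density (0 + b * t) * \<bar>0 + b * t\<bar> ^ k \<partial>lborel) = gauss_moment k / b"
  proof -
    have "gauss_moment k = \<bar>b\<bar> *\<^sub>R (\<integral>t. std_normal_density (0 + b * t) * \<bar>0 + b * t\<bar> ^ k \<partial>lborel)"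
      unfolding gauss_moment_def by (rule lborel_integral_real_affine) (use b in auto)
    thus ?thesis using b by simp
  qed
  have Z_int: "integrable lborel Z"
    unfolding Z_def by (intro Bochner_Integration.integrable_add F_int integrable_mult_right mom_int)
  have h2_int: "integrable lborel (\<lambda>t. (norm (h t))\<^sup>2)"
    by (rule Bochner_Integration.integrable_bound[OF Z_int]) (use Z order.trans[OF Z abs_ge_self] in auto)
  have "(\<integral>t. (norm (h t))\<^sup>2 \<partial>lborel) \<le> (\<integral>t. Z t \<partial>lborel)"
    by (intro integral_mono h2_int Z_int Z)
  also have "\<dots> = (\<integral>t. indicator {-X..X} t * (norm (fourier G t))\<^sup>2 \<partial>lborel) + L\<^sup>2 / (b * X) ^ k * (gauss_moment k / b)"
    unfolding Z_def mom[symmetric] integral_mult_right_zero[symmetric]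
    by (intro Bochner_Integration.integral_add F_int integrable_mult_right mom_int)
  also have "\<dots> = (\<integral>t. indicator {-X..X} t * (norm (fourier G t))\<^sup>2 \<partial>lborel) + L\<^sup>2 * gauss_moment k / (b * (b * X) ^ k)"
    by simp
  finally have h2: "(\<integral>t. (norm (h t))\<^sup>2 \<partial>lborel) \<le> \<dots>" .
  have S: "(norm (\<integral>t. h t * iexp (t * u) \<partial>lborel))\<^sup>2 = (\<integral>v. std_normal_density v * G (u + b * v) \<partial>lborel)\<^sup>2" for u
    unfolding h_def gauss_smoothing_fourier[OF G b, symmetric] by simp
  show "integrable lborel (\<lambda>u. indicator {a..a+1} u * (\<integral>v. std_normal_density v * G (u + b * v) \<partial>lborel)\<^sup>2)"
    using local_plancherel(1)[OF h_int h2_int, of a] unfolding S .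
  have "(\<integral>u. indicator {a..a+1} u * (\<integral>v. std_normal_density v * G (u + b * v) \<partial>lborel)\<^sup>2 \<partial>lborel)
      \<le> sqrt (2 * pi) / std_normal_density 1 * (\<integral>t. (norm (h t))\<^sup>2 \<partial>lborel)"
    using local_plancherel(2)[OF h_int h2_int, of a] unfolding S .
  also have "\<dots> \<le> sqrt (2 * pi) / std_normal_density 1 *
      ((\<integral>t. indicator {-X..X} t * (norm (fourier G t))\<^sup>2 \<partial>lborel) + L\<^sup>2 * gauss_moment k / (b * (b * X) ^ k))"
    by (intro mult_left_mono h2) auto
  finally show "(\<integral>u. indicator {a..a+1} u * (\<integral>v. std_normal_density v * G (u + b * v) \<partial>lborel)\<^sup>2 \<partial>lborel)
      \<le> sqrt (2 * pi) / std_normal_density 1 *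
         ((\<integral>t. indicator {-X..X} t * (norm (fourier G t))\<^sup>2 \<partial>lborel)
           + (\<integral>x. \<bar>G x\<bar> \<partial>lborel)\<^sup>2 * gauss_moment k / (b * (b * X) ^ k))"
    by (simp add: L_def)
qed

section \<open>The fourth moment of the error term\<close>

definition E2_weight :: "real poly \<Rightarrow> real \<Rightarrow> real \<Rightarrow> real" where
  "E2_weight P \<sigma> u = E2_log_square P u * exp (- (\<sigma> * u))"

text \<open>For \<open>exp u\<close> between \<open>T\<close> and \<open>2 * T\<close>, the
  exponential maps the disc of radius \<open>1 / (16 * T)\<close> about \<open>u\<close> into the
  disc of radius \<open>1/4\<close> about \<open>exp u\<close>, inside the strip where the extension
  of \<open>E2\<close> is polynomially bounded: smoothness at a fixed scale in \<open>t\<close>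
  becomes smoothness at scale \<open>1 / T\<close> in \<open>ln t\<close>. In
  \<open>fdiff_cauchy\<close> half this radius is \<open>1 / (32 * T)\<close>, and
  \<open>64 = 4 * 16\<close>.\<close>

lemma E2_weight_fdiff_bound:
  assumes \<sigma>: "\<sigma> \<ge> 0"
  obtains C n where "C \<ge> 0"
    and "\<And>T u. T \<ge> 2 \<Longrightarrow> u \<in> {ln T..ln (2 * T)} \<Longrightarrow> \<bar>E2_weight P \<sigma> u\<bar> \<le> C * T ^ n"
    and "\<And>T u m h. T \<ge> 2 \<Longrightarrow> u \<in> {ln T..ln (2 * T)} \<Longrightarrow> m > 0 \<Longrightarrow> real m * \<bar>h\<bar> < 1 / (32 * T) \<Longrightarrow>
           \<bar>fdiff m (E2_weight P \<sigma>) h u\<bar> \<le> fact m * (C * T ^ n + 1) * (64 * T * \<bar>h\<bar>) ^ m"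
proof -
  obtain Ec C n where Ec: "Ec holomorphic_on {z. Re z > 0}"
    "\<And>x. x > 0 \<Longrightarrow> Ec (of_real x) = of_real (E2 P x)" "C \<ge> 0"
    "\<And>z. Re z > 1/2 \<Longrightarrow> \<bar>Im z\<bar> \<le> 1/4 \<Longrightarrow> norm (Ec z) \<le> C * (1 + norm z) ^ n"
    by (rule E2_holomorphic_extension[of P]) blast
  define f where "f = (\<lambda>w. Ec (exp w) ^ 2 * exp (- (of_real \<sigma> * w)))"
  have f_real: "f (of_real r) = of_real (E2_weight P \<sigma> r)" if "r \<ge> 0" for r
  proof -
    have "Ec (exp (of_real r)) = of_real (E2 P (exp r))"
      using Ec(2)[of "exp r"] by (simp add: exp_of_real)
    thus ?thesis using that by (simp add: f_def E2_weight_def E2_log_square_def exp_of_real[symmetric])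
  qed
  have exp_near: "Re (exp w) > 1/2" "\<bar>Im (exp w)\<bar> \<le> 1/4" "norm (exp w) \<le> 2 * T + 1/4" "Re w \<ge> 0"
    if T: "T \<ge> 2" and u: "u \<in> {ln T..ln (2 * T)}" and w: "w \<in> ball (of_real u) (1 / (16 * T))" for T u :: real and w
  proof -
    have ge: "exp u \<ge> T" using u T by (simp add: ln_ge_iff[symmetric] flip: ln_le_cancel_iff)
    have le: "exp u \<le> 2 * T" using u T by (simp flip: ln_le_cancel_iff)
    have d: "norm (w - of_real u) < 1 / (16 * T)" using w by (simp add: dist_norm norm_minus_commute)
    also have "\<dots> \<le> 1/2" using T by (simp add: field_simps)
    finally have half: "norm (w - of_real u) \<le> 1/2" by simp
    have "exp w - of_real (exp u) = of_real (exp u) * (exp (w - of_real u) - 1)"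
      by (simp add: exp_diff exp_of_real[symmetric] algebra_simps)
    hence "norm (exp w - of_real (exp u)) = exp u * norm (exp (w - of_real u) - 1)"
      by (simp add: norm_mult)
    \<comment> \<open>The product is \<open>3/16\<close>, just below the \<open>1/4\<close> that the
      strip allows.\<close>
    also have "\<dots> \<le> (2 * T) * (3 / 2 * (1 / (16 * T)))"
      using norm_exp_bounds(2)[OF half] d le T by (intro mult_mono) auto
    also have "\<dots> \<le> 1/4" using T by (simp add: field_simps)
    finally have close: "norm (exp w - of_real (exp u)) \<le> 1/4" .
    show "Re (exp w) > 1/2"
      using abs_Re_le_cmod[of "exp w - of_real (exp u)"] close ge T by (simp del: Re_exp)
    show "\<bar>Im (exp w)\<bar> \<le> 1/4"
      using abs_Im_le_cmod[of "exp w - of_real (exp u)"] close by (simp del: Im_exp)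
    show "norm (exp w) \<le> 2 * T + 1/4"
      using norm_triangle_ineq2[of "exp w" "of_real (exp u)"] close le by (simp del: norm_exp_eq_Re)
    have "ln T \<ge> ln 2" using T by simp
    moreover have "ln 2 > (1/2 :: real)" using ln2_ge_two_thirds by simp
    ultimately show "Re w \<ge> 0"
      using u abs_Re_le_cmod[of "w - of_real u"] half by auto
  qed
  define C' where "C' = (C * 4 ^ n)\<^sup>2"
  have bound: "norm (f w) \<le> C' * T ^ (2 * n)"
    if T: "T \<ge> 2" and u: "u \<in> {ln T..ln (2 * T)}" and w: "w \<in> ball (of_real u) (1 / (16 * T))" for T u :: real and w
  proof -
    note near = exp_near[OF T u w]
    have "norm (Ec (exp w)) \<le> C * (1 + norm (exp w)) ^ n" by (intro Ec(4) near)
    also have "\<dots> \<le> C * (4 * T) ^ n"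
      using near(3) T Ec(3) by (intro mult_left_mono power_mono) auto
    finally have 1: "norm (Ec (exp w)) \<le> C * 4 ^ n * T ^ n" by (simp add: power_mult_distrib)
    have "norm (f w) = norm (Ec (exp w)) ^ 2 * exp (- (\<sigma> * Re w))"
      by (simp add: f_def norm_mult norm_power)
    also have "\<dots> \<le> (C * 4 ^ n * T ^ n) ^ 2 * 1"
      using 1 \<sigma> near(4) by (intro mult_mono power_mono) auto
    also have "\<dots> = C' * T ^ (2 * n)" by (simp add: C'_def power_mult_distrib power_mult[symmetric] mult.commute)
    finally show ?thesis .
  qed
  show ?thesis
  proof
    show "C' \<ge> 0" by (simp add: C'_def)
    fix T u :: real assume T: "T \<ge> 2" and u: "u \<in> {ln T..ln (2 * T)}"
    have u0: "u > 1/2"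
    proof -
      have "ln T \<ge> ln 2" using T by simp
      moreover have "ln 2 > (1/2 :: real)" using ln2_ge_two_thirds by simp
      ultimately show ?thesis using u by auto
    qed
    show "\<bar>E2_weight P \<sigma> u\<bar> \<le> C' * T ^ (2 * n)"
      using bound[OF T u, of "of_real u"] f_real[of u] u0 T by simp
    fix m :: nat and h :: real assume m: "m > 0" and h: "real m * \<bar>h\<bar> < 1 / (32 * T)"
    have "norm (fdiff m f (of_real h) (of_real u)) \<le> fact m * (C' * T ^ (2 * n) + 1) * (4 * norm (complex_of_real h) / (1 / (16 * T))) ^ m"
    proof (rule fdiff_cauchy)
      have "(\<lambda>w. Ec (exp w)) holomorphic_on ball (of_real u) (1 / (16 * T))"
        using holomorphic_on_compose_gen[of exp "ball (of_real u) (1 / (16 * T))" Ec "{z. Re z > 0}"] Ec(1) exp_near(1)[OF T u]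
        by (force simp: o_def intro: holomorphic_intros)
      thus "f holomorphic_on ball (of_real u) (1 / (16 * T))"
        unfolding f_def by (intro holomorphic_intros)
      show "norm (f z) \<le> C' * T ^ (2 * n)" if "z \<in> ball (of_real u) (1 / (16 * T))" for z
        by (rule bound[OF T u that])
    qed (use T m h in auto)
    \<comment> \<open>The formula for \<open>f\<close> gives the values of \<open>E2_weight\<close>
      only at nonnegative reals; \<open>u > 1/2\<close> and the short step keep every
      \<open>u + j * h\<close> there.\<close>
    moreover have "fdiff m f (of_real h) (of_real u) = of_real (fdiff m (E2_weight P \<sigma>) h u)"
    proof -
      have "f (of_real u + of_nat j * of_real h) = of_real (E2_weight P \<sigma> (u + of_nat j * h))" if j: "j \<le> m" for j
      proof -
        have "\<bar>real j * h\<bar> \<le> real m * \<bar>h\<bar>" using j by (simp add: abs_mult mult_right_mono)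
        also have "\<dots> < 1 / (32 * T)" by (rule h)
        also have "\<dots> \<le> 1/2" using T by (simp add: field_simps)
        finally have "u + real j * h \<ge> 0" using u0 by linarith
        from f_real[OF this] show ?thesis by simp
      qed
      thus ?thesis unfolding fdiff_def of_real_sum by (intro sum.cong) auto
    qed
    ultimately show "\<bar>fdiff m (E2_weight P \<sigma>) h u\<bar> \<le> fact m * (C' * T ^ (2 * n) + 1) * (64 * T * \<bar>h\<bar>) ^ m"
      by (simp add: mult_ac)
  qed
qed

text \<open>\<open>G u\<close> is the remainder of \<open>gauss_remainder\<close> minus
  \<open>m\<close> signed Gaussian averages. The remainder is bounded pointwise, the averages in
  mean square by \<open>gauss_smoothing_L2\<close>, and squaring a sum of \<open>m + 1\<close> terms
  costs the factor \<open>m + 1\<close>. The constant \<open>A\<close> is independent of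
  \<open>T\<close>, \<open>X\<close> and \<open>Y\<close>.\<close>

lemma local_L2_bound:
  assumes G: "integrable lborel G" and Gint: "integrable lborel (\<lambda>u. indicator {a..b} u * (G u)\<^sup>2)"
    and m: "m > 0" and T: "T > 0" and Y: "Y \<ge> 1" and X: "X > 0" and M: "M \<ge> 0" and b: "a \<le> b" "b \<le> a + 1"
    and GM: "\<And>u. u \<in> {a..b} \<Longrightarrow> \<bar>G u\<bar> \<le> M"
    and fd: "\<And>u h. u \<in> {a..b} \<Longrightarrow> real m * \<bar>h\<bar> < 1 / (32 * T) \<Longrightarrow>
           \<bar>fdiff m G h u\<bar> \<le> fact m * (M + 1) * (64 * T * \<bar>h\<bar>) ^ m"
  defines "L \<equiv> (\<integral>x. \<bar>G x\<bar> \<partial>lborel)"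
  defines "A \<equiv> (fact m * 64 ^ m + (64 * real m) ^ m) * gauss_moment m + 4 ^ m * fact m * (64 * real m) ^ m * L"
  shows "(\<integral>u. indicator {a..b} u * (G u)\<^sup>2 \<partial>lborel) \<le> (real m + 1) * (((T / Y) ^ m * (M + 1) * Y * A)\<^sup>2 +
     real m * 4 ^ m * (sqrt (2 * pi) / std_normal_density 1 *
       ((\<integral>t. indicator {-X..X} t * (norm (fourier G t))\<^sup>2 \<partial>lborel) + L\<^sup>2 * gauss_moment m * Y * (Y / X) ^ m)))"
proof -
  define S where "S = (\<lambda>j u. \<integral>v. std_normal_density v * G (u + (real j / Y) * v) \<partial>lborel)"
  define R where "R = (T / Y) ^ m * (M + 1) * Y * A"
  define Q where "Q = sqrt (2 * pi) / std_normal_density 1 *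
       ((\<integral>t. indicator {-X..X} t * (norm (fourier G t))\<^sup>2 \<partial>lborel) + L\<^sup>2 * gauss_moment m * Y * (Y / X) ^ m)"
  have L0: "L \<ge> 0" by (simp add: L_def)
  have \<mu>0: "gauss_moment m \<ge> 0" by (rule gauss_moment_nonneg)
  have Y0: "Y > 0" using Y by simp
  \<comment> \<open>Chosen so that \<open>m * \<bar>v / Y\<bar> \<le> 1 / (64 * T)\<close>, within
    the range of \<open>fd\<close>. Then \<open>1 / \<delta> ^ m\<close> is a constant times
    \<open>(T / Y) ^ m\<close>, so both parts of the remainder have the same gain.\<close>
  define \<delta> where "\<delta> = Y / (64 * T * real m)"
  have \<delta>: "\<delta> > 0" using Y0 T m by (simp add: \<delta>_def)
  have inv_\<delta>: "1 / \<delta> ^ m = (64 * real m) ^ m * (T / Y) ^ m"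
    using T Y0 m by (simp add: \<delta>_def power_mult_distrib power_divide field_simps)
  have rem: "\<bar>G u + (\<Sum>j=1..m. (-1) ^ j * of_nat (m choose j) * S j u)\<bar> \<le> R" if u: "u \<in> {a..b}" for u
  proof -
    define B where "B = fact m * (M + 1) * (64 * T / Y) ^ m"
    have "\<bar>G u + (\<Sum>j=1..m. (-1) ^ j * of_nat (m choose j) * S j u)\<bar>
        \<le> (B + \<bar>G u\<bar> / \<delta> ^ m) * gauss_moment m + 2 ^ m * (2 ^ m * fact m / \<delta> ^ m) * Y * L"
      unfolding S_def L_def
    proof (rule gauss_remainder[OF G Y0 \<delta>])
      show "B \<ge> 0" using M T Y0 by (simp add: B_def)
      fix v :: real assume v: "\<bar>v\<bar> \<le> \<delta>"
      have "real m * \<bar>v / Y\<bar> \<le> real m * (\<delta> / Y)"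
        using v Y0 by (intro mult_left_mono) (auto simp: abs_mult divide_right_mono)
      also have "\<dots> < 1 / (32 * T)" using T Y0 m by (simp add: \<delta>_def field_simps)
      finally have "\<bar>fdiff m G (v / Y) u\<bar> \<le> fact m * (M + 1) * (64 * T * \<bar>v / Y\<bar>) ^ m" by (rule fd[OF u])
      also have "\<dots> = B * \<bar>v\<bar> ^ m"
        using Y0 by (simp add: B_def power_mult_distrib power_divide)
      finally show "\<bar>fdiff m G (v / Y) u\<bar> \<le> B * \<bar>v\<bar> ^ m" .
    qed
    also have "\<dots> = (T / Y) ^ m * ((fact m * (M + 1) * 64 ^ m + \<bar>G u\<bar> * (64 * real m) ^ m) * gauss_moment m
        + 4 ^ m * fact m * (64 * real m) ^ m * Y * L)"
    proof -
      have "\<bar>G u\<bar> / \<delta> ^ m = \<bar>G u\<bar> * (1 / \<delta> ^ m)" "2 ^ m * fact m / \<delta> ^ m = 2 ^ m * fact m * (1 / \<delta> ^ m)" by auto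
      moreover have "(4::real) ^ m = 2 ^ m * 2 ^ m" by (simp flip: power_mult_distrib)
      moreover have "(64 * T / Y) ^ m = 64 ^ m * (T / Y) ^ m" by (simp add: power_mult_distrib power_divide)
      ultimately show ?thesis unfolding B_def inv_\<delta> by (simp add: algebra_simps)
    qed
    \<comment> \<open>The bounds \<open>Y \<ge> 1\<close> and \<open>M + 1 \<ge> 1\<close> merge the
      two contributions into a single product.\<close>
    also have "\<dots> \<le> (T / Y) ^ m * ((M + 1) * Y * A)"
    proof (rule mult_left_mono)
      have "(fact m * (M + 1) * 64 ^ m + \<bar>G u\<bar> * (64 * real m) ^ m) * gauss_moment m
          \<le> (fact m * (M + 1) * 64 ^ m + (M + 1) * (64 * real m) ^ m) * gauss_moment m"
        using GM[OF u] \<mu>0 by (intro mult_right_mono add_left_mono) auto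
      also have "\<dots> = (M + 1) * 1 * ((fact m * 64 ^ m + (64 * real m) ^ m) * gauss_moment m)"
        by (simp add: algebra_simps)
      also have "\<dots> \<le> (M + 1) * Y * ((fact m * 64 ^ m + (64 * real m) ^ m) * gauss_moment m)"
        using M Y \<mu>0 by (intro mult_right_mono mult_left_mono) auto
      finally have 1: "(fact m * (M + 1) * 64 ^ m + \<bar>G u\<bar> * (64 * real m) ^ m) * gauss_moment m \<le> \<dots>" .
      have "4 ^ m * fact m * (64 * real m) ^ m * Y * L = 1 * (Y * (4 ^ m * fact m * (64 * real m) ^ m * L))" by simp
      also have "\<dots> \<le> (M + 1) * (Y * (4 ^ m * fact m * (64 * real m) ^ m * L))"
        using M Y0 L0 by (intro mult_right_mono mult_nonneg_nonneg) auto
      finally have 2: "4 ^ m * fact m * (64 * real m) ^ m * Y * L \<le> \<dots>" .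
      show "(fact m * (M + 1) * 64 ^ m + \<bar>G u\<bar> * (64 * real m) ^ m) * gauss_moment m
        + 4 ^ m * fact m * (64 * real m) ^ m * Y * L \<le> (M + 1) * Y * A"
        using add_mono[OF 1 2] unfolding A_def by (simp only: distrib_left mult.assoc)
    qed (use T Y0 in auto)
    finally show ?thesis by (simp add: R_def mult.assoc)
  qed
  have S_int: "integrable lborel (\<lambda>u. indicator {a..a+1} u * (S j u)\<^sup>2)"
    and S_le: "(\<integral>u. indicator {a..a+1} u * (S j u)\<^sup>2 \<partial>lborel) \<le> Q" if j: "j \<in> {1..m}" for j
  proof -
    have bj: "real j / Y > 0" using j Y0 by auto
    show "integrable lborel (\<lambda>u. indicator {a..a+1} u * (S j u)\<^sup>2)"
      unfolding S_def by (rule gauss_smoothing_L2(1)[OF G bj X])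
    have "(\<integral>u. indicator {a..a+1} u * (S j u)\<^sup>2 \<partial>lborel) \<le> sqrt (2 * pi) / std_normal_density 1 *
       ((\<integral>t. indicator {-X..X} t * (norm (fourier G t))\<^sup>2 \<partial>lborel) +
         L\<^sup>2 * gauss_moment m / (real j / Y * (real j / Y * X) ^ m))"
      unfolding S_def L_def by (rule gauss_smoothing_L2(2)[OF G bj X])
    also have "\<dots> \<le> Q"
      unfolding Q_def
    proof (intro mult_left_mono add_left_mono)
      \<comment> \<open>The averages have widths \<open>j / Y\<close>; the narrowest,
        \<open>j = 1\<close>, has the worst tail in frequency.\<close>
      have j1: "1 / Y \<le> real j / Y" using j Y0 by (auto intro!: divide_right_mono)
      have "L\<^sup>2 * gauss_moment m / (real j / Y * (real j / Y * X) ^ m) \<le> L\<^sup>2 * gauss_moment m / (1 / Y * (1 / Y * X) ^ m)"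
        using j1 Y0 X \<mu>0 bj by (intro divide_left_mono mult_mono power_mono mult_right_mono mult_pos_pos zero_less_power) auto
      also have "\<dots> = L\<^sup>2 * gauss_moment m * Y * (Y / X) ^ m"
        using Y0 X by (simp add: power_mult_distrib power_divide field_simps)
      finally show "L\<^sup>2 * gauss_moment m / (real j / Y * (real j / Y * X) ^ m) \<le> L\<^sup>2 * gauss_moment m * Y * (Y / X) ^ m" .
    qed auto
    finally show "(\<integral>u. indicator {a..a+1} u * (S j u)\<^sup>2 \<partial>lborel) \<le> Q" .
  qed
  define Z where "Z = (\<lambda>u. (real m + 1) * (indicator {a..a+1} u * R\<^sup>2 + (\<Sum>j=1..m. 4 ^ m * (indicator {a..a+1} u * (S j u)\<^sup>2))))"
  have ind_int: "integrable lborel (\<lambda>u. indicator {a..a+1} u * R\<^sup>2)"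
    by (intro integrable_mult_left) (auto simp: integrable_indicator_iff)
  have sum_int: "integrable lborel (\<lambda>u. \<Sum>j=1..m. 4 ^ m * (indicator {a..a+1} u * (S j u)\<^sup>2))"
    by (intro Bochner_Integration.integrable_sum integrable_mult_right S_int)
  have Z_int: "integrable lborel Z" unfolding Z_def
    by (intro integrable_mult_right Bochner_Integration.integrable_add ind_int sum_int)
  have GZ: "indicator {a..b} u * (G u)\<^sup>2 \<le> Z u" for u
  proof (cases "u \<in> {a..b}")
    case True
    \<comment> \<open>Term 0 is the remainder and the others are the averages with opposite sign, so
      the total is \<open>G u\<close>.\<close>
    define y where "y = (\<lambda>j. if j = 0 then G u + (\<Sum>j=1..m. (-1) ^ j * of_nat (m choose j) * S j u)
        else - ((-1) ^ j * of_nat (m choose j) * S j u))"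
    have split: "{..m} = insert 0 {1..m}" by auto
    have "(\<Sum>j\<le>m. y j) = G u"
      unfolding split by (subst sum.insert) (auto simp: y_def sum_negf)
    hence "(G u)\<^sup>2 \<le> (\<Sum>j\<le>m. (y j)\<^sup>2) * (real m + 1)"
      using sum_squared_le_sum_of_squares[of y "{..m}"] by (simp add: add.commute)
    also have "(\<Sum>j\<le>m. (y j)\<^sup>2) = (y 0)\<^sup>2 + (\<Sum>j=1..m. (y j)\<^sup>2)"
      unfolding split by (subst sum.insert) auto
    also have "\<dots> \<le> R\<^sup>2 + (\<Sum>j=1..m. 4 ^ m * (S j u)\<^sup>2)"
    proof (intro add_mono sum_mono)
      have "\<bar>y 0\<bar> \<le> \<bar>R\<bar>" using rem[OF True] by (simp add: y_def)
      thus "(y 0)\<^sup>2 \<le> R\<^sup>2" by (simp add: abs_le_square_iff)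
      fix j assume j: "j \<in> {1..m}"
      have "(m choose j) \<le> 2 ^ m" by (rule binomial_le_pow2)
      hence "real (m choose j) \<le> 2 ^ m" by (metis of_nat_le_iff of_nat_numeral of_nat_power)
      hence "(real (m choose j))\<^sup>2 \<le> (2 ^ m)\<^sup>2" by (intro power_mono) auto
      also have "((2::real) ^ m)\<^sup>2 = 4 ^ m" by (simp add: power2_eq_square flip: power_mult_distrib)
      finally have "(real (m choose j))\<^sup>2 * (S j u)\<^sup>2 \<le> 4 ^ m * (S j u)\<^sup>2" by (intro mult_right_mono) auto
      moreover have "(y j)\<^sup>2 = (real (m choose j))\<^sup>2 * (S j u)\<^sup>2"
        using j by (simp add: y_def power_mult_distrib power_even_eq[symmetric] flip: power_mult)
      ultimately show "(y j)\<^sup>2 \<le> 4 ^ m * (S j u)\<^sup>2" by simp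
    qed
    finally show ?thesis using True b by (simp add: Z_def mult.commute)
  next
    case False
    thus ?thesis by (auto simp: Z_def intro!: mult_nonneg_nonneg add_nonneg_nonneg sum_nonneg)
  qed
  have "(\<integral>u. indicator {a..b} u * (G u)\<^sup>2 \<partial>lborel) \<le> (\<integral>u. Z u \<partial>lborel)"
    by (intro integral_mono Gint Z_int GZ)
  also have "\<dots> = (real m + 1) * (R\<^sup>2 + (\<Sum>j=1..m. 4 ^ m * (\<integral>u. indicator {a..a+1} u * (S j u)\<^sup>2 \<partial>lborel)))"
    unfolding Z_def using S_int
    by (subst integral_mult_right_zero, subst Bochner_Integration.integral_add[OF ind_int sum_int],
        subst Bochner_Integration.integral_sum) auto
  also have "\<dots> \<le> (real m + 1) * (R\<^sup>2 + (\<Sum>j=1..m. 4 ^ m * Q))"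
    by (intro mult_left_mono add_left_mono sum_mono S_le) auto
  also have "(\<Sum>j=1..m. 4 ^ m * Q) = real m * 4 ^ m * Q" by simp
  finally show ?thesis unfolding R_def Q_def .
qed

text \<open>The integration by parts identity is solved for the Laplace transform. The resulting
  quotient is holomorphic on \<open>Re s > 1\<close>, where \<open>s \<noteq> 0\<close>, and equals
  the transform wherever \<open>K_integral\<close> represents \<open>K\<close> and the crude growth
  bounds apply; \<open>landau_laplace\<close> covers the rest.\<close>

lemma laplace_E2_log_square:
  assumes K: "K holomorphic_on {s. Re s > 1}" "\<And>s. Re s > 5/3 \<Longrightarrow> K s = K_integral P s"
    and s: "Re s > 1"
  shows "integrable lborel (\<lambda>u. of_real (E2_log_square P u) * exp (- (s * of_real u)))"
    and "(\<integral>u. of_real (E2_log_square P u) * exp (- (s * of_real u)) \<partial>lborel) = (2 * K s + of_real ((E2 P 1)\<^sup>2)) / s"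
proof -
  obtain c0 where c0: "\<And>s. Re s > c0 \<Longrightarrow>
     integrable lborel (\<lambda>u. of_real (E2_log_square P u) * exp (- (s * of_real u)))"
     "\<And>s. Re s > c0 \<Longrightarrow> K_integral P s = - of_real ((E2 P 1)\<^sup>2) / 2 +
       s / 2 * (\<integral>u. of_real (E2_log_square P u) * exp (- (s * of_real u)) \<partial>lborel)"
    using K_integral_eq_laplace[of P] by blast
  define N where "N = (\<lambda>s. (2 * K s + of_real ((E2 P 1)\<^sup>2)) / s)"
  have nz: "s \<noteq> 0" if "Re s > 1" for s using that by auto
  have hol: "N holomorphic_on {s. Re s > 1}"
    unfolding N_def by (intro holomorphic_intros K(1)) (use nz in auto)
  have eq: "N s = (\<integral>u. of_real (E2_log_square P u) * exp (- (s * of_real u)) \<partial>lborel)"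
    if "Re s > max c0 (5/3)" for s
    using c0(2)[of s] K(2)[of s] nz[of s] that by (simp add: N_def field_simps)
  have supp: "E2_log_square P u = 0" if "u < 0" for u using that by (simp add: E2_log_square_def)
  have nonneg: "E2_log_square P u \<ge> 0" for u by (simp add: E2_log_square_def)
  have int: "integrable lborel (\<lambda>u. of_real (E2_log_square P u) * exp (- (s * of_real u)))"
    if "Re s > max c0 (5/3)" for s using that by (intro c0) auto
  note landau = landau_laplace[OF E2_log_square_measurable supp nonneg hol int eq s]
  show "integrable lborel (\<lambda>u. of_real (E2_log_square P u) * exp (- (s * of_real u)))" by (rule landau(1))
  show "(\<integral>u. of_real (E2_log_square P u) * exp (- (s * of_real u)) \<partial>lborel) = (2 * K s + of_real ((E2 P 1)\<^sup>2)) / s"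
  proof -
    have "N s = (\<integral>u. of_real (E2_log_square P u) * exp (- (s * of_real u)) \<partial>lborel)" by (rule landau(2))
    thus ?thesis by (simp add: N_def)
  qed
qed

lemma
  assumes K: "K holomorphic_on {s. Re s > 1}" "\<And>s. Re s > 5/3 \<Longrightarrow> K s = K_integral P s"
    and \<sigma>: "\<sigma> > 1"
  shows integrable_E2_weight: "integrable lborel (E2_weight P \<sigma>)"
    and fourier_E2_weight: "fourier (E2_weight P \<sigma>) t = (2 * K (Complex \<sigma> t) + of_real ((E2 P 1)\<^sup>2)) / Complex \<sigma> t"
proof -
  have eq: "of_real (E2_weight P \<sigma> u) * iexp (- t * u) = of_real (E2_log_square P u) * exp (- (Complex \<sigma> t * of_real u))" for u t
  proof -
    have "of_real (exp (- (\<sigma> * u))) * iexp (- t * u) = exp (- (Complex \<sigma> t * of_real u))"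
      by (simp add: exp_of_real[symmetric] exp_add[symmetric] Complex_eq algebra_simps)
    thus ?thesis by (simp add: E2_weight_def mult.assoc)
  qed
  \<comment> \<open>At \<open>t = 0\<close> the exponential is real, which gives integrability of
    \<open>E2_weight\<close> itself.\<close>
  have "integrable lborel (\<lambda>u. of_real (E2_log_square P u) * exp (- (Complex \<sigma> 0 * of_real u)))"
    by (rule laplace_E2_log_square(1)[OF K]) (use \<sigma> in auto)
  hence "integrable lborel (\<lambda>u. complex_of_real (E2_weight P \<sigma> u))"
    unfolding eq[symmetric] by simp
  thus "integrable lborel (E2_weight P \<sigma>)" by (simp only: complex_of_real_integrable_eq)
  show "fourier (E2_weight P \<sigma>) t = (2 * K (Complex \<sigma> t) + of_real ((E2 P 1)\<^sup>2)) / Complex \<sigma> t"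
    unfolding fourier_def eq by (rule laplace_E2_log_square(2)[OF K]) (use \<sigma> in auto)
qed

text \<open>For real \<open>G\<close> the transform at \<open>-t\<close> is conjugate to that at
  \<open>t\<close>; the mean square of \<open>K\<close> in the final bound runs over
  \<open>t \<ge> 0\<close> only.\<close>

lemma fourier_L2_symmetric:
  assumes G: "integrable lborel G" and X: "X \<ge> 0"
  shows "(\<integral>t. indicator {-X..X} t * (norm (fourier G t))\<^sup>2 \<partial>lborel)
    \<le> 2 * (\<integral>t. indicator {0..X} t * (norm (fourier G t))\<^sup>2 \<partial>lborel)"
proof -
  have [measurable]: "G \<in> borel_measurable borel" using G by auto
  define L where "L = (\<integral>x. \<bar>G x\<bar> \<partial>lborel)"
  define f where "f = (\<lambda>t. (norm (fourier G t))\<^sup>2)"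
  have f_even: "f (-t) = f t" for t
  proof -
    have "fourier G (-t) = cnj (fourier G t)"
      unfolding fourier_def Bochner_Integration.integral_cnj[symmetric]
      by (intro Bochner_Integration.integral_cong) (auto simp: exp_cnj)
    thus ?thesis by (simp add: f_def)
  qed
  have int: "integrable lborel (\<lambda>t. indicator {c..d} t * f t)" for c d :: real
  proof (rule Bochner_Integration.integrable_bound)
    show "integrable lborel (\<lambda>t. indicator {c..d} t * L\<^sup>2)"
      by (intro integrable_mult_left) (auto simp: integrable_indicator_iff emeasure_lborel_Icc_eq)
    show "AE t in lborel. norm (indicator {c..d} t * f t) \<le> norm (indicator {c..d} t * L\<^sup>2)"
      using norm_fourier_le[of G] by (auto simp: indicator_def f_def L_def intro!: power_mono)
  qed (unfold f_def, measurable)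
  have refl_int: "integrable lborel (\<lambda>t. indicator {0..X} (0 + (-1) * t) * f (0 + (-1) * t))"
    by (rule lborel_integrable_real_affine[OF int]) auto
  have "(\<integral>t. indicator {0..X} t * f t \<partial>lborel) = \<bar>-1\<bar> *\<^sub>R (\<integral>t. indicator {0..X} (0 + (-1) * t) * f (0 + (-1) * t) \<partial>lborel)"
    by (rule lborel_integral_real_affine) auto
  hence refl: "(\<integral>t. indicator {0..X} (0 + (-1) * t) * f (0 + (-1) * t) \<partial>lborel) = (\<integral>t. indicator {0..X} t * f t \<partial>lborel)"
    by simp
  have "(\<integral>t. indicator {-X..X} t * f t \<partial>lborel) \<le>
      (\<integral>t. indicator {0..X} t * f t + indicator {0..X} (0 + (-1) * t) * f (0 + (-1) * t) \<partial>lborel)"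
  proof (intro integral_mono int Bochner_Integration.integrable_add refl_int)
    show "indicator {-X..X} t * f t \<le> indicator {0..X} t * f t + indicator {0..X} (0 + (-1) * t) * f (0 + (-1) * t)" for t
      using f_even[of t] by (auto simp: indicator_def f_def)
  qed
  also have "\<dots> = 2 * (\<integral>t. indicator {0..X} t * f t \<partial>lborel)"
    by (subst Bochner_Integration.integral_add[OF int refl_int]) (use refl in simp)
  finally show ?thesis by (simp add: f_def)
qed

text \<open>Since \<open>\<sigma> > 1\<close>, the squared modulus of
  \<open>Complex \<sigma> t\<close> is at least \<open>1 + t\<^sup>2\<close>, and
  \<open>(x + y)\<^sup>2 \<le> 2 * x\<^sup>2 + 2 * y\<^sup>2\<close> separates \<open>K\<close> from
  the constant \<open>(E2 P 1)\<^sup>2\<close>, whose share is bounded by means of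
  \<open>arctan\<close> and absorbed by the 1 in front of the integral. Folding in negative
  \<open>t\<close> doubles 8 to 16.\<close>

lemma fourier_E2_weight_L2:
  assumes K: "K holomorphic_on {s. Re s > 1}" "\<And>s. Re s > 5/3 \<Longrightarrow> K s = K_integral P s"
    and \<sigma>: "\<sigma> > 1" and X: "X \<ge> 0"
  shows "(\<integral>t. indicator {-X..X} t * (norm (fourier (E2_weight P \<sigma>) t))\<^sup>2 \<partial>lborel)
    \<le> (16 + 8 * E2 P 1 ^ 4) * (1 + integral {0..X} (\<lambda>t. (norm (K (Complex \<sigma> t)))\<^sup>2 / (1 + t\<^sup>2)))"
    and "integral {0..X} (\<lambda>t. (norm (K (Complex \<sigma> t)))\<^sup>2 / (1 + t\<^sup>2)) \<ge> 0"
proof -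
  define E where "E = E2 P 1 ^ 4"
  have E0: "E \<ge> 0" by (simp add: E_def)
  define k where "k = (\<lambda>t. (norm (K (Complex \<sigma> t)))\<^sup>2 / (1 + t\<^sup>2))"
  have pos: "1 + t\<^sup>2 > (0::real)" for t by (simp add: add_pos_nonneg)
  have cK: "continuous_on A (\<lambda>t. K (Complex \<sigma> t))" for A
    by (rule continuous_on_compose2[OF holomorphic_on_imp_continuous_on[OF K(1)]])
       (use \<sigma> in \<open>auto intro!: continuous_intros simp: Complex_eq\<close>)
  have ck: "continuous_on A k" for A
    unfolding k_def using pos by (intro continuous_intros cK) (metis less_irrefl)
  have c1: "continuous_on A (\<lambda>t::real. 1 / (1 + t\<^sup>2))" for A
    using pos by (intro continuous_intros) (metis less_irrefl)
  show kint: "integral {0..X} (\<lambda>t. (norm (K (Complex \<sigma> t)))\<^sup>2 / (1 + t\<^sup>2)) \<ge> 0"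
    by (rule Henstock_Kurzweil_Integration.integral_nonneg)
       (use ck in \<open>auto intro!: integrable_continuous_real simp: k_def\<close>)
  define Z where "Z = (\<lambda>t. 8 * k t + 2 * E * (1 / (1 + t\<^sup>2)))"
  have cZ: "continuous_on A Z" for A unfolding Z_def by (intro continuous_intros ck c1)
  have le: "(norm (fourier (E2_weight P \<sigma>) t))\<^sup>2 \<le> Z t" for t
  proof -
    have "(norm (Complex \<sigma> t))\<^sup>2 = \<sigma>\<^sup>2 + t\<^sup>2" by (simp add: cmod_power2)
    moreover have "\<sigma>\<^sup>2 \<ge> 1" using \<sigma> by (simp add: one_le_power)
    ultimately have den: "(norm (Complex \<sigma> t))\<^sup>2 \<ge> 1 + t\<^sup>2" by simp
    have "(norm (fourier (E2_weight P \<sigma>) t))\<^sup>2 = (norm (2 * K (Complex \<sigma> t) + of_real ((E2 P 1)\<^sup>2)))\<^sup>2 / (norm (Complex \<sigma> t))\<^sup>2"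
    proof -
      have "fourier (E2_weight P \<sigma>) t = (2 * K (Complex \<sigma> t) + of_real ((E2 P 1)\<^sup>2)) / Complex \<sigma> t"
        by (rule fourier_E2_weight[OF K \<sigma>])
      thus ?thesis by (simp only: norm_divide power_divide)
    qed
    also have "\<dots> \<le> (norm (2 * K (Complex \<sigma> t) + of_real ((E2 P 1)\<^sup>2)))\<^sup>2 / (1 + t\<^sup>2)"
      using den pos[of t] by (intro divide_left_mono mult_pos_pos) (linarith | simp)+
    also have "\<dots> \<le> (8 * (norm (K (Complex \<sigma> t)))\<^sup>2 + 2 * E) / (1 + t\<^sup>2)"
    proof (rule divide_right_mono)
      have "(norm (2 * K (Complex \<sigma> t) + of_real ((E2 P 1)\<^sup>2)))\<^sup>2 \<le> (2 * norm (K (Complex \<sigma> t)) + (E2 P 1)\<^sup>2)\<^sup>2"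
        using norm_triangle_ineq[of "2 * K (Complex \<sigma> t)" "of_real ((E2 P 1)\<^sup>2)"]
        by (intro power_mono) (auto simp: norm_mult norm_power)
      also have "\<dots> \<le> 2 * (2 * norm (K (Complex \<sigma> t)))\<^sup>2 + 2 * ((E2 P 1)\<^sup>2)\<^sup>2"
      proof -
        have "(x + y)\<^sup>2 \<le> 2 * x\<^sup>2 + 2 * y\<^sup>2" for x y :: real
          using sum_squares_bound[of x y] by (simp add: power2_sum)
        thus ?thesis by blast
      qed
      also have "\<dots> = 8 * (norm (K (Complex \<sigma> t)))\<^sup>2 + 2 * E"
        by (simp add: E_def power_mult_distrib flip: power_mult)
      finally show "(norm (2 * K (Complex \<sigma> t) + of_real ((E2 P 1)\<^sup>2)))\<^sup>2 \<le> 8 * (norm (K (Complex \<sigma> t)))\<^sup>2 + 2 * E" .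
    qed (use pos[of t] in linarith)
    also have "\<dots> = Z t" by (simp add: Z_def k_def add_divide_distrib)
    finally show ?thesis .
  qed
  have G: "integrable lborel (E2_weight P \<sigma>)" by (rule integrable_E2_weight[OF K \<sigma>])
  have setZ: "set_integrable lborel {0..X} Z" by (rule borel_integrable_atLeastAtMost'[OF cZ])
  have Zint: "integrable lborel (\<lambda>t. indicator {0..X} t * Z t)"
    using setZ by (simp add: set_integrable_def)
  have [measurable]: "E2_weight P \<sigma> \<in> borel_measurable borel" using G by auto
  have "(\<integral>t. indicator {-X..X} t * (norm (fourier (E2_weight P \<sigma>) t))\<^sup>2 \<partial>lborel)
    \<le> 2 * (\<integral>t. indicator {0..X} t * (norm (fourier (E2_weight P \<sigma>) t))\<^sup>2 \<partial>lborel)"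
    by (rule fourier_L2_symmetric[OF G X])
  also have "(\<integral>t. indicator {0..X} t * (norm (fourier (E2_weight P \<sigma>) t))\<^sup>2 \<partial>lborel) \<le> (\<integral>t. indicator {0..X} t * Z t \<partial>lborel)"
  proof (intro integral_mono Zint)
    show "integrable lborel (\<lambda>t. indicator {0..X} t * (norm (fourier (E2_weight P \<sigma>) t))\<^sup>2)"
      by (rule Bochner_Integration.integrable_bound[OF Zint])
         (use le order.trans[OF le abs_ge_self] in \<open>auto simp: indicator_def\<close>)
  qed (auto simp: indicator_def le)
  also have "(\<integral>t. indicator {0..X} t * Z t \<partial>lborel) = integral {0..X} Z"
    using set_borel_integral_eq_integral(2)[OF setZ] by (simp add: set_lebesgue_integral_def)
  also have "integral {0..X} Z = 8 * integral {0..X} k + 2 * E * arctan X"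
  proof -
    have "((\<lambda>t. 1 / (1 + t\<^sup>2)) has_integral (arctan X - arctan 0)) {0..X}"
      by (rule fundamental_theorem_of_calculus[OF X])
         (auto intro!: derivative_eq_intros simp: inverse_eq_divide simp flip: has_real_derivative_iff_has_vector_derivative)
    hence "(Z has_integral (8 * integral {0..X} k + 2 * E * (arctan X - arctan 0))) {0..X}"
      unfolding Z_def
      by (intro has_integral_add has_integral_mult_right integrable_integral integrable_continuous_real ck) auto
    thus ?thesis by (simp add: integral_unique)
  qed
  also have "2 * (8 * integral {0..X} k + 2 * E * arctan X) \<le> (16 + 8 * E) * (1 + integral {0..X} k)"
  proof -
    have "arctan X \<le> 2" using arctan_ubound[of X] pi_less_4 by simp
    hence "2 * E * arctan X \<le> 2 * E * 2" using E0 by (intro mult_left_mono) auto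
    moreover have "E * integral {0..X} k \<ge> 0" using E0 kint by (simp add: k_def)
    ultimately show ?thesis by (simp add: algebra_simps)
  qed
  finally show "(\<integral>t. indicator {-X..X} t * (norm (fourier (E2_weight P \<sigma>) t))\<^sup>2 \<partial>lborel)
    \<le> (16 + 8 * E2 P 1 ^ 4) * (1 + integral {0..X} (\<lambda>t. (norm (K (Complex \<sigma> t)))\<^sup>2 / (1 + t\<^sup>2)))"
    by (simp add: E_def k_def)
qed

text \<open>With \<open>t = exp u\<close> the integrand becomes
  \<open>exp ((2 * \<sigma> + 1) * u)\<close> times the square of \<open>E2_weight\<close>, and
  \<open>exp u \<le> 2 * T\<close> on the range.\<close>

lemma
  assumes T: "T \<ge> 1" and \<sigma>: "\<sigma> \<ge> 0"
  shows integrable_E2_weight_square: "integrable lborel (\<lambda>u. indicator {ln T..ln (2 * T)} u * (E2_weight P \<sigma> u)\<^sup>2)"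
    and E2_fourth_moment_le: "integral {T..2*T} (\<lambda>t. E2 P t ^ 4) \<le>
      (2 * T) powr (2 * \<sigma> + 1) * (\<integral>u. indicator {ln T..ln (2 * T)} u * (E2_weight P \<sigma> u)\<^sup>2 \<partial>lborel)"
proof -
  define w where "w = (\<lambda>u. (E2 P (exp u))\<^sup>2 * exp (- (\<sigma> * u)))"
  have cw: "continuous_on A w" for A unfolding w_def by (intro continuous_intros continuous_on_E2_exp)
  have w_eq: "E2_weight P \<sigma> u = w u" if "u \<ge> ln T" for u
  proof -
    have "ln T \<ge> 0" using T by simp
    hence "u \<ge> 0" using that by linarith
    thus ?thesis by (simp add: E2_weight_def E2_log_square_def w_def)
  qed
  have ind: "indicator {ln T..ln (2 * T)} u * (E2_weight P \<sigma> u)\<^sup>2 = indicator {ln T..ln (2 * T)} u *\<^sub>R (w u)\<^sup>2" for u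
    using w_eq[of u] by (auto simp: indicator_def)
  have set: "set_integrable lborel {ln T..ln (2 * T)} (\<lambda>u. (w u)\<^sup>2)"
    by (intro borel_integrable_atLeastAtMost' continuous_intros cw)
  thus "integrable lborel (\<lambda>u. indicator {ln T..ln (2 * T)} u * (E2_weight P \<sigma> u)\<^sup>2)"
    unfolding ind by (simp add: set_integrable_def)
  have I: "(\<integral>u. indicator {ln T..ln (2 * T)} u * (E2_weight P \<sigma> u)\<^sup>2 \<partial>lborel) = integral {ln T..ln (2 * T)} (\<lambda>u. (w u)\<^sup>2)"
    unfolding ind using set_borel_integral_eq_integral(2)[OF set] by (simp add: set_lebesgue_integral_def)
  have "((\<lambda>u. exp u *\<^sub>R E2 P (exp u) ^ 4) has_integral integral {exp (ln T)..exp (ln (2 * T))} (\<lambda>t. E2 P t ^ 4)) {ln T..ln (2 * T)}"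
  proof (rule has_integral_substitution[where c = T and d = "2 * T"])
    show "exp ` {ln T..ln (2 * T)} \<subseteq> {T..2 * T}"
    proof (rule image_subsetI)
      fix u assume "u \<in> {ln T..ln (2 * T)}"
      hence "exp (ln T) \<le> exp u" "exp u \<le> exp (ln (2 * T))" by (auto simp del: exp_ln exp_ln_iff)
      thus "exp u \<in> {T..2 * T}" using T by simp
    qed
    show "continuous_on {T..2 * T} (\<lambda>t. E2 P t ^ 4)"
      using T by (intro continuous_intros continuous_on_subset[OF continuous_on_E2]) auto
  qed (use T in \<open>auto intro!: derivative_eq_intros\<close>)
  hence sub: "((\<lambda>u. exp u * E2 P (exp u) ^ 4) has_integral integral {T..2 * T} (\<lambda>t. E2 P t ^ 4)) {ln T..ln (2 * T)}"
    using T by simp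
  have "integral {T..2*T} (\<lambda>t. E2 P t ^ 4) \<le> integral {ln T..ln (2 * T)} (\<lambda>u. (2 * T) powr (2 * \<sigma> + 1) * (w u)\<^sup>2)"
  proof (rule has_integral_le[OF sub])
    show "((\<lambda>u. (2 * T) powr (2 * \<sigma> + 1) * (w u)\<^sup>2) has_integral integral {ln T..ln (2 * T)} (\<lambda>u. (2 * T) powr (2 * \<sigma> + 1) * (w u)\<^sup>2)) {ln T..ln (2 * T)}"
      by (intro integrable_integral integrable_continuous_real continuous_intros cw)
    fix u assume u: "u \<in> {ln T..ln (2 * T)}"
    have "exp u * E2 P (exp u) ^ 4 = exp ((2 * \<sigma> + 1) * u) * (w u)\<^sup>2"
    proof -
      have "exp ((2 * \<sigma> + 1) * u) = exp u * (exp (\<sigma> * u))\<^sup>2"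
        by (simp add: algebra_simps flip: exp_add exp_double)
      moreover have "(w u)\<^sup>2 = E2 P (exp u) ^ 4 * (exp (- (\<sigma> * u)))\<^sup>2"
        by (simp add: w_def power_mult_distrib flip: power_mult)
      moreover have "(exp (\<sigma> * u))\<^sup>2 * (exp (- (\<sigma> * u)))\<^sup>2 = 1"
        by (simp flip: power_mult_distrib exp_add)
      ultimately show ?thesis by simp
    qed
    also have "\<dots> \<le> (2 * T) powr (2 * \<sigma> + 1) * (w u)\<^sup>2"
      using u T \<sigma> by (intro mult_right_mono) (auto simp: powr_def intro!: mult_left_mono)
    finally show "exp u * E2 P (exp u) ^ 4 \<le> (2 * T) powr (2 * \<sigma> + 1) * (w u)\<^sup>2" .
  qed
  thus "integral {T..2*T} (\<lambda>t. E2 P t ^ 4) \<le>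
      (2 * T) powr (2 * \<sigma> + 1) * (\<integral>u. indicator {ln T..ln (2 * T)} u * (E2_weight P \<sigma> u)\<^sup>2 \<partial>lborel)"
    unfolding I by simp
qed

section \<open>Choice of parameters and conclusion\<close>

theorem theorem3:
  fixes P :: "real poly" and K :: "complex \<Rightarrow> complex" and \<sigma> \<epsilon> :: real
  assumes "degree P = 4" and "lead_coeff P = 1 / (2 * pi\<^sup>2)"
    and "E2 P \<in> o[at_top](\<lambda>T. T)"
    and "K holomorphic_on {s. Re s > 1}"
    and "\<And>s. Re s > 5/3 \<Longrightarrow> K s = K_integral P s"
    and "\<sigma> > 1" and "\<epsilon> > 0"
  shows "(\<lambda>T. integral {T..2*T} (\<lambda>t. E2 P t ^ 4)) \<in>
           O[at_top](\<lambda>T. T powr (2*\<sigma> + 1) *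
             (1 + integral {0..T powr (1 + \<epsilon>)} (\<lambda>t. (norm (K (Complex \<sigma> t)))\<^sup>2 / (1 + t\<^sup>2))))"
proof -
  note K = assms(4,5) and \<sigma> = assms(6) and \<epsilon> = assms(7)
  let ?G = "E2_weight P \<sigma>"
  obtain C n where C: "C \<ge> 0"
    "\<And>T u. T \<ge> 2 \<Longrightarrow> u \<in> {ln T..ln (2 * T)} \<Longrightarrow> \<bar>?G u\<bar> \<le> C * T ^ n"
    "\<And>T u m h. T \<ge> 2 \<Longrightarrow> u \<in> {ln T..ln (2 * T)} \<Longrightarrow> m > 0 \<Longrightarrow> real m * \<bar>h\<bar> < 1 / (32 * T) \<Longrightarrow>
           \<bar>fdiff m ?G h u\<bar> \<le> fact m * (C * T ^ n + 1) * (64 * T * \<bar>h\<bar>) ^ m"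
    using \<sigma> by (rule E2_weight_fdiff_bound[of \<sigma> P, OF less_imp_le[OF less_trans[OF zero_less_one]]]) blast
  have G: "integrable lborel ?G" by (rule integrable_E2_weight[OF K \<sigma>])
  \<comment> \<open>Chosen so that \<open>(T / Y) ^ m = T powr (- (\<epsilon> / 2 * m))\<close>
    outweighs \<open>T ^ n * Y\<close>, that is
    \<open>\<epsilon> / 2 * m \<ge> n + 1 + \<epsilon> / 2\<close>; the final \<open>+ 1\<close>
    makes \<open>m > 0\<close> immediate.\<close>
  define m where "m = nat \<lceil>(2 * real n + 2 + \<epsilon>) / \<epsilon>\<rceil> + 1"
  have m0: "m > 0" by (simp add: m_def)
  have m: "real n + 1 + \<epsilon> / 2 \<le> \<epsilon> / 2 * real m"
  proof -
    have "(2 * real n + 2 + \<epsilon>) / \<epsilon> \<le> real m" unfolding m_def by linarith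
    thus ?thesis using \<epsilon> by (simp add: field_simps)
  qed
  define L where "L = (\<integral>x. \<bar>?G x\<bar> \<partial>lborel)"
  define A where "A = (fact m * 64 ^ m + (64 * real m) ^ m) * gauss_moment m + 4 ^ m * fact m * (64 * real m) ^ m * L"
  define c0 where "c0 = sqrt (2 * pi) / std_normal_density 1"
  define c1 where "c1 = 16 + 8 * E2 P 1 ^ 4"
  define J where "J = (\<lambda>T. integral {0..T powr (1 + \<epsilon>)} (\<lambda>t. (norm (K (Complex \<sigma> t)))\<^sup>2 / (1 + t\<^sup>2)))"
  define D where "D = (real m + 1) * (((C + 1) * A)\<^sup>2 + real m * 4 ^ m * (c0 * (c1 + L\<^sup>2 * gauss_moment m)))"
  have L0: "L \<ge> 0" by (simp add: L_def)
  have A0: "A \<ge> 0" using L0 gauss_moment_nonneg[of m] by (simp add: A_def)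
  have c0: "c0 \<ge> 0" by (simp add: c0_def)
  have main: "integral {T..2*T} (\<lambda>t. E2 P t ^ 4) \<le> 2 powr (2 * \<sigma> + 1) * D * (T powr (2 * \<sigma> + 1) * (1 + J T))"
    and J0: "J T \<ge> 0" if T: "T \<ge> 2" for T
  proof -
    \<comment> \<open>\<open>Y\<close> is midway between \<open>T\<close> and \<open>X\<close> on a
      logarithmic scale, so \<open>T / Y\<close> and \<open>Y / X\<close> both equal
      \<open>T powr (- (\<epsilon> / 2))\<close>.\<close>
    define Y where "Y = T powr (1 + \<epsilon> / 2)"
    define X where "X = T powr (1 + \<epsilon>)"
    have T0: "T > 0" and T1: "T \<ge> 1" using T by auto
    have Y1: "Y \<ge> 1" unfolding Y_def using T \<epsilon> by (intro ge_one_powr_ge_zero) auto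
    have X0: "X > 0" unfolding X_def using T by simp
    have J0: "J T \<ge> 0" unfolding J_def by (rule fourier_E2_weight_L2(2)[OF K \<sigma>]) auto
    thus "J T \<ge> 0" .
    have TY: "(T / Y) ^ m = T powr (- (\<epsilon> / 2 * real m))" and YX: "(Y / X) ^ m = T powr (- (\<epsilon> / 2 * real m))"
    proof -
      have "T / Y = T powr 1 / T powr (1 + \<epsilon> / 2)" using T0 by (simp add: Y_def)
      also have "\<dots> = T powr (- (\<epsilon> / 2))" unfolding powr_diff[symmetric] by simp
      finally show "(T / Y) ^ m = T powr (- (\<epsilon> / 2 * real m))"
        using T0 by (simp add: powr_power mult.commute)
      have "Y / X = T powr (- (\<epsilon> / 2))" unfolding X_def Y_def powr_diff[symmetric] by (simp add: field_simps)
      thus "(Y / X) ^ m = T powr (- (\<epsilon> / 2 * real m))"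
        using T0 by (simp add: powr_power mult.commute)
    qed
    have small: "(T / Y) ^ m * T ^ n * Y \<le> 1"
    proof -
      have "(T / Y) ^ m * T ^ n * Y = T powr (- (\<epsilon> / 2 * real m)) * T powr real n * T powr (1 + \<epsilon> / 2)"
        using T0 unfolding TY by (simp add: Y_def powr_realpow)
      also have "\<dots> = T powr (real n + 1 + \<epsilon> / 2 - \<epsilon> / 2 * real m)"
        unfolding powr_add[symmetric] by (simp add: algebra_simps)
      also have "\<dots> \<le> T powr 0" using T m by (intro powr_mono) auto
      finally show ?thesis using T0 by simp
    qed
    have small2: "Y * (Y / X) ^ m \<le> 1"
    proof -
      have "Y * (Y / X) ^ m = T powr (1 + \<epsilon> / 2) * T powr (- (\<epsilon> / 2 * real m))"
        unfolding YX by (simp add: Y_def)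
      also have "\<dots> = T powr (1 + \<epsilon> / 2 - \<epsilon> / 2 * real m)"
        unfolding powr_add[symmetric] by simp
      also have "\<dots> \<le> T powr 0" using T m by (intro powr_mono) auto
      finally show ?thesis using T0 by simp
    qed
    \<comment> \<open>Since \<open>ln 2 < 1\<close>, the dyadic block fits into an interval of
      length 1, as the local Plancherel inequality requires.\<close>
    have lnT: "ln T \<le> ln (2 * T)" "ln (2 * T) \<le> ln T + 1"
      using T0 ln_2_less_1 by (auto simp: ln_mult)
    have "(\<integral>u. indicator {ln T..ln (2 * T)} u * (?G u)\<^sup>2 \<partial>lborel) \<le>
        (real m + 1) * (((T / Y) ^ m * (C * T ^ n + 1) * Y * A)\<^sup>2 + real m * 4 ^ m * (c0 *
         ((\<integral>t. indicator {-X..X} t * (norm (fourier ?G t))\<^sup>2 \<partial>lborel) + L\<^sup>2 * gauss_moment m * Y * (Y / X) ^ m)))"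
      unfolding A_def L_def c0_def
    proof (rule local_L2_bound[OF G integrable_E2_weight_square m0 T0 Y1 X0 _ lnT])
      show "C * T ^ n \<ge> 0" using C(1) T0 by simp
    qed (use T1 \<sigma> C(2,3)[OF T] m0 in auto)
    also have "\<dots> \<le> (real m + 1) * (((C + 1) * A)\<^sup>2 + real m * 4 ^ m * (c0 * (c1 * (1 + J T) + L\<^sup>2 * gauss_moment m)))"
    proof (intro mult_left_mono add_mono power_mono)
      have "(T / Y) ^ m * (C * T ^ n + 1) * Y \<le> (T / Y) ^ m * ((C + 1) * T ^ n) * Y"
        using one_le_power[OF T1, of n] T0 Y1 by (intro mult_right_mono mult_left_mono) (auto simp: algebra_simps)
      also have "\<dots> = (C + 1) * ((T / Y) ^ m * T ^ n * Y)" by simp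
      also have "\<dots> \<le> (C + 1) * 1" using C(1) small by (intro mult_left_mono) auto
      finally show "(T / Y) ^ m * (C * T ^ n + 1) * Y * A \<le> (C + 1) * A"
        using A0 by (intro mult_right_mono) auto
      show "0 \<le> (T / Y) ^ m * (C * T ^ n + 1) * Y * A"
        using T0 Y1 A0 C(1) by (intro mult_nonneg_nonneg) auto
      show "(\<integral>t. indicator {-X..X} t * (norm (fourier ?G t))\<^sup>2 \<partial>lborel) \<le> c1 * (1 + J T)"
        unfolding c1_def J_def X_def by (rule fourier_E2_weight_L2(1)[OF K \<sigma>]) auto
      have "L\<^sup>2 * gauss_moment m * (Y * (Y / X) ^ m) \<le> L\<^sup>2 * gauss_moment m * 1"
        using gauss_moment_nonneg[of m] by (intro mult_left_mono small2) auto
      thus "L\<^sup>2 * gauss_moment m * Y * (Y / X) ^ m \<le> L\<^sup>2 * gauss_moment m" by (simp add: mult.assoc)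
    qed (use c0 in auto)
    also have "\<dots> \<le> D * (1 + J T)"
    proof -
      \<comment> \<open>Because \<open>1 + J T \<ge> 1\<close>, the bounded terms are absorbed into
        \<open>D * (1 + J T)\<close>, with \<open>D\<close> independent of \<open>T\<close>.\<close>
      have "x \<le> x * (1 + J T)" if "x \<ge> 0" for x using that J0 by (simp add: algebra_simps)
      note le = this
      have "((C + 1) * A)\<^sup>2 + real m * 4 ^ m * (c0 * (c1 * (1 + J T) + L\<^sup>2 * gauss_moment m))
          \<le> ((C + 1) * A)\<^sup>2 * (1 + J T) + real m * 4 ^ m * (c0 * (c1 * (1 + J T) + L\<^sup>2 * gauss_moment m * (1 + J T)))"
        using c0 gauss_moment_nonneg[of m] by (intro add_mono mult_left_mono order.refl le) auto
      also have "\<dots> = (((C + 1) * A)\<^sup>2 + real m * 4 ^ m * (c0 * (c1 + L\<^sup>2 * gauss_moment m))) * (1 + J T)"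
        by (simp only: distrib_right distrib_left mult.assoc)
      finally show ?thesis unfolding D_def mult.assoc by (intro mult_left_mono) (auto simp: mult.assoc)
    qed
    finally have loc: "(\<integral>u. indicator {ln T..ln (2 * T)} u * (?G u)\<^sup>2 \<partial>lborel) \<le> D * (1 + J T)" .
    have "integral {T..2*T} (\<lambda>t. E2 P t ^ 4) \<le>
        (2 * T) powr (2 * \<sigma> + 1) * (\<integral>u. indicator {ln T..ln (2 * T)} u * (?G u)\<^sup>2 \<partial>lborel)"
      using T1 \<sigma> by (intro E2_fourth_moment_le) auto
    also have "\<dots> \<le> (2 * T) powr (2 * \<sigma> + 1) * (D * (1 + J T))"
      by (intro mult_left_mono loc) auto
    also have "\<dots> = 2 powr (2 * \<sigma> + 1) * D * (T powr (2 * \<sigma> + 1) * (1 + J T))"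
      using T0 by (simp add: powr_mult)
    finally show "integral {T..2*T} (\<lambda>t. E2 P t ^ 4) \<le> 2 powr (2 * \<sigma> + 1) * D * (T powr (2 * \<sigma> + 1) * (1 + J T))" .
  qed
  have "(\<lambda>T. integral {T..2*T} (\<lambda>t. E2 P t ^ 4)) \<in> O[at_top](\<lambda>T. T powr (2 * \<sigma> + 1) * (1 + J T))"
  proof (rule bigoI[where c = "2 powr (2 * \<sigma> + 1) * D"])
    show "\<forall>\<^sub>F T in at_top. norm (integral {T..2*T} (\<lambda>t. E2 P t ^ 4)) \<le> 2 powr (2 * \<sigma> + 1) * D * norm (T powr (2 * \<sigma> + 1) * (1 + J T))"
      using eventually_ge_at_top[of 2]
    proof eventually_elim
      case (elim T)
      have "integral {T..2*T} (\<lambda>t. E2 P t ^ 4) \<ge> 0"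
        using elim by (intro Henstock_Kurzweil_Integration.integral_nonneg integrable_continuous_real
            continuous_intros continuous_on_subset[OF continuous_on_E2]) auto
      thus ?case using main[OF elim] J0[OF elim] by (simp add: abs_mult)
    qed
  qed
  thus ?thesis by (simp add: J_def)
qed

end
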